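(* Let $S$ be a finite quantum stop time. If the isometric $p$-adapted cocycle $V$ is strongly continuous (i.e., $r \mapsto V_r$ is strongly continuous on $\mathbb{R}_+$) then $$V_S = V_{S,\infty} := \lim_{t \to \infty} V_{S,t},$$ with the limit taken in the strong operator topology on $B(\mathsf{h} \otimes \mathcal{F})$, is well defined.
   Context: Fock space. Fix a complex Hilbert space $\mathsf{k}$. Inner products are linear in the second variable. $B(H)$ denotes the bounded operators on a Hilbert space $H$. For a subinterval $A$ of $\mathbb{R}_+ = [0,\infty)$, $\mathcal{F}_A$ is the Boson (symmetric) Fock space over $L^2(A;\mathsf{k})$, with exponential vectors $\varepsilon(f)$, $f \in L^2(A;\mathsf{k})$, which are total and satisfy $\langle \varepsilon(f), \varepsilon(g)\rangle = \exp\langle f,g\rangle$. Write $\mathcal{F} = \mathcal{F}_{\mathbb{R}_+}$, $\mathcal{F}_{t)} = \mathcal{F}_{[0,t)}$, $\mathcal{F}_{[t} = \mathcal{F}_{[t,\infty)}$, with identity operators $I$, $I_{t)}$, $I_{[t}$ (so $\mathcal{F}_{0)} = \mathbb{C}$), and identify $\mathcal{F} \cong \mathcal{F}_{s)} \otimes \mathcal{F}_{[s}$ via $\varepsilon(f) \leftrightarrow \varepsilon(f|_{[0,s)}) \otimes \varepsilon(f|_{[s,\infty)})$. Stop times. A finite quantum stop time is a map $S$ from the Borel $\sigma$-algebra of $[0,\infty]$ to $B(\mathcal{F})$ such that: each $S(A)$ is an orthogonal projection; $A \mapsto \langle x, S(A) y\rangle$ is a complex measure for all $x,y \in \mathcal{F}$;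 $S([0,\infty]) = I$; $S([0,t]) \in B(\mathcal{F}_{t)}) \otimes I_{[t}$ for all $t \in (0,\infty)$; $S(\{0\}) = 0$; and $S(\{\infty\}) = 0$ (finiteness). Let $\mathsf{h}$ be a complex Hilbert space; $S$ is extended by ampliation to $\mathsf{h} \otimes \mathcal{F}$, i.e., $S(A)$ also denotes $I_{\mathsf{h}} \otimes S(A)$. CCR flow. For $t \in \mathbb{R}_+$, $\Gamma_t : \mathcal{F} \to \mathcal{F}$ is the isometry with $\Gamma_t\varepsilon(f) = \varepsilon(\theta_t f)$, where $(\theta_t f)(s) = f(s-t)$ if $s \ge t$ and $0$ if $s<t$; it is regarded as an isometric isomorphism of $\mathcal{F}$ onto $\mathcal{F}_{[t} \cong \varepsilon(0|_{[0,t)}) \otimes \mathcal{F}_{[t}$. Put $\sigma_t(X) = I_{t)} \otimes \Gamma_t X \Gamma_t^*$ for $X \in B(\mathcal{F})$, extended by ampliation to a normal unital $*$-endomorphism of $B(\mathsf{h} \otimes \mathcal{F})$ acting trivially on $B(\mathsf{h})$. Cocycles. Let $\mathcal{M} \subseteq B(\mathsf{h})$ be a von Neumann algebra and $\overline{\otimes}$ the ultraweak tensor product. Let $p \in B(\mathsf{k})$ be an orthogonal projection, acting pointwise on $L^2([t,\infty);\mathsf{k})$, and let $P_{[t} \in B(\mathcal{F}_{[t})$ be its second quantisation: $P_{[t}\varepsilon(f) = \varepsilon(pf)$. A family $V = (V_t)_{t \in \mathbb{R}_+} \subseteq \mathcal{M} \,\overline{\otimes}\, B(\mathcal{F})$ is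 a $p$-adapted process if $V_t = V_{t)} \otimes P_{[t}$ for all $t \in \mathbb{R}_+$, with $V_{t)} \in \mathcal{M} \,\overline{\otimes}\, B(\mathcal{F}_{t)})$; put $\widehat{V}_t := V_{t)} \otimes I_{[t}$. A $p$-adapted process $V$ is a cocycle if $V_{s+t} = \widehat{V}_s\, \sigma_s(V_t)$ for all $s,t \in \mathbb{R}_+$. It is isometric if $V_{t)}^* V_{t)} = I_{\mathsf{h}} \otimes I_{t)}$ for all $t \in \mathbb{R}_+$. Stopping at finite horizon. For a strongly continuous isometric $p$-adapted cocycle $V$ and $t \in (0,\infty)$, $V_{S,t}$ is the strong operator limit of $\sum_{j=1}^{n+1} V_{\pi_j} S((\pi_{j-1},\pi_j])$ over finite partitions $\pi = \{0 = \pi_0 < \cdots < \pi_{n+1} = t\}$ of $[0,t]$ ordered by refinement; this limit exists. *)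

theory Defs
  imports "HOL-Analysis.Analysis"
begin

section \<open>Complex Hilbert spaces and their bounded operators\<close>

text \<open>Inner products are linear in the second variable.  The remaining vector space laws, positivity
  and definiteness of the inner product follow from those of the real Banach space structure.\<close>

class chilbert_space = banach +
  fixes scaleC :: "complex \<Rightarrow> 'a \<Rightarrow> 'a"
    and cinner :: "'a \<Rightarrow> 'a \<Rightarrow> complex"
  assumes scaleC_of_real: "scaleC (complex_of_real r) x = r *\<^sub>R x"
    and scaleC_add_right: "scaleC c (x + y) = scaleC c x + scaleC c y"
    and scaleC_add_left: "scaleC (c + d) x = scaleC c x + scaleC d x"
    and scaleC_scaleC: "scaleC c (scaleC d x) = scaleC (c * d) x"
    and cinner_commute: "cinner x y = cnj (cinner y x)"
    and cinner_add_right: "cinner x (y + z) = cinner x y + cinner x z"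
    and cinner_scaleC_right: "cinner x (scaleC c y) = c * cinner x y"
    and cinner_self: "cinner x x = complex_of_real ((norm x)\<^sup>2)"

lemma vector_space_scaleC: "vector_space (scaleC :: complex \<Rightarrow> 'a \<Rightarrow> 'a::chilbert_space)"
proof
  show "scaleC 1 x = x" for x :: 'a
    using scaleC_of_real[of 1 x] by simp
qed (simp_all add: scaleC_add_right scaleC_add_left scaleC_scaleC)

abbreviation cspan :: "'a::chilbert_space set \<Rightarrow> 'a set" where
  "cspan \<equiv> module.span scaleC"

text \<open>\<open>bop D\<close> is \<open>B(D)\<close> for a closed subspace \<open>D\<close>; in particular \<open>bop UNIV\<close> is the set of all bounded
  operators.  For proper \<open>D\<close>, the values of its members outside \<open>D\<close> are irrelevant: functions which
  agree on \<open>D\<close> represent the same operator.\<close>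

definition bop :: "'a::chilbert_space set \<Rightarrow> ('a \<Rightarrow> 'a) set" where
  "bop D = {T. (\<forall>x\<in>D. T x \<in> D) \<and> (\<forall>x\<in>D. \<forall>y\<in>D. T (x + y) = T x + T y) \<and>
     (\<forall>c. \<forall>x\<in>D. T (scaleC c x) = scaleC c (T x)) \<and> (\<exists>K. \<forall>x\<in>D. norm (T x) \<le> K * norm x)}"

text \<open>The adjoint of a bounded operator on the closed subspace \<open>D\<close>.\<close>

definition adj :: "'a::chilbert_space set \<Rightarrow> ('a \<Rightarrow> 'a) \<Rightarrow> 'a \<Rightarrow> 'a" where
  "adj D T y = (THE x. x \<in> D \<and> (\<forall>z\<in>D. cinner x z = cinner y (T z)))"

definition orth_projection :: "('a::chilbert_space \<Rightarrow> 'a) \<Rightarrow> bool" where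
  "orth_projection P \<longleftrightarrow> P \<in> bop UNIV \<and> P \<circ> P = P \<and> (\<forall>x y. cinner (P x) y = cinner x (P y))"

definition commutant :: "('a::chilbert_space \<Rightarrow> 'a) set \<Rightarrow> ('a \<Rightarrow> 'a) set" where
  "commutant M = {T \<in> bop UNIV. \<forall>X\<in>M. T \<circ> X = X \<circ> T}"

definition von_neumann_algebra :: "('a::chilbert_space \<Rightarrow> 'a) set \<Rightarrow> bool" where
  "von_neumann_algebra M \<longleftrightarrow>
     M \<subseteq> bop UNIV \<and> (\<forall>X\<in>M. adj UNIV X \<in> M) \<and> commutant (commutant M) = M"

text \<open>The ultraweak topology on \<open>B(D)\<close> is the one induced by the functionals
  \<open>T \<mapsto> \<Sum>n. \<langle>\<xi> n, T (\<eta> n)\<rangle>\<close> with \<open>\<xi>\<close>, \<open>\<eta>\<close> square-summable sequences in \<open>D\<close>.\<close>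

definition sq_summable_seqs :: "'a::chilbert_space set \<Rightarrow> (nat \<Rightarrow> 'a) set" where
  "sq_summable_seqs D = {\<xi>. range \<xi> \<subseteq> D \<and> summable (\<lambda>n. (norm (\<xi> n))\<^sup>2)}"

definition ultraweak_closure ::
  "'a::chilbert_space set \<Rightarrow> ('a \<Rightarrow> 'a) set \<Rightarrow> ('a \<Rightarrow> 'a) set" where
  "ultraweak_closure D C = {T \<in> bop D.
     \<forall>\<Omega>. finite \<Omega> \<and> \<Omega> \<subseteq> sq_summable_seqs D \<times> sq_summable_seqs D \<longrightarrow>
       (\<forall>e>0. \<exists>R\<in>C. \<forall>(\<xi>, \<eta>)\<in>\<Omega>. cmod (\<Sum>n. cinner (\<xi> n) (T (\<eta> n) - R (\<eta> n))) < e)}"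


section \<open>Hilbert space tensor products\<close>

text \<open>A map \<open>T\<close> exhibits the ambient space of its values as the Hilbert space tensor product of the
  closed subspaces \<open>D\<close> and \<open>E\<close> when \<open>T x y\<close> behaves as \<open>x \<otimes> y\<close>: the elementary tensors have the
  right inner products and are total.  This determines the tensor product up to unique unitary
  equivalence; bilinearity of \<open>T\<close> on \<open>D \<times> E\<close> is a consequence.\<close>

definition tensor_space ::
  "'a set \<Rightarrow> 'b set \<Rightarrow> ('a \<Rightarrow> 'b \<Rightarrow> 'c::chilbert_space) \<Rightarrow> 'c set" where
  "tensor_space D E T = closure (cspan {T x y | x y. x \<in> D \<and> y \<in> E})"

definition hilbert_tensor ::
  "'a::chilbert_space set \<Rightarrow> 'b::chilbert_space set \<Rightarrow> ('a \<Rightarrow> 'b \<Rightarrow> 'c::chilbert_space) \<Rightarrow> bool" where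
  "hilbert_tensor D E T \<longleftrightarrow>
     (\<forall>x\<in>D. \<forall>x'\<in>D. \<forall>y\<in>E. \<forall>y'\<in>E. cinner (T x y) (T x' y') = cinner x x' * cinner y y') \<and>
     tensor_space D E T = UNIV"

text \<open>\<open>Z\<close> is the operator \<open>A \<otimes> B\<close>, with tensor products of vectors formed by \<open>T\<close>.\<close>

definition is_op_tensor ::
  "'a::chilbert_space set \<Rightarrow> 'b::chilbert_space set \<Rightarrow> ('a \<Rightarrow> 'b \<Rightarrow> 'c::chilbert_space) \<Rightarrow>
   ('a \<Rightarrow> 'a) \<Rightarrow> ('b \<Rightarrow> 'b) \<Rightarrow> ('c \<Rightarrow> 'c) \<Rightarrow> bool" where
  "is_op_tensor D E T A B Z \<longleftrightarrow>
     Z \<in> bop (tensor_space D E T) \<and> (\<forall>x\<in>D. \<forall>y\<in>E. Z (T x y) = T (A x) (B y))"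

text \<open>Well defined on \<open>tensor_space D E T\<close>, which is all that matters.\<close>

definition op_tensor ::
  "'a::chilbert_space set \<Rightarrow> 'b::chilbert_space set \<Rightarrow> ('a \<Rightarrow> 'b \<Rightarrow> 'c::chilbert_space) \<Rightarrow>
   ('a \<Rightarrow> 'a) \<Rightarrow> ('b \<Rightarrow> 'b) \<Rightarrow> 'c \<Rightarrow> 'c" where
  "op_tensor D E T A B = (SOME Z. is_op_tensor D E T A B Z)"


section \<open>Square-integrable functions\<close>

text \<open>Strong measurability in the sense of Bochner, since \<open>'k\<close> need not be separable.  The elements of
  \<open>L2 A\<close> are representatives, extended by zero outside \<open>A\<close>; every class has such an everywhere
  Borel representative.\<close>

definition L2 :: "real set \<Rightarrow> (real \<Rightarrow> 'k::chilbert_space) set" where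
  "L2 A = {f. (\<exists>s. (\<forall>n. simple_function lborel (s n)) \<and> (\<forall>r. (\<lambda>n. s n r) \<longlonglongrightarrow> f r)) \<and>
     integrable lborel (\<lambda>r. (norm (f r))\<^sup>2) \<and> (\<forall>r. r \<notin> A \<longrightarrow> f r = 0)}"

definition l2_inner :: "(real \<Rightarrow> 'k::chilbert_space) \<Rightarrow> (real \<Rightarrow> 'k) \<Rightarrow> complex" where
  "l2_inner f g = (LINT r|lborel. cinner (f r) (g r))"

definition cut :: "real set \<Rightarrow> (real \<Rightarrow> 'k::chilbert_space) \<Rightarrow> real \<Rightarrow> 'k" where
  "cut A f r = (if r \<in> A then f r else 0)"

definition shift :: "real \<Rightarrow> (real \<Rightarrow> 'k::chilbert_space) \<Rightarrow> real \<Rightarrow> 'k" where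
  "shift t f r = (if r \<ge> t then f (r - t) else 0)"


section \<open>Fock space and quantum stop times\<close>

text \<open>\<open>'f\<close> is the symmetric Fock space over \<open>L\<^sup>2(\<real>\<^sub>+; 'k)\<close>, given through its exponential vectors
  \<open>eps f\<close>, whose two properties below determine it up to unique unitary equivalence.\<close>

locale fock_space =
  fixes eps :: "(real \<Rightarrow> 'k::chilbert_space) \<Rightarrow> 'f::chilbert_space"
  assumes cinner_eps:
      "\<And>f g. f \<in> L2 {0..} \<Longrightarrow> g \<in> L2 {0..} \<Longrightarrow> cinner (eps f) (eps g) = exp (l2_inner f g)"
    and total_eps: "closure (cspan (eps ` L2 {0..})) = UNIV"
begin

text \<open>The Fock space over \<open>L\<^sup>2(A; 'k)\<close>, realised inside \<open>'f\<close> through extension of functions by zero.\<close>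

definition fock :: "real set \<Rightarrow> 'f set" where
  "fock A = closure (cspan (eps ` L2 A))"

text \<open>The identification of \<open>'f\<close> with the tensor product of \<open>fock {0..<s}\<close> and \<open>fock {s..}\<close>, as the map
  \<open>(x, y) \<mapsto> x \<otimes> y\<close>; it is unique on \<open>fock {0..<s} \<times> fock {s..}\<close>.\<close>

definition fock_split :: "real \<Rightarrow> 'f \<Rightarrow> 'f \<Rightarrow> 'f" where
  "fock_split s = (SOME T. hilbert_tensor (fock {0..<s}) (fock {s..}) T \<and>
     (\<forall>f\<in>L2 {0..}. T (eps (cut {0..<s} f)) (eps (cut {s..} f)) = eps f))"

text \<open>The bounded operator \<open>eps f \<mapsto> eps (C f)\<close>, defined on \<open>fock A\<close>.\<close>

definition second_quant :: "real set \<Rightarrow> ((real \<Rightarrow> 'k) \<Rightarrow> real \<Rightarrow> 'k) \<Rightarrow> 'f \<Rightarrow> 'f" where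
  "second_quant A C = (SOME T. T \<in> bop (fock A) \<and> (\<forall>f\<in>L2 A. T (eps f) = eps (C f)))"

definition fock_shift :: "real \<Rightarrow> 'f \<Rightarrow> 'f" where
  "fock_shift t = second_quant {0..} (shift t)"

definition fock_proj :: "('k \<Rightarrow> 'k) \<Rightarrow> real \<Rightarrow> 'f \<Rightarrow> 'f" where
  "fock_proj p t = second_quant {t..} (\<lambda>f r. p (f r))"

text \<open>The type \<^typ>\<open>ennreal\<close> is the interval \<open>[0, \<infinity>]\<close>.\<close>

definition finite_stop_time :: "(ennreal set \<Rightarrow> 'f \<Rightarrow> 'f) \<Rightarrow> bool" where
  "finite_stop_time S \<longleftrightarrow>
     (\<forall>A\<in>sets borel. orth_projection (S A)) \<and>
     (\<forall>x y. \<forall>A :: nat \<Rightarrow> ennreal set. range A \<subseteq> sets borel \<and> disjoint_family A \<longrightarrow>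
        (\<lambda>n. cinner x (S (A n) y)) sums cinner x (S (\<Union>n. A n) y)) \<and>
     S UNIV = (\<lambda>x. x) \<and>
     (\<forall>t>0. \<exists>A\<in>bop (fock {0..<t}).
        is_op_tensor (fock {0..<t}) (fock {t..}) (fock_split t) A (\<lambda>y. y) (S {0..ennreal t})) \<and>
     S {0} = (\<lambda>x. 0) \<and> S {\<infinity>} = (\<lambda>x. 0)"

end


section \<open>Cocycles\<close>

text \<open>\<open>'g\<close> is the tensor product of \<open>'h\<close> and Fock space.\<close>

locale ampliated_fock_space = fock_space eps
  for eps :: "(real \<Rightarrow> 'k::chilbert_space) \<Rightarrow> 'f::chilbert_space" +
  fixes tens :: "'h::chilbert_space \<Rightarrow> 'f \<Rightarrow> 'g::chilbert_space"
  assumes hilbert_tensor_tens: "hilbert_tensor UNIV UNIV tens"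
begin

text \<open>The subspace \<open>'h \<otimes> fock A\<close>.\<close>

definition amp_fock :: "real set \<Rightarrow> 'g set" where
  "amp_fock A = tensor_space UNIV (fock A) tens"

text \<open>The two bracketings of \<open>'h \<otimes> (fock {0..<t} \<otimes> fock {t..})\<close>: its identification with
  \<open>('h \<otimes> fock {0..<t}) \<otimes> fock {t..}\<close> and with \<open>fock {0..<t} \<otimes> ('h \<otimes> fock {t..})\<close>.\<close>

definition amp_split_past :: "real \<Rightarrow> 'g \<Rightarrow> 'f \<Rightarrow> 'g" where
  "amp_split_past t = (SOME T. hilbert_tensor (amp_fock {0..<t}) (fock {t..}) T \<and>
     (\<forall>u. \<forall>x\<in>fock {0..<t}. \<forall>y\<in>fock {t..}. T (tens u x) y = tens u (fock_split t x y)))"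

definition amp_split_future :: "real \<Rightarrow> 'f \<Rightarrow> 'g \<Rightarrow> 'g" where
  "amp_split_future t = (SOME T. hilbert_tensor (fock {0..<t}) (amp_fock {t..}) T \<and>
     (\<forall>u. \<forall>x\<in>fock {0..<t}. \<forall>y\<in>fock {t..}. T x (tens u y) = tens u (fock_split t x y)))"

definition ampliation :: "('f \<Rightarrow> 'f) \<Rightarrow> 'g \<Rightarrow> 'g" where
  "ampliation Y = op_tensor UNIV UNIV tens (\<lambda>u. u) Y"

text \<open>The algebraic tensor product of \<open>M\<close> with \<open>B(fock A)\<close> and its ultraweak closure.\<close>

definition alg_tensor :: "('h \<Rightarrow> 'h) set \<Rightarrow> real set \<Rightarrow> ('g \<Rightarrow> 'g) set" where
  "alg_tensor M A = {R. \<exists>(n::nat) X Y. (\<forall>i<n. X i \<in> M \<and> Y i \<in> bop (fock A)) \<and>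
     R = (\<lambda>z. \<Sum>i<n. op_tensor UNIV (fock A) tens (X i) (Y i) z)}"

definition vn_tensor :: "('h \<Rightarrow> 'h) set \<Rightarrow> real set \<Rightarrow> ('g \<Rightarrow> 'g) set" where
  "vn_tensor M A = ultraweak_closure (amp_fock A) (alg_tensor M A)"

text \<open>The CCR flow on \<open>B('h \<otimes> 'f)\<close>: \<open>X \<mapsto> I \<otimes> \<Gamma> X \<Gamma>\<^sup>*\<close>, where \<open>I\<close> acts on \<open>fock {0..<t}\<close> and \<open>\<Gamma>\<close> is the
  ampliation of \<open>fock_shift t\<close>, with range \<open>'h \<otimes> fock {t..}\<close>.\<close>

definition ccr_flow :: "real \<Rightarrow> ('g \<Rightarrow> 'g) \<Rightarrow> 'g \<Rightarrow> 'g" where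
  "ccr_flow t X = (let \<Gamma> = ampliation (fock_shift t) in
     op_tensor (fock {0..<t}) (amp_fock {t..}) (amp_split_future t) (\<lambda>x. x) (\<Gamma> \<circ> X \<circ> adj UNIV \<Gamma>))"

text \<open>\<open>is_past_part p t X W\<close> says \<open>X = W \<otimes> P\<close>, where \<open>P\<close> is the second quantisation of \<open>p\<close> on
  \<open>fock {t..}\<close>.  As \<open>P \<noteq> 0\<close>, this determines \<open>W\<close> on \<open>'h \<otimes> fock {0..<t}\<close>.\<close>

definition is_past_part :: "('k \<Rightarrow> 'k) \<Rightarrow> real \<Rightarrow> ('g \<Rightarrow> 'g) \<Rightarrow> ('g \<Rightarrow> 'g) \<Rightarrow> bool" where
  "is_past_part p t X W \<longleftrightarrow> W \<in> bop (amp_fock {0..<t}) \<and>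
     is_op_tensor (amp_fock {0..<t}) (fock {t..}) (amp_split_past t) W (fock_proj p t) X"

definition past_part :: "('k \<Rightarrow> 'k) \<Rightarrow> (real \<Rightarrow> 'g \<Rightarrow> 'g) \<Rightarrow> real \<Rightarrow> 'g \<Rightarrow> 'g" where
  "past_part p V t = (SOME W. is_past_part p t (V t) W)"

definition hat :: "('k \<Rightarrow> 'k) \<Rightarrow> (real \<Rightarrow> 'g \<Rightarrow> 'g) \<Rightarrow> real \<Rightarrow> 'g \<Rightarrow> 'g" where
  "hat p V t =
     op_tensor (amp_fock {0..<t}) (fock {t..}) (amp_split_past t) (past_part p V t) (\<lambda>y. y)"

definition adapted_process ::
  "('h \<Rightarrow> 'h) set \<Rightarrow> ('k \<Rightarrow> 'k) \<Rightarrow> (real \<Rightarrow> 'g \<Rightarrow> 'g) \<Rightarrow> bool" where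
  "adapted_process M p V \<longleftrightarrow>
     (\<forall>t\<ge>0. V t \<in> vn_tensor M {0..} \<and> (\<exists>W\<in>vn_tensor M {0..<t}. is_past_part p t (V t) W))"

definition adapted_cocycle ::
  "('h \<Rightarrow> 'h) set \<Rightarrow> ('k \<Rightarrow> 'k) \<Rightarrow> (real \<Rightarrow> 'g \<Rightarrow> 'g) \<Rightarrow> bool" where
  "adapted_cocycle M p V \<longleftrightarrow> adapted_process M p V \<and>
     (\<forall>s\<ge>0. \<forall>t\<ge>0. V (s + t) = hat p V s \<circ> ccr_flow s (V t))"

definition isometric_process :: "('k \<Rightarrow> 'k) \<Rightarrow> (real \<Rightarrow> 'g \<Rightarrow> 'g) \<Rightarrow> bool" where
  "isometric_process p V \<longleftrightarrow> (\<forall>t\<ge>0. \<forall>x\<in>amp_fock {0..<t}.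
     adj (amp_fock {0..<t}) (past_part p V t) (past_part p V t x) = x)"

definition strongly_continuous :: "(real \<Rightarrow> 'g \<Rightarrow> 'g) \<Rightarrow> bool" where
  "strongly_continuous V \<longleftrightarrow> (\<forall>x. continuous_on {0..} (\<lambda>r. V r x))"


section \<open>Stopping\<close>

text \<open>A finite partition of \<open>[0, t]\<close> is represented by the finite set \<open>Q\<close> of its points in the open
  interval \<open>(0, t)\<close>, so that refinement is inclusion.\<close>

definition stop_sum ::
  "(real \<Rightarrow> 'g \<Rightarrow> 'g) \<Rightarrow> (ennreal set \<Rightarrow> 'f \<Rightarrow> 'f) \<Rightarrow> real \<Rightarrow> real set \<Rightarrow> 'g \<Rightarrow> 'g" where
  "stop_sum V S t Q x = (let \<pi> = sorted_list_of_set (insert 0 (insert t Q)) in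
     \<Sum>j=1..<length \<pi>. V (\<pi> ! j) (ampliation (S {ennreal (\<pi> ! (j - 1))<..ennreal (\<pi> ! j)}) x))"

definition stopped_at ::
  "(real \<Rightarrow> 'g \<Rightarrow> 'g) \<Rightarrow> (ennreal set \<Rightarrow> 'f \<Rightarrow> 'f) \<Rightarrow> real \<Rightarrow> 'g \<Rightarrow> 'g" where
  "stopped_at V S t x = Lim (finite_subsets_at_top {0<..<t}) (\<lambda>Q. stop_sum V S t Q x)"

definition stopped ::
  "(real \<Rightarrow> 'g \<Rightarrow> 'g) \<Rightarrow> (ennreal set \<Rightarrow> 'f \<Rightarrow> 'f) \<Rightarrow> 'g \<Rightarrow> 'g" where
  "stopped V S x = Lim at_top (\<lambda>t. stopped_at V S t x)"

end

end

theory Submission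
  imports Defs
begin

text \<open>Write \<open>Q\<^sub>r\<close> for \<open>S([0, r])\<close>.  The cocycle identity gives \<open>V\<^sub>s = H\<^sub>c (I \<otimes> Y\<^sub>s)\<close> for all \<open>s \<ge> c\<close>, with
  \<open>H\<^sub>c\<close> an isometry and \<open>Y\<^sub>s\<close> acting on the future of \<open>c\<close>, whereas \<open>Q\<^sub>c\<close> acts on the past of \<open>c\<close>.  Hence
  \<open>\<langle>V\<^sub>s Q\<^sub>c x, V\<^sub>t y\<rangle> = \<langle>V\<^sub>s x, V\<^sub>t Q\<^sub>c y\<rangle>\<close> for \<open>s, t \<ge> c\<close>, so that the summands of a stopping sum are
  orthogonal and its norm is controlled by that of \<open>V\<close>, which is bounded uniformly in time.

  On \<open>x = u \<otimes> \<epsilon>(f)\<close> the increments \<open>E = S((a, b])\<close> satisfy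
  \<open>\<parallel>(V\<^sub>b - V\<^sub>t) E x\<parallel> \<parallel>x\<parallel> = \<parallel>E x\<parallel> \<parallel>(V\<^sub>b - V\<^sub>t) x\<parallel>\<close> for \<open>t \<ge> b\<close>.  By orthogonality, the distance of two
  stopping sums at \<open>x\<close> is at most the modulus of continuity of \<open>r \<mapsto> V\<^sub>r x\<close> at the mesh of the coarser
  partition, whence convergence at finite horizon.  For \<open>s < t\<close>, orthogonality also yields
  \<open>\<parallel>V\<^sub>S\<^sub>,\<^sub>t x - V\<^sub>S\<^sub>,\<^sub>s x\<parallel>\<^sup>2 \<le> K\<^sup>2 (\<parallel>Q\<^sub>t x\<parallel>\<^sup>2 - \<parallel>Q\<^sub>s x\<parallel>\<^sup>2)\<close>, and \<open>\<parallel>Q\<^sub>t x\<parallel>\<close> is increasing and bounded in \<open>t\<close>.\<close>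

section \<open>Complex inner product spaces\<close>

text \<open>\<open>V\<^sub>t\<close> itself need not be isometric, since the second quantised
  \<open>p\<close> acts on the future of \<open>t\<close>; what preserves inner products is
  \<open>H\<^sub>c\<close>, which is \<open>hat p V c\<close>. Taking \<open>c = s\<close> in the
  factorisation gives \<open>\<parallel>V\<^sub>s z\<parallel> =
  \<parallel>\<sigma>\<^sub>s(V\<^sub>0) z\<parallel>\<close>, so a bound \<open>K\<close> of
  \<open>V\<^sub>0\<close> serves at all times. The identity for increments rests on the exponential
  form of \<open>x\<close>: for every \<open>c\<close> it is a product \<open>a \<otimes> w\<close>
  over the past and the future of \<open>c\<close>. Here \<open>Q\<^sub>c\<close> changes only
  \<open>a\<close>, while \<open>V\<^sub>s - V\<^sub>t\<close> is, up to \<open>H\<^sub>c\<close>,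
  felt only by \<open>w\<close>. General vectors do not factorise, so convergence is shown on this
  total set and spread by the bound \<open>K\<close>, which does not depend on the partition. The
  obstacle is that tensor products, second quantisations and adjoints enter through
  \<open>SOME\<close> or \<open>THE\<close>: nothing is known of them until some object with the
  defining property is built. Hence the work on extending maps from total families; for
  \<open>I \<otimes> Y\<close> the needed norm bound is an instance of Schur's product
  theorem.\<close>

interpretation complex_vector: vector_space "scaleC :: complex \<Rightarrow> 'a \<Rightarrow> 'a::chilbert_space"
  by (rule vector_space_scaleC)

lemma cinner_add_left: "cinner (x + y) z = cinner x z + cinner (y::'a::chilbert_space) z"
  by (metis cinner_add_right cinner_commute complex_cnj_add)

lemma cinner_scaleC_left: "cinner (scaleC c x) z = cnj c * cinner (x::'a::chilbert_space) z"
  by (metis cinner_scaleC_right cinner_commute complex_cnj_mult)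

lemma scaleC_minus_one: "scaleC (-1) x = - (x::'a::chilbert_space)"
  by simp

lemma cinner_zero_left [simp]: "cinner 0 (x::'a::chilbert_space) = 0"
  using cinner_add_left[of 0 0 x] by simp

lemma cinner_zero_right [simp]: "cinner (x::'a::chilbert_space) 0 = 0"
  using cinner_add_right[of x 0 0] by simp

lemma cinner_minus_left: "cinner (- x) (y::'a::chilbert_space) = - cinner x y"
  using cinner_add_left[of x "- x" y] by (simp add: eq_neg_iff_add_eq_0 add.commute)

lemma cinner_minus_right: "cinner x (- y::'a::chilbert_space) = - cinner x y"
  using cinner_add_right[of x y "- y"] by (simp add: eq_neg_iff_add_eq_0 add.commute)

lemma cinner_diff_left: "cinner (x - y) z = cinner x z - cinner (y::'a::chilbert_space) z"
  using cinner_add_left[of x "- y" z] by (simp add: cinner_minus_left)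

lemma cinner_diff_right: "cinner x (y - z) = cinner x y - cinner x (z::'a::chilbert_space)"
  using cinner_add_right[of x y "- z"] by (simp add: cinner_minus_right)

lemma cinner_sum_left: "cinner (\<Sum>i\<in>F. f i) (y::'a::chilbert_space) = (\<Sum>i\<in>F. cinner (f i) y)"
  by (induction F rule: infinite_finite_induct) (simp_all add: cinner_add_left)

lemma cinner_sum_right: "cinner (y::'a::chilbert_space) (\<Sum>i\<in>F. f i) = (\<Sum>i\<in>F. cinner y (f i))"
  by (induction F rule: infinite_finite_induct) (simp_all add: cinner_add_right)

lemmas cinner_simps = cinner_add_left cinner_add_right cinner_diff_left cinner_diff_right
  cinner_minus_left cinner_minus_right cinner_scaleC_left cinner_scaleC_right

lemma norm_sq_cinner: "(norm (x::'a::chilbert_space))\<^sup>2 = Re (cinner x x)"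
  by (simp add: cinner_self)

lemma Re_cinner_commute: "Re (cinner x y) = Re (cinner (y::'a::chilbert_space) x)"
  by (subst cinner_commute) simp

lemma norm_add_sq:
  "(norm (x + y::'a::chilbert_space))\<^sup>2 = (norm x)\<^sup>2 + (norm y)\<^sup>2 + 2 * Re (cinner x y)"
  unfolding norm_sq_cinner using Re_cinner_commute[of x y] by (simp add: cinner_simps)

lemma norm_diff_sq:
  "(norm (x - y::'a::chilbert_space))\<^sup>2 = (norm x)\<^sup>2 + (norm y)\<^sup>2 - 2 * Re (cinner x y)"
  unfolding norm_sq_cinner using Re_cinner_commute[of x y] by (simp add: cinner_simps)

lemma cinner_self_eq_0 [simp]: "cinner x x = 0 \<longleftrightarrow> (x::'a::chilbert_space) = 0"
  by (simp add: cinner_self)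

lemma norm_scaleC: "norm (scaleC c (x::'a::chilbert_space)) = cmod c * norm x"
proof -
  have "complex_of_real ((norm (scaleC c x))\<^sup>2) = (c * cnj c) * complex_of_real ((norm x)\<^sup>2)"
    unfolding cinner_self[symmetric] by (simp add: cinner_scaleC_left cinner_scaleC_right)
  also have "\<dots> = complex_of_real ((cmod c * norm x)\<^sup>2)"
    by (simp only: complex_norm_square[symmetric] of_real_mult[symmetric] power_mult_distrib)
  finally have "(norm (scaleC c x))\<^sup>2 = (cmod c * norm x)\<^sup>2"
    by (simp only: of_real_eq_iff)
  then show ?thesis by simp
qed

lemma cinner_Cauchy_Schwarz: "cmod (cinner x y) \<le> norm x * norm (y::'a::chilbert_space)"
proof (cases "x = 0")
  case False
  \<comment> \<open>\<open>scaleC c x\<close> is the orthogonal projection of \<open>y\<close> onto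
    the line through \<open>x\<close>.\<close>
  define c where "c = cinner x y / of_real ((norm x)\<^sup>2)"
  have nx: "(norm x)\<^sup>2 > 0" using False by simp
  have "0 \<le> (norm (y - scaleC c x))\<^sup>2" by simp
  also have "\<dots> = (norm y)\<^sup>2 + (cmod c)\<^sup>2 * (norm x)\<^sup>2 - 2 * Re (cinner y (scaleC c x))"
    by (simp add: norm_diff_sq norm_scaleC power_mult_distrib)
  also have "cinner y (scaleC c x) = of_real ((cmod (cinner x y))\<^sup>2 / (norm x)\<^sup>2)"
    unfolding cinner_scaleC_right c_def cinner_commute[of y x]
    by (simp flip: complex_norm_square)
  also have "(cmod c)\<^sup>2 * (norm x)\<^sup>2 = (cmod (cinner x y))\<^sup>2 / (norm x)\<^sup>2"
    using nx unfolding c_def norm_divide norm_of_real power_divide by (simp add: power2_eq_square)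
  finally have "(cmod (cinner x y))\<^sup>2 / (norm x)\<^sup>2 \<le> (norm y)\<^sup>2" by simp
  then have "(cmod (cinner x y))\<^sup>2 \<le> (norm x * norm y)\<^sup>2"
    using nx by (simp add: field_simps power_mult_distrib)
  then show ?thesis by (rule power2_le_imp_le) simp
qed simp

lemma bounded_bilinear_cinner:
  "bounded_bilinear (cinner :: 'a \<Rightarrow> 'a::chilbert_space \<Rightarrow> complex)"
proof
  fix r :: real and a b :: 'a
  show "cinner (r *\<^sub>R a) b = r *\<^sub>R cinner a b" "cinner a (r *\<^sub>R b) = r *\<^sub>R cinner a b"
    by (simp_all add: scaleC_of_real[symmetric] cinner_simps scaleR_conv_of_real)
  show "\<exists>K. \<forall>a b. norm (cinner a (b::'a)) \<le> norm a * norm b * K"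
    by (intro exI[of _ 1]) (simp add: cinner_Cauchy_Schwarz)
qed (simp_all add: cinner_simps)

lemmas tendsto_cinner [tendsto_intros] = bounded_bilinear.tendsto[OF bounded_bilinear_cinner]

lemma bounded_linear_scaleC: "bounded_linear (scaleC c :: 'a \<Rightarrow> 'a::chilbert_space)"
proof
  show "scaleC c (r *\<^sub>R x) = r *\<^sub>R scaleC c x" for r and x :: 'a
    by (simp add: scaleC_of_real[symmetric] scaleC_scaleC mult.commute)
  show "\<exists>K. \<forall>x. norm (scaleC c (x::'a)) \<le> norm x * K"
    by (intro exI[of _ "cmod c"]) (simp add: norm_scaleC mult.commute)
qed (rule scaleC_add_right)

lemmas tendsto_scaleC [tendsto_intros] = bounded_linear.tendsto[OF bounded_linear_scaleC]

section \<open>Closed spans\<close>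

text \<open>Density arguments become an induction with a case for limits of sequences. The cases
  carry membership in the closed span, since bounds of operators are often available only
  there.\<close>

lemma closure_span_induct [consumes 1, case_names base zero add scale limit]:
  fixes x :: "'a::chilbert_space"
  assumes x: "x \<in> closure (cspan X)"
    and base: "\<And>x. x \<in> X \<Longrightarrow> P x"
    and zero: "P 0"
    and add: "\<And>x y. x \<in> closure (cspan X) \<Longrightarrow> y \<in> closure (cspan X) \<Longrightarrow> P x \<Longrightarrow> P y \<Longrightarrow> P (x + y)"
    and scale: "\<And>c x. x \<in> closure (cspan X) \<Longrightarrow> P x \<Longrightarrow> P (scaleC c x)"
    and limit: "\<And>f x. (\<And>n::nat. f n \<in> closure (cspan X)) \<Longrightarrow> (\<And>n. P (f n)) \<Longrightarrow> f \<longlonglongrightarrow> x \<Longrightarrow>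
      x \<in> closure (cspan X) \<Longrightarrow> P x"
  shows "P x"
proof -
  have sub: "cspan X \<subseteq> closure (cspan X)" by (rule closure_subset)
  have "y \<in> cspan X \<and> P y" if "y \<in> cspan X" for y
    using that
  proof (induction rule: complex_vector.span_induct_alt)
    case base
    show ?case by (simp add: zero complex_vector.span_zero)
  next
    case (step c b y)
    have "scaleC c b \<in> cspan X"
      using complex_vector.span_scale[OF complex_vector.span_base[OF step(1)]] .
    moreover have "P (scaleC c b)"
      using scale[OF subsetD[OF sub complex_vector.span_base[OF step(1)]] base[OF step(1)]] .
    ultimately show ?case
      using add[of "scaleC c b" y] step(2) sub complex_vector.span_add[of "scaleC c b" X y]
      by (simp add: subset_iff)
  qed
  then have P: "P y" if "y \<in> cspan X" for y using that by blast
  from x obtain f where f: "\<And>n. f n \<in> cspan X" "f \<longlonglongrightarrow> x"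
    unfolding closure_sequential by blast
  show ?thesis
    by (rule limit[OF subsetD[OF sub f(1)] P[OF f(1)] f(2) x])
qed

definition closed_csubspace :: "'a::chilbert_space set \<Rightarrow> bool" where
  "closed_csubspace D \<longleftrightarrow> complex_vector.subspace D \<and> closed D"

lemma closed_csubspace_closure_span [simp]: "closed_csubspace (closure (cspan X))"
  unfolding closed_csubspace_def complex_vector.subspace_def
proof (intro conjI ballI allI)
  show "0 \<in> closure (cspan X)"
    using closure_subset[of "cspan X"] complex_vector.span_zero by (rule subsetD)
  show "x + y \<in> closure (cspan X)" if xy: "x \<in> closure (cspan X)" "y \<in> closure (cspan X)" for x y
  proof -
    obtain f g where "\<And>n. f n \<in> cspan X" "f \<longlonglongrightarrow> x" "\<And>n. g n \<in> cspan X" "g \<longlonglongrightarrow> y"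
      using xy unfolding closure_sequential by blast
    then show ?thesis
      unfolding closure_sequential
      by (intro exI[of _ "\<lambda>n. f n + g n"]) (auto intro: tendsto_add complex_vector.span_add)
  qed
  show "scaleC c x \<in> closure (cspan X)" if x: "x \<in> closure (cspan X)" for c x
  proof -
    obtain f where "\<And>n. f n \<in> cspan X" "f \<longlonglongrightarrow> x"
      using x unfolding closure_sequential by blast
    then show ?thesis
      unfolding closure_sequential
      by (intro exI[of _ "\<lambda>n. scaleC c (f n)"]) (auto intro: tendsto_scaleC complex_vector.span_scale)
  qed
qed simp

lemma closed_csubspace_UNIV [simp]: "closed_csubspace UNIV"
  by (simp add: closed_csubspace_def)

lemma closed_csubspace_tensor_space [simp]: "closed_csubspace (tensor_space D E T)"
  by (simp add: tensor_space_def)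

context
  fixes D :: "'a::chilbert_space set"
  assumes D: "closed_csubspace D"
begin

lemma closed_csubspace_zero: "0 \<in> D"
  and closed_csubspace_add: "x \<in> D \<Longrightarrow> y \<in> D \<Longrightarrow> x + y \<in> D"
  and closed_csubspace_scale: "x \<in> D \<Longrightarrow> scaleC c x \<in> D"
  and closed_csubspace_diff: "x \<in> D \<Longrightarrow> y \<in> D \<Longrightarrow> x - y \<in> D"
  and closed_csubspace_sum: "(\<And>i. i \<in> F \<Longrightarrow> f i \<in> D) \<Longrightarrow> sum f F \<in> D"
proof -
  have D': "complex_vector.subspace D"
    using D by (simp add: closed_csubspace_def)
  show "0 \<in> D" "x \<in> D \<Longrightarrow> y \<in> D \<Longrightarrow> x + y \<in> D" "x \<in> D \<Longrightarrow> scaleC c x \<in> D"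
    "x \<in> D \<Longrightarrow> y \<in> D \<Longrightarrow> x - y \<in> D" "(\<And>i. i \<in> F \<Longrightarrow> f i \<in> D) \<Longrightarrow> sum f F \<in> D"
    by (fact complex_vector.subspace_0[OF D'] complex_vector.subspace_add[OF D']
        complex_vector.subspace_scale[OF D'] complex_vector.subspace_diff[OF D']
        complex_vector.subspace_sum[OF D'])+
qed

lemma closed_csubspace_scaleR: "x \<in> D \<Longrightarrow> r *\<^sub>R x \<in> D"
  using closed_csubspace_scale[of x "of_real r"] by (simp add: scaleC_of_real)

lemma closed_csubspace_limit: "(\<And>n::nat. f n \<in> D) \<Longrightarrow> f \<longlonglongrightarrow> x \<Longrightarrow> x \<in> D"
  using D closed_sequentially[of D f x] unfolding closed_csubspace_def by auto

lemma closure_span_subset: "X \<subseteq> D \<Longrightarrow> closure (cspan X) \<subseteq> D"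
  using D complex_vector.span_minimal[of X D] closure_minimal[of "cspan X" D]
  unfolding closed_csubspace_def by auto

end

lemma closure_span_superset: "x \<in> X \<Longrightarrow> x \<in> closure (cspan X)"
  using closure_subset[of "cspan X"] complex_vector.span_base[of x X] by (rule subsetD)

lemma cinner_eqI:
  assumes "closed_csubspace D" "x \<in> D" "y \<in> D" "\<And>z. z \<in> D \<Longrightarrow> cinner x z = cinner y z"
  shows "x = (y::'a::chilbert_space)"
proof -
  have "x - y \<in> D" using assms(1-3) by (rule closed_csubspace_diff)
  then have "cinner (x - y) (x - y) = 0" using assms(4)[of "x - y"] by (simp add: cinner_diff_left)
  then show ?thesis by simp
qed

section \<open>Bounded linear maps on closed subspaces\<close>

text \<open>The codomain is arbitrary, unlike that of \<^const>\<open>bop\<close>, and a bound of the norm is recorded.\<close>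

definition linear_bound ::
  "'a::chilbert_space set \<Rightarrow> real \<Rightarrow> ('a \<Rightarrow> 'b::chilbert_space) \<Rightarrow> bool" where
  "linear_bound D K Z \<longleftrightarrow> (\<forall>x\<in>D. \<forall>y\<in>D. Z (x + y) = Z x + Z y) \<and>
     (\<forall>c. \<forall>x\<in>D. Z (scaleC c x) = scaleC c (Z x)) \<and> (\<forall>x\<in>D. norm (Z x) \<le> K * norm x)"

lemma bop_iff: "T \<in> bop D \<longleftrightarrow> T ` D \<subseteq> D \<and> (\<exists>K\<ge>0. linear_bound D K T)"
proof -
  have "\<exists>K\<ge>0. \<forall>x\<in>D. norm (T x) \<le> K * norm x" if "\<forall>x\<in>D. norm (T x) \<le> K * norm x" for K
  \<comment> \<open>The constant in \<open>bop\<close> may be negative when \<open>D\<close> is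
    trivial, hence the absolute value.\<close>
  proof (intro exI[of _ "\<bar>K\<bar>"] conjI ballI)
    show "norm (T x) \<le> \<bar>K\<bar> * norm x" if "x \<in> D" for x
      using \<open>\<forall>x\<in>D. norm (T x) \<le> K * norm x\<close> that
      by (meson abs_ge_self mult_right_mono norm_ge_zero order_trans)
  qed simp
  then have "(\<exists>K. \<forall>x\<in>D. norm (T x) \<le> K * norm x) \<longleftrightarrow> (\<exists>K\<ge>0. \<forall>x\<in>D. norm (T x) \<le> K * norm x)"
    by metis
  then show ?thesis
    by (simp add: bop_def linear_bound_def image_subset_iff) blast
qed

context
  fixes D :: "'a::chilbert_space set" and Z :: "'a \<Rightarrow> 'b::chilbert_space" and K
  assumes Z: "linear_bound D K Z" and D: "closed_csubspace D"
begin

lemma linear_bound_add: "x \<in> D \<Longrightarrow> y \<in> D \<Longrightarrow> Z (x + y) = Z x + Z y"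
  and linear_bound_scale: "x \<in> D \<Longrightarrow> Z (scaleC c x) = scaleC c (Z x)"
  and linear_bound_norm: "x \<in> D \<Longrightarrow> norm (Z x) \<le> K * norm x"
  using Z unfolding linear_bound_def by simp_all

lemma linear_bound_zero: "Z 0 = 0"
  using linear_bound_scale[of 0 0] closed_csubspace_zero[OF D] by simp

lemma linear_bound_diff:
  assumes "x \<in> D" "y \<in> D"
  shows "Z (x - y) = Z x - Z y"
  using linear_bound_add[of "x - y" y] closed_csubspace_diff[OF D] assms by simp

lemma linear_bound_sum: "(\<And>i. i \<in> F \<Longrightarrow> f i \<in> D) \<Longrightarrow> Z (sum f F) = (\<Sum>i\<in>F. Z (f i))"
  by (induction F rule: infinite_finite_induct)
     (simp_all add: linear_bound_zero linear_bound_add closed_csubspace_sum[OF D])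

lemma linear_bound_tendsto:
  assumes "\<And>n::nat. f n \<in> D" "f \<longlonglongrightarrow> x" "x \<in> D"
  shows "(\<lambda>n. Z (f n)) \<longlonglongrightarrow> Z x"
proof -
  have "(\<lambda>n. norm (f n - x)) \<longlonglongrightarrow> 0"
    using assms(2) by (simp add: LIM_zero_iff tendsto_norm_zero_iff)
  then have lim: "(\<lambda>n. K * norm (f n - x)) \<longlonglongrightarrow> 0" by (rule tendsto_mult_right_zero)
  have "norm (Z (f n) - Z x) \<le> K * norm (f n - x)" for n
    using linear_bound_diff[OF assms(1,3)] linear_bound_norm[OF closed_csubspace_diff[OF D assms(1,3)]]
    by simp
  then have "(\<lambda>n. Z (f n) - Z x) \<longlonglongrightarrow> 0"
    by (intro Lim_null_comparison[OF _ lim] always_eventually allI)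
  then show ?thesis by (simp add: LIM_zero_iff)
qed

end

lemma linear_bound_eqI:
  assumes "linear_bound D K Z" "linear_bound D L W" "D = closure (cspan X)"
    "\<And>x. x \<in> X \<Longrightarrow> Z x = W x" "x \<in> D"
  shows "Z x = W x"
proof -
  have D: "closed_csubspace D" using assms(3) by simp
  show ?thesis
    using assms(5) unfolding assms(3)
  proof (induction rule: closure_span_induct)
    case (limit f x)
    then have "(\<lambda>n. Z (f n)) \<longlonglongrightarrow> Z x" "(\<lambda>n. W (f n)) \<longlonglongrightarrow> W x"
      using linear_bound_tendsto[OF assms(1) D, of f x] linear_bound_tendsto[OF assms(2) D, of f x]
        assms(3)
      by simp_all
    then show ?case using limit(4) LIMSEQ_unique by simp
  qed (use assms(3,4) linear_bound_zero[OF assms(1) D] linear_bound_add[OF assms(1) D]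
       linear_bound_scale[OF assms(1) D] linear_bound_zero[OF assms(2) D]
       linear_bound_add[OF assms(2) D] linear_bound_scale[OF assms(2) D] in auto)
qed

lemma linear_bound_id: "linear_bound D 1 (\<lambda>x. x)"
  unfolding linear_bound_def by simp

lemma linear_bound_compose:
  assumes "linear_bound D K Z" "Z ` D \<subseteq> E" "linear_bound E L W" "L \<ge> 0"
  shows "linear_bound D (L * K) (\<lambda>x. W (Z x))"
  unfolding linear_bound_def
proof (intro conjI ballI allI)
  fix x assume x: "x \<in> D"
  then have "norm (W (Z x)) \<le> L * norm (Z x)"
    using assms(2,3) unfolding linear_bound_def by blast
  also have "\<dots> \<le> L * (K * norm x)"
    using x assms(1,4) unfolding linear_bound_def by (simp add: mult_left_mono)
  finally show "norm (W (Z x)) \<le> L * K * norm x" by simp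
qed (use assms(1-3) in \<open>simp_all add: linear_bound_def image_subset_iff\<close>)

text \<open>Sesquilinear identities pass from total families to closed spans, one variable at a
  time. The factor \<open>k\<close> serves Gram identities in which the other tensor slot is
  frozen.\<close>

lemma linear_bound_cinner_eqI:
  assumes Z: "linear_bound D K Z" "linear_bound D K' Z'"
    and W: "linear_bound E L W" "linear_bound E L' W'"
    and DE: "D = closure (cspan X)" "E = closure (cspan Y)"
    and base: "\<And>x y. x \<in> X \<Longrightarrow> y \<in> Y \<Longrightarrow> cinner (Z x) (W y) = k * cinner (Z' x) (W' y)"
    and xy: "x \<in> D" "y \<in> E"
  shows "cinner (Z x) (W y) = k * cinner (Z' x) (W' y)"
proof -
  have D: "closed_csubspace D" "closed_csubspace E" using DE by simp_all
  have *: "cinner (Z x) (W y) = k * cinner (Z' x) (W' y)" if "x \<in> X" for x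
    using xy(2) unfolding DE(2)
  proof (induction rule: closure_span_induct)
    case (limit f y)
    have lim: "(\<lambda>n. W (f n)) \<longlonglongrightarrow> W y" "(\<lambda>n. W' (f n)) \<longlonglongrightarrow> W' y"
      using linear_bound_tendsto[OF W(1) D(2), of f y] linear_bound_tendsto[OF W(2) D(2), of f y]
        DE(2) limit(1-3) by simp_all
    have "(\<lambda>n. cinner (Z x) (W (f n))) \<longlonglongrightarrow> cinner (Z x) (W y)"
      "(\<lambda>n. k * cinner (Z' x) (W' (f n))) \<longlonglongrightarrow> k * cinner (Z' x) (W' y)"
      by (intro tendsto_intros lim)+
    then show ?case unfolding limit(4) by (rule LIMSEQ_unique)
  qed (use that DE(2) base linear_bound_zero[OF W(1) D(2)] linear_bound_add[OF W(1) D(2)]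
       linear_bound_scale[OF W(1) D(2)] linear_bound_zero[OF W(2) D(2)]
       linear_bound_add[OF W(2) D(2)] linear_bound_scale[OF W(2) D(2)]
      in \<open>auto simp: cinner_simps algebra_simps\<close>)
  show ?thesis
    using xy(1) unfolding DE(1)
  proof (induction rule: closure_span_induct)
    case (limit f x)
    have lim: "(\<lambda>n. Z (f n)) \<longlonglongrightarrow> Z x" "(\<lambda>n. Z' (f n)) \<longlonglongrightarrow> Z' x"
      using linear_bound_tendsto[OF Z(1) D(1), of f x] linear_bound_tendsto[OF Z(2) D(1), of f x]
        DE(1) limit(1-3) by simp_all
    have "(\<lambda>n. cinner (Z (f n)) (W y)) \<longlonglongrightarrow> cinner (Z x) (W y)"
      "(\<lambda>n. k * cinner (Z' (f n)) (W' y)) \<longlonglongrightarrow> k * cinner (Z' x) (W' y)"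
      by (intro tendsto_intros lim)+
    then show ?case unfolding limit(4) by (rule LIMSEQ_unique)
  qed (use * DE(1) linear_bound_zero[OF Z(1) D(1)] linear_bound_add[OF Z(1) D(1)]
       linear_bound_scale[OF Z(1) D(1)] linear_bound_zero[OF Z(2) D(1)]
       linear_bound_add[OF Z(2) D(1)] linear_bound_scale[OF Z(2) D(1)]
      in \<open>auto simp: cinner_simps algebra_simps\<close>)
qed

lemmas linear_bound_inner_eqI =
  linear_bound_cinner_eqI[OF _ linear_bound_id _ linear_bound_id]

lemma linear_bound_mono: "linear_bound D K Z \<Longrightarrow> D' \<subseteq> D \<Longrightarrow> linear_bound D' K Z"
  unfolding linear_bound_def by (meson subsetD)

lemma linear_bound_image_subset:
  assumes "linear_bound D K Z" "D = closure (cspan X)" "closed_csubspace N" "Z ` X \<subseteq> N"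
  shows "Z ` D \<subseteq> N"
proof clarify
  fix x assume "x \<in> D"
  have D: "closed_csubspace D" using assms(2) by simp
  from \<open>x \<in> D\<close> show "Z x \<in> N"
    unfolding assms(2)
  proof (induction rule: closure_span_induct)
    case (limit f x)
    show ?case
      by (rule closed_csubspace_limit[OF assms(3) limit(4) linear_bound_tendsto[OF assms(1) D]])
         (use limit(1-3) assms(2) in auto)
  qed (use assms(2-4) linear_bound_zero[OF assms(1) D] linear_bound_add[OF assms(1) D]
       linear_bound_scale[OF assms(1) D] closed_csubspace_zero[OF assms(3)]
       closed_csubspace_add[OF assms(3)] closed_csubspace_scale[OF assms(3)] in auto)
qed

lemma closure_span_eq [simp]: "closed_csubspace D \<Longrightarrow> closure (cspan D) = D"
  using closure_span_subset[of D D] closure_span_superset[of _ D] by blast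

text \<open>The closure of a linear relation inherits the bound. The bound makes it single-valued,
  by subtracting two pairs over the same \<open>v\<close>, and turns convergence in the domain into
  Cauchy sequences of values, so it is the graph of the extension.\<close>

lemma linear_bound_graph_extension:
  fixes G :: "('a::chilbert_space \<times> 'b::chilbert_space) set"
  assumes add: "\<And>v w v' w'. (v, w) \<in> G \<Longrightarrow> (v', w') \<in> G \<Longrightarrow> (v + v', w + w') \<in> G"
    and scale: "\<And>c v w. (v, w) \<in> G \<Longrightarrow> (scaleC c v, scaleC c w) \<in> G"
    and bound: "\<And>v w. (v, w) \<in> G \<Longrightarrow> norm w \<le> K * norm v"
    and K: "K \<ge> 0"
  obtains Z where "linear_bound (closure (fst ` G)) K Z" "\<And>v w. (v, w) \<in> G \<Longrightarrow> Z v = w"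
proof -
  define H where "H = closure G"
  have seq: "\<exists>f g. (\<forall>n. (f n, g n) \<in> G) \<and> f \<longlonglongrightarrow> v \<and> g \<longlonglongrightarrow> w" if "(v, w) \<in> H" for v w
  proof -
    from that obtain h where h: "\<And>n. h n \<in> G" "h \<longlonglongrightarrow> (v, w)"
      unfolding H_def closure_sequential by blast
    show ?thesis
      using h tendsto_fst[OF h(2)] tendsto_snd[OF h(2)]
      by (intro exI[of _ "\<lambda>n. fst (h n)"] exI[of _ "\<lambda>n. snd (h n)"]) auto
  qed
  have seqI: "(v, w) \<in> H" if "\<And>n. (f n, g n) \<in> G" "f \<longlonglongrightarrow> v" "g \<longlonglongrightarrow> w" for f g v w
    unfolding H_def closure_sequential
    using that by (intro exI[of _ "\<lambda>n. (f n, g n)"]) (auto intro: tendsto_Pair)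
  have GH: "(v, w) \<in> H" if "(v, w) \<in> G" for v w
    using that closure_subset H_def by blast
  have H_add: "(v + v', w + w') \<in> H" if vw: "(v, w) \<in> H" "(v', w') \<in> H" for v w v' w'
  proof -
    from seq[OF vw(1)] seq[OF vw(2)] obtain f g f' g' where
      "\<And>n. (f n, g n) \<in> G" "f \<longlonglongrightarrow> v" "g \<longlonglongrightarrow> w" "\<And>n. (f' n, g' n) \<in> G" "f' \<longlonglongrightarrow> v'" "g' \<longlonglongrightarrow> w'"
      by blast
    then show ?thesis
      by (intro seqI[of "\<lambda>n. f n + f' n" "\<lambda>n. g n + g' n"] add tendsto_add)
  qed
  have H_scale: "(scaleC c v, scaleC c w) \<in> H" if vw: "(v, w) \<in> H" for c v w
  proof -
    from seq[OF vw] obtain f g where "\<And>n. (f n, g n) \<in> G" "f \<longlonglongrightarrow> v" "g \<longlonglongrightarrow> w" by blast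
    then show ?thesis
      by (intro seqI[of "\<lambda>n. scaleC c (f n)" "\<lambda>n. scaleC c (g n)"] scale tendsto_scaleC)
  qed
  have H_bound: "norm w \<le> K * norm v" if vw: "(v, w) \<in> H" for v w
  proof -
    from seq[OF vw] obtain f g where fg: "\<And>n. (f n, g n) \<in> G" "f \<longlonglongrightarrow> v" "g \<longlonglongrightarrow> w" by blast
    show ?thesis
      by (rule LIMSEQ_le[OF tendsto_norm[OF fg(3)] tendsto_mult[OF tendsto_const tendsto_norm[OF fg(2)]]])
         (use bound[OF fg(1)] in blast)
  qed
  have H_diff: "(v - v', w - w') \<in> H" if "(v, w) \<in> H" "(v', w') \<in> H" for v w v' w'
    using H_add[OF that(1) H_scale[OF that(2), of "-1"]] by (simp add: scaleC_minus_one)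
  have G_diff: "(v - v', w - w') \<in> G" if "(v, w) \<in> G" "(v', w') \<in> G" for v w v' w'
    using add[OF that(1) scale[OF that(2), of "-1"]] by (simp add: scaleC_minus_one)
  have unique: "w = w'" if "(v, w) \<in> H" "(v, w') \<in> H" for v w w'
    using H_bound[OF H_diff[OF that]] by simp
  have ex: "\<exists>w. (v, w) \<in> H" if v: "v \<in> closure (fst ` G)" for v
  proof -
    from v obtain f where f: "\<And>n. f n \<in> fst ` G" "f \<longlonglongrightarrow> v"
      unfolding closure_sequential by blast
    from f(1) have "\<forall>n. \<exists>w. (f n, w) \<in> G" by force
    then obtain g where g: "\<And>n. (f n, g n) \<in> G" by metis
    have "Cauchy g"
    proof (rule CauchyI)
      fix e :: real assume "e > 0"
      then have "e / (K + 1) > 0" using K by simp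
      then obtain N where N: "\<And>m n. m \<ge> N \<Longrightarrow> n \<ge> N \<Longrightarrow> norm (f m - f n) < e / (K + 1)"
        using LIMSEQ_imp_Cauchy[OF f(2)] CauchyD by metis
      have "norm (g m - g n) < e" if "m \<ge> N" "n \<ge> N" for m n
      proof -
        have "norm (g m - g n) \<le> K * norm (f m - f n)"
          by (rule bound[OF G_diff[OF g g]])
        also have "\<dots> \<le> (K + 1) * norm (f m - f n)"
          by (simp add: algebra_simps)
        also have "\<dots> < e" using N[OF that] K by (simp add: field_simps)
        finally show ?thesis .
      qed
      then show "\<exists>M. \<forall>m\<ge>M. \<forall>n\<ge>M. norm (g m - g n) < e" by blast
    qed
    then obtain w where "g \<longlonglongrightarrow> w" using Cauchy_convergent convergent_def by blast
    then show ?thesis using seqI[OF g f(2)] by blast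
  qed
  define Z where "Z v = (THE w. (v, w) \<in> H)" for v
  have Z_eq: "Z v = w" if "(v, w) \<in> H" for v w
    unfolding Z_def using that by (rule the_equality) (rule unique[OF _ that])
  have Z_H: "(v, Z v) \<in> H" if "v \<in> closure (fst ` G)" for v
    using ex[OF that] Z_eq by blast
  have "linear_bound (closure (fst ` G)) K Z"
    unfolding linear_bound_def
  proof (intro conjI ballI allI)
    fix x assume x: "x \<in> closure (fst ` G)"
    show "Z (scaleC c x) = scaleC c (Z x)" for c
      by (rule Z_eq[OF H_scale[OF Z_H[OF x]]])
    show "norm (Z x) \<le> K * norm x"
      by (rule H_bound[OF Z_H[OF x]])
    fix y assume y: "y \<in> closure (fst ` G)"
    show "Z (x + y) = Z x + Z y"
      by (rule Z_eq[OF H_add[OF Z_H[OF x] Z_H[OF y]]])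
  qed
  then show thesis using that Z_eq GH by blast
qed

lemma sum_scaleC_union:
  fixes \<phi> :: "'i \<Rightarrow> 'a::chilbert_space"
  assumes "finite F" "finite F'"
  shows "(\<Sum>i\<in>F \<union> F'. scaleC ((if i \<in> F then c i else 0) + (if i \<in> F' then c' i else 0)) (\<phi> i)) =
    (\<Sum>i\<in>F. scaleC (c i) (\<phi> i)) + (\<Sum>i\<in>F'. scaleC (c' i) (\<phi> i))"
proof -
  have "(\<Sum>i\<in>F \<union> F'. scaleC (if i \<in> F then c i else 0) (\<phi> i)) = (\<Sum>i\<in>F. scaleC (c i) (\<phi> i))"
    using assms by (intro sum.mono_neutral_cong_right) auto
  moreover have "(\<Sum>i\<in>F \<union> F'. scaleC (if i \<in> F' then c' i else 0) (\<phi> i)) = (\<Sum>i\<in>F'. scaleC (c' i) (\<phi> i))"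
    using assms by (intro sum.mono_neutral_cong_right) auto
  ultimately show ?thesis by (simp add: scaleC_add_left sum.distrib)
qed

text \<open>The bound on finite combinations already contains well-definedness, so the \<phi>-family
  may be linearly dependent, as elementary tensors are.\<close>

lemma linear_bound_extension:
  fixes \<phi> :: "'i \<Rightarrow> 'a::chilbert_space" and \<psi> :: "'i \<Rightarrow> 'b::chilbert_space"
  assumes bound: "\<And>F c. finite F \<Longrightarrow> F \<subseteq> I \<Longrightarrow>
      norm (\<Sum>i\<in>F. scaleC (c i) (\<psi> i)) \<le> K * norm (\<Sum>i\<in>F. scaleC (c i) (\<phi> i))"
    and K: "K \<ge> 0"
  obtains Z where "linear_bound (closure (cspan (\<phi> ` I))) K Z" "\<And>i. i \<in> I \<Longrightarrow> Z (\<phi> i) = \<psi> i"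
proof -
  define G where "G = {(\<Sum>i\<in>F. scaleC (c i) (\<phi> i), \<Sum>i\<in>F. scaleC (c i) (\<psi> i)) | F c. finite F \<and> F \<subseteq> I}"
  have GI: "(\<Sum>i\<in>F. scaleC (c i) (\<phi> i), \<Sum>i\<in>F. scaleC (c i) (\<psi> i)) \<in> G"
    if "finite F" "F \<subseteq> I" for F c
    unfolding G_def using that by blast
  have base: "(\<phi> i, \<psi> i) \<in> G" if "i \<in> I" for i
    using GI[of "{i}" "\<lambda>_. 1"] that by simp
  obtain Z where Z: "linear_bound (closure (fst ` G)) K Z" "\<And>v w. (v, w) \<in> G \<Longrightarrow> Z v = w"
  proof (rule linear_bound_graph_extension)
    fix v w v' w' assume "(v, w) \<in> G" "(v', w') \<in> G"
    then obtain F c F' c' where *: "v = (\<Sum>i\<in>F. scaleC (c i) (\<phi> i))" "w = (\<Sum>i\<in>F. scaleC (c i) (\<psi> i))"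
        "v' = (\<Sum>i\<in>F'. scaleC (c' i) (\<phi> i))" "w' = (\<Sum>i\<in>F'. scaleC (c' i) (\<psi> i))"
        "finite F" "finite F'" "F \<subseteq> I" "F' \<subseteq> I"
      unfolding G_def by blast
    show "(v + v', w + w') \<in> G"
      using GI[of "F \<union> F'" "\<lambda>i. (if i \<in> F then c i else 0) + (if i \<in> F' then c' i else 0)"] *
      by (simp add: sum_scaleC_union)
  next
    fix c v w assume "(v, w) \<in> G"
    then obtain F d where *: "v = (\<Sum>i\<in>F. scaleC (d i) (\<phi> i))" "w = (\<Sum>i\<in>F. scaleC (d i) (\<psi> i))"
        "finite F" "F \<subseteq> I"
      unfolding G_def by blast
    show "(scaleC c v, scaleC c w) \<in> G"
      using GI[of F "\<lambda>i. c * d i"] * by (simp add: complex_vector.scale_sum_right scaleC_scaleC)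
  qed (use bound K in \<open>auto simp: G_def\<close>)
  have "cspan (\<phi> ` I) \<subseteq> fst ` G"
  proof
    fix x assume "x \<in> cspan (\<phi> ` I)"
    then show "x \<in> fst ` G"
    proof (induction rule: complex_vector.span_induct_alt)
      case base
      show ?case using GI[of "{}"] by force
    next
      case (step c x y)
      then obtain i F d where i: "i \<in> I" "x = \<phi> i" and F: "finite F" "F \<subseteq> I" "y = (\<Sum>i\<in>F. scaleC (d i) (\<phi> i))"
        unfolding G_def by auto
      \<comment> \<open>The index \<open>i\<close> may already occur in \<open>F\<close>; the two
        coefficients are then added.\<close>
      have "scaleC c x + y = (\<Sum>k\<in>{i} \<union> F. scaleC ((if k \<in> {i} then c else 0) + (if k \<in> F then d k else 0)) (\<phi> k))"
        using i F by (subst sum_scaleC_union) auto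
      then show ?case
        using GI[of "{i} \<union> F" "\<lambda>k. (if k \<in> {i} then c else 0) + (if k \<in> F then d k else 0)"] i F
        by (metis (no_types, lifting) Un_least empty_subsetI finite.emptyI finite.insertI finite_UnI
            fst_conv image_eqI insert_subset)
    qed
  qed
  then have sub: "closure (cspan (\<phi> ` I)) \<subseteq> closure (fst ` G)" by (rule closure_mono)
  have "linear_bound (closure (cspan (\<phi> ` I))) K Z"
    using Z(1) sub unfolding linear_bound_def by (meson subsetD)
  then show thesis using that Z(2) base by blast
qed

lemma norm_sum_gram:
  fixes a :: "'i \<Rightarrow> 'a::chilbert_space" and b :: "'i \<Rightarrow> 'b::chilbert_space"
  assumes "\<And>i j. i \<in> F \<Longrightarrow> j \<in> F \<Longrightarrow> cinner (a i) (a j) = of_real k * cinner (b i) (b j)"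
  shows "(norm (\<Sum>i\<in>F. scaleC (c i) (a i)))\<^sup>2 = k * (norm (\<Sum>i\<in>F. scaleC (c i) (b i)))\<^sup>2"
proof -
  have "cinner (\<Sum>i\<in>F. scaleC (c i) (a i)) (\<Sum>i\<in>F. scaleC (c i) (a i)) =
    of_real k * cinner (\<Sum>i\<in>F. scaleC (c i) (b i)) (\<Sum>i\<in>F. scaleC (c i) (b i))"
    by (auto simp: cinner_sum_left cinner_sum_right cinner_scaleC_left cinner_scaleC_right assms
        sum_distrib_left intro!: sum.cong)
  then show ?thesis unfolding norm_sq_cinner by simp
qed

text \<open>Proportional Gram matrices turn the required bound into an equality. With
  \<open>K = 1\<close> this yields isometries such as the shift, with \<open>K\<close> the norm of a
  fixed vector it yields tensoring by that vector.\<close>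

lemma linear_bound_extension_gram:
  fixes \<phi> :: "'i \<Rightarrow> 'a::chilbert_space" and \<psi> :: "'i \<Rightarrow> 'b::chilbert_space"
  assumes gram: "\<And>i j. i \<in> I \<Longrightarrow> j \<in> I \<Longrightarrow> cinner (\<psi> i) (\<psi> j) = of_real (K\<^sup>2) * cinner (\<phi> i) (\<phi> j)"
    and K: "K \<ge> 0"
  obtains Z where "linear_bound (closure (cspan (\<phi> ` I))) K Z" "\<And>i. i \<in> I \<Longrightarrow> Z (\<phi> i) = \<psi> i"
proof (rule linear_bound_extension[OF _ K])
  fix F c assume F: "F \<subseteq> I"
  have "(norm (\<Sum>i\<in>F. scaleC (c i) (\<psi> i)))\<^sup>2 = (K * norm (\<Sum>i\<in>F. scaleC (c i) (\<phi> i)))\<^sup>2"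
    unfolding power_mult_distrib by (rule norm_sum_gram) (use gram F in blast)
  then show "norm (\<Sum>i\<in>F. scaleC (c i) (\<psi> i)) \<le> K * norm (\<Sum>i\<in>F. scaleC (c i) (\<phi> i))"
    using K by simp
qed blast

section \<open>Adjoints\<close>

text \<open>The representing vector minimises \<open>J\<close> on \<open>D\<close>: a minimising
  sequence is Cauchy by the parallelogram law, and the first variation of \<open>J\<close> at the
  minimum must vanish.\<close>

lemma riesz_representation:
  fixes D :: "'a::chilbert_space set" and \<phi> :: "'a \<Rightarrow> complex"
  assumes D: "closed_csubspace D"
    and add: "\<And>x y. x \<in> D \<Longrightarrow> y \<in> D \<Longrightarrow> \<phi> (x + y) = \<phi> x + \<phi> y"
    and scale: "\<And>c x. x \<in> D \<Longrightarrow> \<phi> (scaleC c x) = c * \<phi> x"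
    and bound: "\<And>x. x \<in> D \<Longrightarrow> cmod (\<phi> x) \<le> K * norm x"
  shows "\<exists>!v. v \<in> D \<and> (\<forall>z\<in>D. cinner v z = \<phi> z)"
proof -
  define J where "J z = (norm z)\<^sup>2 - 2 * Re (\<phi> z)" for z
  define m where "m = Inf (J ` D)"
  have J_lower: "J z \<ge> - K\<^sup>2" if "z \<in> D" for z
  proof -
    have "Re (\<phi> z) \<le> K * norm z"
      using bound[OF that] complex_Re_le_cmod[of "\<phi> z"] by linarith
    moreover have "0 \<le> (norm z - K)\<^sup>2" by simp
    ultimately show ?thesis unfolding J_def power2_diff by (simp add: algebra_simps)
  qed
  then have bdd: "bdd_below (J ` D)" by (intro bdd_belowI[of _ "- K\<^sup>2"]) auto
  have ne: "J ` D \<noteq> {}" using closed_csubspace_zero[OF D] by blast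
  have J_ge: "J z \<ge> m" if "z \<in> D" for z
    unfolding m_def using that bdd by (simp add: cInf_lower)
  have parallelogram: "(norm (z - w))\<^sup>2 \<le> 2 * (J z - m) + 2 * (J w - m)" if zw: "z \<in> D" "w \<in> D" for z w
  proof -
    \<comment> \<open>\<open>J\<close> is at least \<open>m\<close> at the midpoint, which forces
      near-minimisers to be close together.\<close>
    let ?u = "(1/2) *\<^sub>R (z + w)"
    have u: "?u \<in> D" using zw D by (simp add: closed_csubspace_scaleR closed_csubspace_add)
    have \<phi>_u: "\<phi> ?u = of_real (1/2) * (\<phi> z + \<phi> w)"
      using scale[OF closed_csubspace_add[OF D zw], of "of_real (1/2)"] zw add
      unfolding scaleC_of_real by metis
    have Re_u: "Re (\<phi> ?u) = (Re (\<phi> z) + Re (\<phi> w)) / 2"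
      unfolding \<phi>_u times_complex.sel by simp
    have "(norm (z + w))\<^sup>2 = 4 * (norm ?u)\<^sup>2" by (simp add: power_mult_distrib power_divide)
    moreover have "(norm (z + w))\<^sup>2 + (norm (z - w))\<^sup>2 = 2 * (norm z)\<^sup>2 + 2 * (norm w)\<^sup>2"
      unfolding norm_add_sq norm_diff_sq by simp
    moreover have "m \<le> (norm ?u)\<^sup>2 - (Re (\<phi> z) + Re (\<phi> w))"
      using J_ge[OF u] unfolding J_def Re_u by (simp add: field_simps)
    ultimately show ?thesis unfolding J_def right_diff_distrib by linarith
  qed
  have "\<exists>z. z \<in> D \<and> J z < m + 1 / real (Suc n)" for n
  proof -
    have "m < m + 1 / real (Suc n)" by simp
    then show ?thesis using cInf_lessD[OF ne] unfolding m_def by blast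
  qed
  then obtain f where f: "\<And>n. f n \<in> D" "\<And>n. J (f n) < m + 1 / real (Suc n)" by metis
  have "Cauchy f"
  proof (rule CauchyI)
    fix e :: real assume e: "e > 0"
    then have "e\<^sup>2 / 4 > 0" by simp
    then obtain N where N: "1 / real (Suc N) < e\<^sup>2 / 4" using nat_approx_posE by blast
    have "norm (f k - f n) < e" if "k \<ge> N" "n \<ge> N" for k n
    proof -
      have small: "J (f i) - m < e\<^sup>2 / 4" if "i \<ge> N" for i
      proof -
        have "1 / real (Suc i) \<le> 1 / real (Suc N)" using that by (simp add: frac_le)
        then show ?thesis using f(2)[of i] N by linarith
      qed
      then have "(norm (f k - f n))\<^sup>2 < e\<^sup>2"
        using parallelogram[OF f(1) f(1), of k n] small[OF that(1)] small[OF that(2)]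
        by (simp add: right_diff_distrib)
      then show ?thesis using e by (simp add: power2_less_imp_less)
    qed
    then show "\<exists>M. \<forall>k\<ge>M. \<forall>n\<ge>M. norm (f k - f n) < e" by blast
  qed
  then obtain v where v: "f \<longlonglongrightarrow> v" using Cauchy_convergent convergent_def by blast
  have vD: "v \<in> D" by (rule closed_csubspace_limit[OF D f(1) v])
  have Jv: "J v \<le> m"
  proof -
    have \<phi>_diff: "\<phi> (z - w) = \<phi> z - \<phi> w" if "z \<in> D" "w \<in> D" for z w
      using add[of "z - w" w] that closed_csubspace_diff[OF D] by simp
    have lim0: "(\<lambda>n. K * norm (f n - v)) \<longlonglongrightarrow> 0"
      using v by (intro tendsto_mult_right_zero) (simp add: LIM_zero_iff tendsto_norm_zero_iff)
    have "norm (\<phi> (f n) - \<phi> v) \<le> K * norm (f n - v)" for n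
      using bound[OF closed_csubspace_diff[OF D f(1) vD]] \<phi>_diff[OF f(1) vD] by simp
    then have "(\<lambda>n. \<phi> (f n) - \<phi> v) \<longlonglongrightarrow> 0"
      by (intro Lim_null_comparison[OF _ lim0] always_eventually allI)
    then have "(\<lambda>n. \<phi> (f n)) \<longlonglongrightarrow> \<phi> v" by (simp add: LIM_zero_iff)
    then have J: "(\<lambda>n. J (f n)) \<longlonglongrightarrow> J v"
      unfolding J_def using v by (auto intro!: tendsto_intros)
    have "(\<lambda>n. m + 1 / real (Suc n)) \<longlonglongrightarrow> m + 0"
      by (intro tendsto_add tendsto_const LIMSEQ_Suc lim_1_over_n)
    then show ?thesis
      using LIMSEQ_le[OF J] f(2) less_imp_le unfolding add_0_right by blast
  qed
  have repr: "cinner v z = \<phi> z" if z: "z \<in> D" for z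
  proof -
    define g where "g = cinner v z - \<phi> z"
    \<comment> \<open>Minimality is tested in the direction \<open>z\<close>, with the phase of the
      coefficient chosen so that the linear term is real and negative for
      \<open>s > 0\<close>.\<close>
    have "0 \<le> s\<^sup>2 * ((cmod g)\<^sup>2 * (norm z)\<^sup>2) - 2 * s * (cmod g)\<^sup>2" for s :: real
    proof -
      define c where "c = - (of_real s * cnj g)"
      have "v + scaleC c z \<in> D" using vD z D by (simp add: closed_csubspace_add closed_csubspace_scale)
      then have "J v \<le> J (v + scaleC c z)" using J_ge Jv by fastforce
      also have "J (v + scaleC c z) = J v + (cmod c)\<^sup>2 * (norm z)\<^sup>2 + 2 * Re (c * g)"
        unfolding J_def g_def norm_add_sq
        using add[OF vD closed_csubspace_scale[OF D z]] scale[OF z]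
        by (simp add: norm_scaleC power_mult_distrib cinner_scaleC_right algebra_simps)
      also have "c * g = - of_real (s * (cmod g)\<^sup>2)"
        unfolding c_def by (simp add: complex_norm_square mult.commute flip: of_real_power)
      finally show ?thesis by (simp add: c_def norm_mult power_mult_distrib)
    qed note * = this
    have "g = 0"
    proof (rule ccontr)
      assume g: "g \<noteq> 0"
      \<comment> \<open>The step \<open>s = 1/(b+1)\<close> is small enough for the linear term to
        win, and is also defined when \<open>z = 0\<close>.\<close>
      define b where "b = (norm z)\<^sup>2"
      have b: "b \<ge> 0" by (simp add: b_def)
      have "0 \<le> (1/(b+1))\<^sup>2 * ((cmod g)\<^sup>2 * b) - 2 * (1/(b+1)) * (cmod g)\<^sup>2"
        using *[of "1/(b+1)"] b_def by simp
      then have "0 \<le> ((1/(b+1))\<^sup>2 * b - 2 * (1/(b+1))) * (cmod g)\<^sup>2"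
        by (simp add: algebra_simps)
      then have "0 \<le> (1/(b+1))\<^sup>2 * b - 2 * (1/(b+1))"
        using g by (simp add: zero_le_mult_iff)
      also have "(1/(b+1))\<^sup>2 * b - 2 * (1/(b+1)) = (1/(b+1)) * (b/(b+1) - 2)"
        by (simp add: power2_eq_square right_diff_distrib)
      finally have "0 \<le> b/(b+1) - 2" using b by (simp add: zero_le_divide_iff)
      moreover have "b/(b+1) \<le> 1" using b by simp
      ultimately show False by linarith
    qed
    then show ?thesis by (simp add: g_def)
  qed
  show ?thesis
  proof (rule ex1I[of _ v])
    show "w = v" if "w \<in> D \<and> (\<forall>z\<in>D. cinner w z = \<phi> z)" for w
      using that repr vD by (intro cinner_eqI[OF D, of w v]) auto
  qed (use vD repr in blast)
qed

text \<open>Riesz representation of the functional sending \<open>z\<close> to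
  \<open>cinner y (T z)\<close> justifies the \<open>THE\<close> in \<open>adj\<close>;
  \<open>y\<close> may lie outside \<open>D\<close>.\<close>

lemma adj_props:
  assumes D: "closed_csubspace D" and T: "linear_bound D K T" "T ` D \<subseteq> D"
  shows adj_mem: "adj D T y \<in> D"
    and cinner_adj: "z \<in> D \<Longrightarrow> cinner (adj D T y) z = cinner y (T z)"
proof -
  have "\<exists>!v. v \<in> D \<and> (\<forall>z\<in>D. cinner v z = cinner y (T z))"
  proof (rule riesz_representation[OF D])
    show "cmod (cinner y (T x)) \<le> (norm y * K) * norm x" if "x \<in> D" for x
      using cinner_Cauchy_Schwarz[of y "T x"] linear_bound_norm[OF T(1) D that]
        mult_left_mono[of "norm (T x)" "K * norm x" "norm y"] by simp
  qed (simp_all add: linear_bound_add[OF T(1) D] linear_bound_scale[OF T(1) D] cinner_simps)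
  from theI'[OF this, folded adj_def]
  show "adj D T y \<in> D" "z \<in> D \<Longrightarrow> cinner (adj D T y) z = cinner y (T z)" by blast+
qed

lemma linear_bound_adj:
  assumes D: "closed_csubspace D" and T: "linear_bound D K T" "T ` D \<subseteq> D"
  shows "linear_bound D K (adj D T)"
  unfolding linear_bound_def
proof (intro conjI ballI allI)
  note mem = adj_mem[OF assms] and inner = cinner_adj[OF assms]
  show "adj D T (x + y) = adj D T x + adj D T y" for x y
    by (rule cinner_eqI[OF D]) (simp_all add: mem closed_csubspace_add[OF D] inner cinner_simps)
  show "adj D T (scaleC c x) = scaleC c (adj D T x)" for c x
    by (rule cinner_eqI[OF D]) (simp_all add: mem closed_csubspace_scale[OF D] inner cinner_simps)
  fix x assume "x \<in> D"
  show "norm (adj D T x) \<le> K * norm x"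
  proof (cases "adj D T x = 0")
    case False
    have "(norm (adj D T x))\<^sup>2 = cmod (cinner x (T (adj D T x)))"
      unfolding inner[OF mem, of x x, symmetric] cinner_self by (simp add: norm_power)
    also have "\<dots> \<le> norm x * (K * norm (adj D T x))"
      using cinner_Cauchy_Schwarz[of x "T (adj D T x)"] linear_bound_norm[OF T(1) D mem[of x]]
      by (meson mult_left_mono norm_ge_zero order_trans)
    finally show ?thesis using False by (simp add: power2_eq_square mult.commute)
  next
    case True
    \<comment> \<open>No sign of \<open>K\<close> is assumed, so nonnegativity is read off from the
      norm of \<open>T x\<close>.\<close>
    have "0 \<le> K * norm x"
      using linear_bound_norm[OF T(1) D \<open>x \<in> D\<close>] norm_ge_zero[of "T x"] by linarith
    then show ?thesis using True by simp
  qed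
qed

section \<open>Hilbert space tensor products\<close>

text \<open>Schur's product theorem for a Gram matrix and a positive matrix. Projecting out one
  vector \<open>d k\<close> splits the Gram matrix into a rank-one part, on which positivity of
  \<open>b\<close> applies directly, and the Gram matrix of the remainders, which vanishes in row
  and column \<open>k\<close>.\<close>

lemma schur_gram_nonneg:
  fixes d :: "'i \<Rightarrow> 'a::chilbert_space"
  assumes "finite F" and "\<And>\<alpha>. 0 \<le> Re (\<Sum>i\<in>F. \<Sum>j\<in>F. cnj (\<alpha> i) * \<alpha> j * b i j)"
  shows "0 \<le> Re (\<Sum>i\<in>F. \<Sum>j\<in>F. cinner (d i) (d j) * b i j)"
  using assms
proof (induction F arbitrary: d)
  case (insert k F)
  \<comment> \<open>Coefficient of the orthogonal projection of \<open>d i\<close> onto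
    \<open>d k\<close>; zero if there is nothing to project onto.\<close>
  define \<alpha> where "\<alpha> i = (if d k = 0 then 0 else cinner (d k) (d i) / of_real ((norm (d k))\<^sup>2))" for i
  define d' where "d' i = d i - scaleC (\<alpha> i) (d k)" for i
  have orth: "cinner (d k) (d' i) = 0" for i
    unfolding d'_def \<alpha>_def cinner_diff_right cinner_scaleC_right by (simp add: cinner_self)
  then have orth': "cinner (d' i) (d k) = 0" for i
    by (metis cinner_commute complex_cnj_zero)
  have d: "d i = d' i + scaleC (\<alpha> i) (d k)" for i
    by (simp add: d'_def)
  have split: "cinner (d i) (d j) = cinner (d' i) (d' j) + of_real ((norm (d k))\<^sup>2) * (cnj (\<alpha> i) * \<alpha> j)" for i j
    by (subst d[of i], subst d[of j]) (simp add: cinner_simps orth orth' cinner_self)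
  have d'_k: "d' k = 0"
    by (simp add: d'_def \<alpha>_def cinner_self)
  have "(\<Sum>i\<in>insert k F. \<Sum>j\<in>insert k F. cinner (d i) (d j) * b i j) =
    (\<Sum>i\<in>insert k F. \<Sum>j\<in>insert k F. cinner (d' i) (d' j) * b i j) +
    of_real ((norm (d k))\<^sup>2) * (\<Sum>i\<in>insert k F. \<Sum>j\<in>insert k F. cnj (\<alpha> i) * \<alpha> j * b i j)"
    unfolding sum_distrib_left sum.distrib[symmetric]
    by (intro sum.cong refl) (simp add: split algebra_simps)
  also have "(\<Sum>i\<in>insert k F. \<Sum>j\<in>insert k F. cinner (d' i) (d' j) * b i j) =
      (\<Sum>i\<in>F. \<Sum>j\<in>F. cinner (d' i) (d' j) * b i j)"
    using insert.hyps d'_k by simp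
  finally have eq: "Re (\<Sum>i\<in>insert k F. \<Sum>j\<in>insert k F. cinner (d i) (d j) * b i j) =
    Re (\<Sum>i\<in>F. \<Sum>j\<in>F. cinner (d' i) (d' j) * b i j) +
    (norm (d k))\<^sup>2 * Re (\<Sum>i\<in>insert k F. \<Sum>j\<in>insert k F. cnj (\<alpha> i) * \<alpha> j * b i j)"
    by (simp only: plus_complex.sel Re_complex_of_real Im_complex_of_real times_complex.sel mult_zero_left diff_zero)
  have "0 \<le> Re (\<Sum>i\<in>F. \<Sum>j\<in>F. cinner (d' i) (d' j) * b i j)"
  proof (rule insert.IH)
    fix \<beta> :: "'i \<Rightarrow> complex"
    \<comment> \<open>Extension by zero at \<open>k\<close> restricts positivity of the form from
      \<open>insert k F\<close> to \<open>F\<close>.\<close>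
    define \<gamma> where "\<gamma> i = (if i = k then 0 else \<beta> i)" for i
    have "(\<Sum>i\<in>F. \<Sum>j\<in>F. cnj (\<beta> i) * \<beta> j * b i j) = (\<Sum>i\<in>F. \<Sum>j\<in>F. cnj (\<gamma> i) * \<gamma> j * b i j)"
      using insert.hyps by (intro sum.cong refl) (auto simp: \<gamma>_def)
    also have "\<dots> = (\<Sum>i\<in>insert k F. \<Sum>j\<in>insert k F. cnj (\<gamma> i) * \<gamma> j * b i j)"
      using insert.hyps by (simp add: \<gamma>_def)
    finally show "0 \<le> Re (\<Sum>i\<in>F. \<Sum>j\<in>F. cnj (\<beta> i) * \<beta> j * b i j)"
      using insert.prems[of \<gamma>] by simp
  qed
  then show ?case
    unfolding eq by (intro add_nonneg_nonneg mult_nonneg_nonneg insert.prems) simp_all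
qed simp

lemma hilbert_tensor_cinner:
  "hilbert_tensor D E T \<Longrightarrow> x \<in> D \<Longrightarrow> x' \<in> D \<Longrightarrow> y \<in> E \<Longrightarrow> y' \<in> E \<Longrightarrow>
    cinner (T x y) (T x' y') = cinner x x' * cinner y y'"
  unfolding hilbert_tensor_def by blast

lemma tensor_space_image: "tensor_space D E T = closure (cspan ((\<lambda>(x, y). T x y) ` (D \<times> E)))"
  unfolding tensor_space_def by (rule arg_cong[where f="\<lambda>X. closure (cspan X)"]) auto

lemma hilbert_tensor_UNIV:
  "hilbert_tensor D E T \<Longrightarrow> UNIV = closure (cspan ((\<lambda>(x, y). T x y) ` (D \<times> E)))"
  unfolding hilbert_tensor_def tensor_space_image by simp

lemma hilbert_tensor_flip:
  assumes "hilbert_tensor D E T"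
  shows "hilbert_tensor E D (\<lambda>y x. T x y)"
proof -
  have "{T x y | y x. y \<in> E \<and> x \<in> D} = {T x y | x y. x \<in> D \<and> y \<in> E}" by blast
  then show ?thesis
    using assms unfolding hilbert_tensor_def tensor_space_def by (simp add: mult.commute)
qed

lemma linear_bound_tensor_right:
  assumes T: "hilbert_tensor D E T" and E: "closed_csubspace E" and x: "x \<in> D"
  shows "linear_bound E (norm x) (T x)"
proof -
  note inner = hilbert_tensor_cinner[OF T x x]
  have zero: "z = 0" if "cinner z z = 0" for z :: 'c
    using that by simp
  show ?thesis
    unfolding linear_bound_def
  proof (intro conjI ballI allI)
    fix y assume y: "y \<in> E"
    show "T x (scaleC c y) = scaleC c (T x y)" for c
    proof -
      have cy: "scaleC c y \<in> E" using E y by (rule closed_csubspace_scale)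
      have "T x (scaleC c y) - scaleC c (T x y) = 0"
        by (rule zero) (simp add: cinner_simps inner y cy algebra_simps)
      then show ?thesis by simp
    qed
    have "(norm (T x y))\<^sup>2 = (norm x * norm y)\<^sup>2"
      unfolding norm_sq_cinner[of "T x y"] inner[OF y y]
      by (simp add: cinner_self power_mult_distrib flip: of_real_mult)
    then show "norm (T x y) \<le> norm x * norm y" by simp
    fix y' assume y': "y' \<in> E"
    have yy: "y + y' \<in> E" using E y y' by (rule closed_csubspace_add)
    have "T x (y + y') - (T x y + T x y') = 0"
      by (rule zero, simp only: cinner_simps inner y y' yy) (simp add: algebra_simps)
    then show "T x (y + y') = T x y + T x y'" by simp
  qed
qed

lemma linear_bound_tensor_left:
  assumes "hilbert_tensor D E T" "closed_csubspace D" "y \<in> E"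
  shows "linear_bound D (norm y) (\<lambda>x. T x y)"
  by (rule linear_bound_tensor_right[OF hilbert_tensor_flip[OF assms(1)] assms(2,3)])

text \<open>For a finite sum of tensors, the defect between \<open>K\<^sup>2\<close> times its
  squared norm and the squared norm of its image is a Schur product: the Gram matrix of the left
  factors against a matrix that is positive because \<open>Y\<close> is bounded by
  \<open>K\<close>.\<close>

lemma tensor_right_operator_exists:
  fixes D :: "'a::chilbert_space set" and E :: "'b::chilbert_space set"
    and T :: "'a \<Rightarrow> 'b \<Rightarrow> 'c::chilbert_space"
  assumes T: "hilbert_tensor D E T" and D: "closed_csubspace D" and E: "closed_csubspace E"
    and Y: "linear_bound E K Y" "Y ` E \<subseteq> E" and K: "K \<ge> 0"
  obtains Z where "linear_bound UNIV K Z" "\<And>x y. x \<in> D \<Longrightarrow> y \<in> E \<Longrightarrow> Z (T x y) = T x (Y y)"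
proof -
  obtain Z where Z: "linear_bound (closure (cspan ((\<lambda>(x, y). T x y) ` (D \<times> E)))) K Z"
    "\<And>i. i \<in> D \<times> E \<Longrightarrow> Z ((\<lambda>(x, y). T x y) i) = (\<lambda>(x, y). T x (Y y)) i"
  proof (rule linear_bound_extension[OF _ K])
    fix F :: "('a \<times> 'b) set" and c
    assume F: "finite F" "F \<subseteq> D \<times> E"
    \<comment> \<open>The weighted Gram matrix of the right factors for the form
      \<open>K\<^sup>2 - Y\<^sup>*Y\<close>; the coefficients \<open>c\<close> are absorbed into
      it.\<close>
    define b where "b i j = cnj (c i) * c j *
      (of_real (K\<^sup>2) * cinner (snd i) (snd j) - cinner (Y (snd i)) (Y (snd j)))" for i j :: "'a \<times> 'b"
    have mem: "fst i \<in> D" "snd i \<in> E" "Y (snd i) \<in> E" if "i \<in> F" for i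
      using that F Y(2) by force+
    have "0 \<le> Re (\<Sum>i\<in>F. \<Sum>j\<in>F. cinner (fst i) (fst j) * b i j)"
    proof (rule schur_gram_nonneg[OF F(1)])
      fix \<alpha> :: "('a \<times> 'b) \<Rightarrow> complex"
      let ?y = "\<Sum>i\<in>F. scaleC (\<alpha> i * c i) (snd i)"
      have yE: "?y \<in> E" using mem by (intro closed_csubspace_sum[OF E] closed_csubspace_scale[OF E])
      have Yy: "Y ?y = (\<Sum>i\<in>F. scaleC (\<alpha> i * c i) (Y (snd i)))"
        using mem by (subst linear_bound_sum[OF Y(1) E])
          (auto simp: linear_bound_scale[OF Y(1) E] intro!: closed_csubspace_scale[OF E])
      have "(\<Sum>i\<in>F. \<Sum>j\<in>F. cnj (\<alpha> i) * \<alpha> j * b i j) = of_real (K\<^sup>2) * cinner ?y ?y - cinner (Y ?y) (Y ?y)"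
        unfolding Yy unfolding cinner_sum_left unfolding cinner_sum_right
          sum_distrib_left sum_subtractf[symmetric]
        by (intro sum.cong refl) (simp add: b_def cinner_simps algebra_simps)
      then have "Re (\<Sum>i\<in>F. \<Sum>j\<in>F. cnj (\<alpha> i) * \<alpha> j * b i j) = K\<^sup>2 * (norm ?y)\<^sup>2 - (norm (Y ?y))\<^sup>2"
        by (simp add: cinner_self flip: of_real_power of_real_mult)
      moreover have "(norm (Y ?y))\<^sup>2 \<le> (K * norm ?y)\<^sup>2"
        using linear_bound_norm[OF Y(1) E yE] by (intro power_mono) simp_all
      ultimately show "0 \<le> Re (\<Sum>i\<in>F. \<Sum>j\<in>F. cnj (\<alpha> i) * \<alpha> j * b i j)"
        by (simp add: power_mult_distrib)
    qed
    also have "(\<Sum>i\<in>F. \<Sum>j\<in>F. cinner (fst i) (fst j) * b i j) =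
      of_real (K\<^sup>2) * cinner (\<Sum>i\<in>F. scaleC (c i) (T (fst i) (snd i))) (\<Sum>i\<in>F. scaleC (c i) (T (fst i) (snd i))) -
      cinner (\<Sum>i\<in>F. scaleC (c i) (T (fst i) (Y (snd i)))) (\<Sum>i\<in>F. scaleC (c i) (T (fst i) (Y (snd i))))"
      unfolding cinner_sum_left unfolding cinner_sum_right sum_distrib_left sum_subtractf[symmetric]
      by (intro sum.cong refl)
         (simp add: b_def cinner_simps mem hilbert_tensor_cinner[OF T] algebra_simps)
    finally have "(norm (\<Sum>i\<in>F. scaleC (c i) (T (fst i) (Y (snd i)))))\<^sup>2 \<le>
      (K * norm (\<Sum>i\<in>F. scaleC (c i) (T (fst i) (snd i))))\<^sup>2"
      by (simp add: cinner_self power_mult_distrib flip: of_real_power of_real_mult)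
    then show "norm (\<Sum>i\<in>F. scaleC (c i) ((\<lambda>(x, y). T x (Y y)) i)) \<le>
      K * norm (\<Sum>i\<in>F. scaleC (c i) ((\<lambda>(x, y). T x y) i))"
      using K by (simp add: case_prod_beta)
  qed blast
  from Z(1) have "linear_bound UNIV K Z" using hilbert_tensor_UNIV[OF T] by simp
  then show thesis using that Z(2) by fastforce
qed

lemma tensor_left_operator_exists:
  assumes T: "hilbert_tensor D E T" and "closed_csubspace D" "closed_csubspace E"
    "linear_bound D K X" "X ` D \<subseteq> D" "K \<ge> 0"
  obtains Z where "linear_bound UNIV K Z" "\<And>x y. x \<in> D \<Longrightarrow> y \<in> E \<Longrightarrow> Z (T x y) = T (X x) y"
proof (rule tensor_right_operator_exists[OF hilbert_tensor_flip[OF T] assms(3,2,4,5,6)])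
  fix Z
  assume "linear_bound UNIV K Z" "\<And>y x. y \<in> E \<Longrightarrow> x \<in> D \<Longrightarrow> Z (T x y) = T (X x) y"
  then show thesis by (intro that)
qed

lemma is_op_tensor_iff:
  assumes "hilbert_tensor D E T"
  shows "is_op_tensor D E T A B Z \<longleftrightarrow>
    (\<exists>K\<ge>0. linear_bound UNIV K Z) \<and> (\<forall>x\<in>D. \<forall>y\<in>E. Z (T x y) = T (A x) (B y))"
  using assms unfolding is_op_tensor_def hilbert_tensor_def bop_iff by simp

lemma op_tensor_right:
  assumes T: "hilbert_tensor D E T" and "closed_csubspace D" "closed_csubspace E"
    "linear_bound E K Y" "Y ` E \<subseteq> E" "K \<ge> 0"
  shows "is_op_tensor D E T (\<lambda>x. x) Y (op_tensor D E T (\<lambda>x. x) Y)"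
  unfolding op_tensor_def
proof (rule someI_ex[where P="is_op_tensor D E T (\<lambda>x. x) Y"])
  show "\<exists>Z. is_op_tensor D E T (\<lambda>x. x) Y Z"
    using tensor_right_operator_exists[OF assms] assms(6) unfolding is_op_tensor_iff[OF T] by metis
qed

lemma op_tensor_left:
  assumes T: "hilbert_tensor D E T" and "closed_csubspace D" "closed_csubspace E"
    "linear_bound D K X" "X ` D \<subseteq> D" "K \<ge> 0"
  shows "is_op_tensor D E T X (\<lambda>y. y) (op_tensor D E T X (\<lambda>y. y))"
  unfolding op_tensor_def
proof (rule someI_ex[where P="is_op_tensor D E T X (\<lambda>y. y)"])
  show "\<exists>Z. is_op_tensor D E T X (\<lambda>y. y) Z"
    using tensor_left_operator_exists[OF assms] assms(6) unfolding is_op_tensor_iff[OF T] by metis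
qed

text \<open>The norm bound of the operator obtained in the existence proof carries over to the one chosen
  by \<^const>\<open>op_tensor\<close>, because elementary tensors are total.\<close>

lemma op_tensor_right_bound:
  assumes T: "hilbert_tensor D E T" and "closed_csubspace D" "closed_csubspace E"
    "linear_bound E K Y" "Y ` E \<subseteq> E" "K \<ge> 0"
  shows "linear_bound UNIV K (op_tensor D E T (\<lambda>x. x) Y)"
proof -
  obtain Z where Z: "linear_bound UNIV K Z" "\<And>x y. x \<in> D \<Longrightarrow> y \<in> E \<Longrightarrow> Z (T x y) = T x (Y y)"
    using tensor_right_operator_exists[OF assms] by blast
  have *: "is_op_tensor D E T (\<lambda>x. x) Y (op_tensor D E T (\<lambda>x. x) Y)"
    by (rule op_tensor_right[OF assms])
  then obtain L where L: "linear_bound UNIV L (op_tensor D E T (\<lambda>x. x) Y)"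
    unfolding is_op_tensor_iff[OF T] by blast
  have "op_tensor D E T (\<lambda>x. x) Y z = Z z" for z
    by (rule linear_bound_eqI[OF L Z(1) hilbert_tensor_UNIV[OF T]])
       (use * Z(2) in \<open>auto simp: is_op_tensor_iff[OF T]\<close>)
  then have "op_tensor D E T (\<lambda>x. x) Y = Z" by (rule ext)
  then show ?thesis using Z(1) by simp
qed

text \<open>Tensoring with a fixed vector is bounded, so the closed span of the generating tensors
  absorbs first the closed span in the right slot, then that in the left one.\<close>

lemma tensor_total:
  assumes T: "hilbert_tensor (closure (cspan A)) (closure (cspan B)) T"
  shows "closure (cspan ((\<lambda>(x, y). T x y) ` (A \<times> B))) = UNIV"
proof -
  let ?N = "closure (cspan ((\<lambda>(x, y). T x y) ` (A \<times> B)))"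
  have N: "closed_csubspace ?N" by simp
  have *: "T x y \<in> ?N" if x: "x \<in> A" and y: "y \<in> closure (cspan B)" for x y
  proof -
    have "x \<in> closure (cspan A)" using x by (rule closure_span_superset)
    note lin = linear_bound_tensor_right[OF T closed_csubspace_closure_span this]
    show ?thesis
      using y
    proof (induction rule: closure_span_induct)
      case (base y)
      then show ?case using x by (intro closure_span_superset) auto
    next
      case (limit f y)
      show ?case
        by (rule closed_csubspace_limit[OF N limit(4) linear_bound_tendsto[OF lin _ limit(1-3)]]) simp
    qed (auto simp: linear_bound_zero[OF lin] linear_bound_add[OF lin] linear_bound_scale[OF lin]
         closed_csubspace_zero[OF N] closed_csubspace_add[OF N] closed_csubspace_scale[OF N])
  qed
  have "T x y \<in> ?N" if x: "x \<in> closure (cspan A)" and y: "y \<in> closure (cspan B)" for x y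
  proof -
    note lin = linear_bound_tensor_left[OF T closed_csubspace_closure_span y]
    show ?thesis
      using x
    proof (induction rule: closure_span_induct)
      case (base x)
      then show ?case using * y by blast
    next
      case (limit f x)
      show ?case
        by (rule closed_csubspace_limit[OF N limit(4) linear_bound_tendsto[OF lin _ limit(1-3)]]) simp
    qed (auto simp: linear_bound_zero[OF lin] linear_bound_add[OF lin] linear_bound_scale[OF lin]
         closed_csubspace_zero[OF N] closed_csubspace_add[OF N] closed_csubspace_scale[OF N])
  qed
  then have "(\<lambda>(x, y). T x y) ` (closure (cspan A) \<times> closure (cspan B)) \<subseteq> ?N" by auto
  then have "UNIV \<subseteq> ?N"
    unfolding hilbert_tensor_UNIV[OF T] by (rule closure_span_subset[OF N])
  then show ?thesis by blast
qed

text \<open>An operator for each vector of the total set \<open>\<psi> ` J\<close> is obtained by extension in the first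
  variable; their values at a fixed vector are then extended in the second variable.\<close>

lemma hilbert_tensor_exists:
  fixes \<phi> :: "'i \<Rightarrow> 'a::chilbert_space" and \<psi> :: "'j \<Rightarrow> 'b::chilbert_space"
    and \<tau> :: "'i \<Rightarrow> 'j \<Rightarrow> 'c::chilbert_space"
  assumes inner: "\<And>i i' j j'. i \<in> I \<Longrightarrow> i' \<in> I \<Longrightarrow> j \<in> J \<Longrightarrow> j' \<in> J \<Longrightarrow>
      cinner (\<tau> i j) (\<tau> i' j') = cinner (\<phi> i) (\<phi> i') * cinner (\<psi> j) (\<psi> j')"
    and total: "closure (cspan ((\<lambda>(i, j). \<tau> i j) ` (I \<times> J))) = UNIV"
    and DE: "D = closure (cspan (\<phi> ` I))" "E = closure (cspan (\<psi> ` J))"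
  obtains T where "hilbert_tensor D E T" "\<And>i j. i \<in> I \<Longrightarrow> j \<in> J \<Longrightarrow> T (\<phi> i) (\<psi> j) = \<tau> i j"
proof -
  have csub: "closed_csubspace D" "closed_csubspace E" using DE by simp_all
  have "\<exists>R. linear_bound D (norm (\<psi> j)) R \<and> (\<forall>i\<in>I. R (\<phi> i) = \<tau> i j)" if j: "j \<in> J" for j
  proof -
    have "cinner (\<tau> i j) (\<tau> i' j) = of_real ((norm (\<psi> j))\<^sup>2) * cinner (\<phi> i) (\<phi> i')"
      if "i \<in> I" "i' \<in> I" for i i'
      using inner[OF that j j] by (simp add: cinner_self)
    then show ?thesis
      using linear_bound_extension_gram[of I "\<lambda>i. \<tau> i j" "norm (\<psi> j)" \<phi>] DE(1) norm_ge_zero by metis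
  qed
  then obtain R where R: "\<And>j. j \<in> J \<Longrightarrow> linear_bound D (norm (\<psi> j)) (R j)"
      "\<And>i j. i \<in> I \<Longrightarrow> j \<in> J \<Longrightarrow> R j (\<phi> i) = \<tau> i j"
    by metis
  have R_inner: "cinner (R j x) (R j' x') = cinner (\<psi> j) (\<psi> j') * cinner x x'"
    if "j \<in> J" "j' \<in> J" "x \<in> D" "x' \<in> D" for j j' x x'
    by (rule linear_bound_inner_eqI[OF R(1)[OF that(1)] R(1)[OF that(2)] DE(1) DE(1) _ that(3,4)])
       (use R(2) that(1,2) inner in auto)
  have "\<exists>Q. linear_bound E (norm x) Q \<and> (\<forall>j\<in>J. Q (\<psi> j) = R j x)" if x: "x \<in> D" for x
  proof -
    have "cinner (R j x) (R j' x) = of_real ((norm x)\<^sup>2) * cinner (\<psi> j) (\<psi> j')"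
      if "j \<in> J" "j' \<in> J" for j j'
      using R_inner[OF that x x] by (simp add: cinner_self)
    then show ?thesis
      using linear_bound_extension_gram[of J "\<lambda>j. R j x" "norm x" \<psi>] DE(2) norm_ge_zero by metis
  qed
  then obtain T where T: "\<And>x. x \<in> D \<Longrightarrow> linear_bound E (norm x) (T x)"
      "\<And>x j. x \<in> D \<Longrightarrow> j \<in> J \<Longrightarrow> T x (\<psi> j) = R j x"
    by metis
  have T_inner: "cinner (T x y) (T x' y') = cinner x x' * cinner y y'"
    if "x \<in> D" "x' \<in> D" "y \<in> E" "y' \<in> E" for x x' y y'
    by (rule linear_bound_inner_eqI[OF T(1)[OF that(1)] T(1)[OF that(2)] DE(2) DE(2) _ that(3,4)])
       (use T(2) that(1,2) R_inner in auto)
  have \<phi>: "\<phi> i \<in> D" if "i \<in> I" for i using that DE(1) by (simp add: closure_span_superset)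
  have \<psi>: "\<psi> j \<in> E" if "j \<in> J" for j using that DE(2) by (simp add: closure_span_superset)
  have T_eq: "T (\<phi> i) (\<psi> j) = \<tau> i j" if "i \<in> I" "j \<in> J" for i j
    using T(2)[OF \<phi>] R(2) that by simp
  have "(\<lambda>(i, j). \<tau> i j) ` (I \<times> J) \<subseteq> tensor_space D E T"
    using T_eq \<phi> \<psi> unfolding tensor_space_image
    by (auto intro!: closure_span_superset) (metis (no_types, lifting) SigmaI case_prod_conv image_eqI)
  then have "tensor_space D E T = UNIV"
    using closure_span_subset[OF closed_csubspace_tensor_space] total by blast
  then have "hilbert_tensor D E T"
    unfolding hilbert_tensor_def using T_inner by blast
  then show thesis using that T_eq by blast
qed

section \<open>Square-integrable functions\<close>

lemma L2_integrable: "f \<in> L2 A \<Longrightarrow> integrable lborel (\<lambda>r. (norm (f r))\<^sup>2)"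
  and L2_zero: "f \<in> L2 A \<Longrightarrow> r \<notin> A \<Longrightarrow> f r = 0"
  unfolding L2_def by blast+

lemma L2_mono: "f \<in> L2 A \<Longrightarrow> A \<subseteq> B \<Longrightarrow> f \<in> L2 B"
  unfolding L2_def by blast

text \<open>The values may lie in a nonseparable space, where a pair of Borel functions may fail to
  be Borel. Simple approximants are paired instead, and the limit is taken after applying
  \<open>h\<close>.\<close>

lemma L2_compose2_measurable:
  assumes "f \<in> L2 A" "g \<in> L2 B" "\<And>r u v. u \<longlonglongrightarrow> f r \<Longrightarrow> v \<longlonglongrightarrow> g r \<Longrightarrow> (\<lambda>n. h (u n) (v n)) \<longlonglongrightarrow> h (f r) (g r)"
  shows "(\<lambda>r. h (f r) (g r) :: 'b::{metric_space}) \<in> borel_measurable lborel"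
proof -
  obtain s t where s: "\<And>n. simple_function lborel (s n)" "\<And>r. (\<lambda>n. s n r) \<longlonglongrightarrow> f r"
    and t: "\<And>n. simple_function lborel (t n)" "\<And>r. (\<lambda>n. t n r) \<longlonglongrightarrow> g r"
    using assms(1,2) unfolding L2_def by blast
  show ?thesis
  proof (rule borel_measurable_LIMSEQ_metric)
    show "(\<lambda>r. h (s n r) (t n r)) \<in> borel_measurable lborel" for n
      by (rule borel_measurable_simple_function, rule simple_function_compose2[OF s(1) t(1)])
    show "(\<lambda>n. h (s n r) (t n r)) \<longlonglongrightarrow> h (f r) (g r)" for r
      by (rule assms(3)[OF s(2) t(2)])
  qed
qed

lemma L2_cut:
  assumes f: "f \<in> L2 A" and B: "B \<in> sets lborel"
  shows "cut B f \<in> L2 (A \<inter> B)"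
proof -
  obtain s where s: "\<And>n. simple_function lborel (s n)" "\<And>r. (\<lambda>n. s n r) \<longlonglongrightarrow> f r"
    using f unfolding L2_def by blast
  have "simple_function lborel (cut B (s n))" for n
    unfolding cut_def using B by (intro simple_function_If_set s simple_function_const) auto
  moreover have "(\<lambda>n. cut B (s n) r) \<longlonglongrightarrow> cut B f r" for r
    using s(2)[of r] by (simp add: cut_def)
  moreover have "(\<lambda>r. (norm (cut B f r))\<^sup>2) = (\<lambda>r. indicator B r *\<^sub>R (norm (f r))\<^sup>2)"
    by (auto simp: cut_def indicator_def)
  then have "integrable lborel (\<lambda>r. (norm (cut B f r))\<^sup>2)"
    using integrable_mult_indicator[OF B L2_integrable[OF f]] by simp
  moreover have "cut B f r = 0" if "r \<notin> A \<inter> B" for r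
    using that L2_zero[OF f] by (auto simp: cut_def)
  ultimately show ?thesis
    unfolding L2_def mem_Collect_eq by (intro conjI exI[of _ "\<lambda>n. cut B (s n)"] allI impI)
qed

lemma L2_add:
  assumes f: "f \<in> L2 A" and g: "g \<in> L2 A"
  shows "(\<lambda>r. f r + g r) \<in> L2 A"
proof -
  obtain s t where s: "\<And>n. simple_function lborel (s n)" "\<And>r. (\<lambda>n. s n r) \<longlonglongrightarrow> f r"
    and t: "\<And>n. simple_function lborel (t n)" "\<And>r. (\<lambda>n. t n r) \<longlonglongrightarrow> g r"
    using f g unfolding L2_def by blast
  have "\<exists>u. (\<forall>n. simple_function lborel (u n)) \<and> (\<forall>r. (\<lambda>n. u n r) \<longlonglongrightarrow> f r + g r)"
    using s t by (intro exI[of _ "\<lambda>n r. s n r + t n r"]) (auto intro: tendsto_add)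
  moreover have "integrable lborel (\<lambda>r. (norm (f r + g r))\<^sup>2)"
  proof (rule Bochner_Integration.integrable_bound)
    show "integrable lborel (\<lambda>r. 2 * (norm (f r))\<^sup>2 + 2 * (norm (g r))\<^sup>2)"
      using L2_integrable[OF f] L2_integrable[OF g] by simp
    show "(\<lambda>r. (norm (f r + g r))\<^sup>2) \<in> borel_measurable lborel"
      by (rule L2_compose2_measurable[OF f g]) (intro tendsto_intros)
    have "(norm (f r + g r))\<^sup>2 \<le> 2 * (norm (f r))\<^sup>2 + 2 * (norm (g r))\<^sup>2" for r
    proof -
      have "0 \<le> (norm (f r - g r))\<^sup>2" by simp
      then show ?thesis unfolding norm_add_sq norm_diff_sq by simp
    qed
    then show "AE r in lborel. norm ((norm (f r + g r))\<^sup>2) \<le> norm (2 * (norm (f r))\<^sup>2 + 2 * (norm (g r))\<^sup>2)"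
      by simp
  qed
  ultimately show ?thesis
    using L2_zero[OF f] L2_zero[OF g] unfolding L2_def by simp
qed

lemma L2_integrable_cinner:
  assumes f: "f \<in> L2 A" and g: "g \<in> L2 B"
  shows "integrable lborel (\<lambda>r. cinner (f r) (g r))"
proof (rule Bochner_Integration.integrable_bound)
  show "integrable lborel (\<lambda>r. (norm (f r))\<^sup>2 + (norm (g r))\<^sup>2)"
    using L2_integrable[OF f] L2_integrable[OF g] by simp
  show "(\<lambda>r. cinner (f r) (g r)) \<in> borel_measurable lborel"
    by (rule L2_compose2_measurable[OF f g]) (intro tendsto_intros)
  have "cmod (cinner (f r) (g r)) \<le> (norm (f r))\<^sup>2 + (norm (g r))\<^sup>2" for r
  proof -
    have "0 \<le> (norm (f r) - norm (g r))\<^sup>2" "0 \<le> norm (f r) * norm (g r)" by simp_all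
    then show ?thesis
      using cinner_Cauchy_Schwarz[of "f r" "g r"] unfolding power2_diff mult.assoc by linarith
  qed
  then show "AE r in lborel. norm (cinner (f r) (g r)) \<le> norm ((norm (f r))\<^sup>2 + (norm (g r))\<^sup>2)"
    by simp
qed

text \<open>Under \<open>exp\<close> this becomes multiplicativity, which is why the Fock space over
  a disjoint union is a tensor product.\<close>

lemma l2_inner_add_disjoint:
  assumes "f \<in> L2 A" "f' \<in> L2 A" "g \<in> L2 B" "g' \<in> L2 B" "A \<inter> B = {}"
  shows "l2_inner (\<lambda>r. f r + g r) (\<lambda>r. f' r + g' r) = l2_inner f f' + l2_inner g g'"
proof -
  have "cinner (f r + g r) (f' r + g' r) = cinner (f r) (f' r) + cinner (g r) (g' r)" for r
  proof (cases "r \<in> A")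
    case True
    then have "r \<notin> B" using assms(5) by blast
    then show ?thesis using L2_zero assms(3,4) by (metis add.right_neutral cinner_zero_left)
  next
    case False
    then show ?thesis using L2_zero assms(1,2) by (metis add_0 cinner_zero_left)
  qed
  then show ?thesis
    unfolding l2_inner_def using assms by (simp add: L2_integrable_cinner)
qed

text \<open>Members of \<open>L2 {0..}\<close> vanish at negative arguments, so the shift is a plain
  translation and invariance of Lebesgue measure applies.\<close>

lemma shift_eq: "f \<in> L2 {0..} \<Longrightarrow> shift t f = (\<lambda>r. f (r - t))"
  using L2_zero by (fastforce simp: shift_def)

lemma L2_shift:
  assumes f: "f \<in> L2 {0..}"
  shows "shift t f \<in> L2 {t..}"
proof -
  obtain s where s: "\<And>n. simple_function lborel (s n)" "\<And>r. (\<lambda>n. s n r) \<longlonglongrightarrow> f r"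
    using f unfolding L2_def by blast
  have "simple_function lborel (\<lambda>r. s n (r - t))" for n
    unfolding simple_function_def
  proof (intro conjI ballI)
    show "finite ((\<lambda>r. s n (r - t)) ` space lborel)"
      using simple_functionD(1)[OF s(1)[of n]] by (rule finite_subset[rotated]) auto
    fix x
    have "(\<lambda>r. r - t) -` (s n -` {x} \<inter> space lborel) \<inter> space lborel \<in> sets lborel"
      by (rule measurable_sets[OF _ simple_functionD(2)[OF s(1)]]) simp
    then show "(\<lambda>r. s n (r - t)) -` {x} \<inter> space lborel \<in> sets lborel"
      by (simp add: vimage_def)
  qed
  moreover have "integrable lborel (\<lambda>r. (norm (f (r - t)))\<^sup>2)"
    using lborel_integrable_real_affine[OF L2_integrable[OF f], of 1 "- t"] by simp
  ultimately show ?thesis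
    using s(2) L2_zero[OF f] unfolding shift_eq[OF f] L2_def mem_Collect_eq
    by (intro conjI exI[of _ "\<lambda>n r. s n (r - t)"] allI impI) auto
qed

lemma l2_inner_shift:
  assumes "f \<in> L2 {0..}" "g \<in> L2 {0..}"
  shows "l2_inner (shift t f) (shift t g) = l2_inner f g"
  unfolding l2_inner_def shift_eq[OF assms(1)] shift_eq[OF assms(2)]
  using lborel_integral_real_affine[of 1 "\<lambda>r. cinner (f r) (g r)" "- t"] by simp

section \<open>Fock space\<close>

text \<open>The bound \<open>1\<close> comes from
  \<open>\<parallel>P x\<parallel>\<^sup>2 = \<langle>x, P x\<rangle>\<close> and
  Cauchy-Schwarz.\<close>

lemma orth_projection_linear_bound:
  assumes "orth_projection P"
  shows "linear_bound UNIV 1 P"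
proof -
  obtain K where K: "linear_bound UNIV K P"
    using assms unfolding orth_projection_def bop_iff by blast
  have "norm (P x) \<le> norm x" for x
  proof (cases "P x = 0")
    case False
    have "cinner (P x) (P x) = cinner x (P x)"
      using assms unfolding orth_projection_def by (metis comp_apply)
    then have "(norm (P x))\<^sup>2 = Re (cinner x (P x))" by (simp add: norm_sq_cinner)
    also have "\<dots> \<le> norm x * norm (P x)"
      using cinner_Cauchy_Schwarz[of x "P x"] complex_Re_le_cmod[of "cinner x (P x)"] by linarith
    finally show ?thesis using False by (simp add: power2_eq_square)
  qed simp
  then show ?thesis using K unfolding linear_bound_def by simp
qed

context fock_space
begin

lemma closed_csubspace_fock [simp]: "closed_csubspace (fock A)"
  by (simp add: fock_def)

lemma fock_half_line [simp]: "fock {0..} = UNIV"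
  by (simp add: fock_def total_eps)

lemma eps_in_fock: "f \<in> L2 A \<Longrightarrow> eps f \<in> fock A"
  unfolding fock_def by (simp add: closure_span_superset)

text \<open>The prescription \<open>\<epsilon>(f) \<otimes> \<epsilon>(g) \<mapsto> \<epsilon>(f +
  g)\<close> has the right inner products by disjointness of supports, and is total because each
  \<open>f\<close> is the sum of its two cuts. One such map is a witness for the \<open>SOME\<close>
  in \<open>fock_split\<close>.\<close>

lemma fock_split:
  assumes s: "s \<ge> 0"
  shows hilbert_tensor_fock_split: "hilbert_tensor (fock {0..<s}) (fock {s..}) (fock_split s)"
    and fock_split_eps:
      "f \<in> L2 {0..} \<Longrightarrow> fock_split s (eps (cut {0..<s} f)) (eps (cut {s..} f)) = eps f"
proof -
  have sub: "{0..<s} \<subseteq> {0..}" "{s..} \<subseteq> {0..}" "{0..<s} \<inter> {s..} = {}" using s by auto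
  have cut: "cut {0..<s} f \<in> L2 {0..<s}" "cut {s..} f \<in> L2 {s..}" if "f \<in> L2 {0..}" for f :: "real \<Rightarrow> 'k"
    using L2_cut[OF that, of "{0..<s}"] L2_cut[OF that, of "{s..}"] s
    by (auto elim!: L2_mono)
  have cut_add: "(\<lambda>r. cut {0..<s} f r + cut {s..} f r) = f" if "f \<in> L2 {0..}" for f :: "real \<Rightarrow> 'k"
    using L2_zero[OF that] by (auto simp: cut_def fun_eq_iff)
  have add: "(\<lambda>r. f r + g r) \<in> L2 {0..}" if "f \<in> L2 {0..<s}" "g \<in> L2 {s..}" for f g :: "real \<Rightarrow> 'k"
    using that sub by (intro L2_add) (auto elim: L2_mono)
  obtain T where T: "hilbert_tensor (fock {0..<s}) (fock {s..}) T"
    "\<And>f g. f \<in> L2 {0..<s} \<Longrightarrow> g \<in> L2 {s..} \<Longrightarrow> T (eps f) (eps g) = eps (\<lambda>r. f r + g r)"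
  proof (rule hilbert_tensor_exists[of "L2 {0..<s}" "L2 {s..}" "\<lambda>f g. eps (\<lambda>r. f r + g r)" eps eps])
    fix f f' g g' :: "real \<Rightarrow> 'k"
    assume fg: "f \<in> L2 {0..<s}" "f' \<in> L2 {0..<s}" "g \<in> L2 {s..}" "g' \<in> L2 {s..}"
    then have fg': "f \<in> L2 {0..}" "f' \<in> L2 {0..}" "g \<in> L2 {0..}" "g' \<in> L2 {0..}"
      using sub L2_mono by blast+
    show "cinner (eps (\<lambda>r. f r + g r)) (eps (\<lambda>r. f' r + g' r)) =
        cinner (eps f) (eps f') * cinner (eps g) (eps g')"
      using fg fg' sub(3) by (simp add: cinner_eps add l2_inner_add_disjoint exp_add)
  next
    have "eps ` L2 {0..} \<subseteq> (\<lambda>(f, g). eps (\<lambda>r. f r + g r)) ` (L2 {0..<s} \<times> L2 {s..})"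
    proof clarify
      fix f :: "real \<Rightarrow> 'k" assume f: "f \<in> L2 {0..}"
      show "eps f \<in> (\<lambda>(f, g). eps (\<lambda>r. f r + g r)) ` (L2 {0..<s} \<times> L2 {s..})"
        by (rule image_eqI[of _ _ "(cut {0..<s} f, cut {s..} f)"]) (simp_all add: cut_add cut f)
    qed
    then have "closure (cspan (eps ` L2 {0..})) \<subseteq>
        closure (cspan ((\<lambda>(f, g). eps (\<lambda>r. f r + g r)) ` (L2 {0..<s} \<times> L2 {s..})))"
      by (intro closure_mono complex_vector.span_mono)
    then show "closure (cspan ((\<lambda>(f, g). eps (\<lambda>r. f r + g r)) ` (L2 {0..<s} \<times> L2 {s..}))) = UNIV"
      unfolding total_eps by blast
  qed (auto simp: fock_def)
  have "hilbert_tensor (fock {0..<s}) (fock {s..}) T \<and>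
     (\<forall>f\<in>L2 {0..}. T (eps (cut {0..<s} f)) (eps (cut {s..} f)) = eps f)"
    using T by (simp add: cut cut_add)
  from someI[where P="\<lambda>T. hilbert_tensor (fock {0..<s}) (fock {s..}) T \<and>
     (\<forall>f\<in>L2 {0..}. T (eps (cut {0..<s} f)) (eps (cut {s..} f)) = eps f)", OF this]
  show "hilbert_tensor (fock {0..<s}) (fock {s..}) (fock_split s)"
    "f \<in> L2 {0..} \<Longrightarrow> fock_split s (eps (cut {0..<s} f)) (eps (cut {s..} f)) = eps f"
    unfolding fock_split_def by blast+
qed

lemma L2_cut_past: "f \<in> L2 {0..} \<Longrightarrow> cut {0..<s} f \<in> L2 {0..<s}"
  using L2_cut[of f "{0..}" "{0..<s}"] by (auto elim!: L2_mono)

lemma L2_cut_future: "f \<in> L2 {0..} \<Longrightarrow> cut {s..} f \<in> L2 {s..}"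
  using L2_cut[of f "{0..}" "{s..}"] by (auto elim!: L2_mono)

text \<open>Translation preserves \<open>l2_inner\<close>, so the exponential vectors and their
  images have equal Gram matrices. The chosen operator agrees with the constructed one on a total
  set and so inherits its bound.\<close>

lemma fock_shift:
  assumes t: "t \<ge> 0"
  shows linear_bound_fock_shift: "linear_bound UNIV 1 (fock_shift t)"
    and fock_shift_mem: "fock_shift t x \<in> fock {t..}"
proof -
  have shift: "shift t f \<in> L2 {0..}" if "f \<in> L2 {0..}" for f :: "real \<Rightarrow> 'k"
    using L2_mono[OF L2_shift[OF that, of t]] t by simp
  obtain Z where Z: "linear_bound (closure (cspan (eps ` L2 {0..}))) 1 Z"
    "\<And>f. f \<in> L2 {0..} \<Longrightarrow> Z (eps f) = eps (shift t f)"
    by (rule linear_bound_extension_gram[of "L2 {0..}" "\<lambda>f. eps (shift t f)" 1 eps])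
       (simp_all add: cinner_eps shift l2_inner_shift)
  have "Z \<in> bop (fock {0..}) \<and> (\<forall>f\<in>L2 {0..}. Z (eps f) = eps (shift t f))"
    using Z unfolding bop_iff total_eps by (auto intro!: exI[of _ 1])
  from someI[where P="\<lambda>T. T \<in> bop (fock {0..}) \<and> (\<forall>f\<in>L2 {0..}. T (eps f) = eps (shift t f))", OF this]
  have spec: "fock_shift t \<in> bop (fock {0..})" "\<And>f. f \<in> L2 {0..} \<Longrightarrow> fock_shift t (eps f) = eps (shift t f)"
    unfolding fock_shift_def second_quant_def by blast+
  then obtain L where L: "linear_bound UNIV L (fock_shift t)" unfolding bop_iff by auto
  have "fock_shift t z = Z z" for z
    by (rule linear_bound_eqI[OF L Z(1)[unfolded total_eps] total_eps[symmetric]]) (use Z(2) spec(2) in auto)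
  then have "fock_shift t = Z" by (rule ext)
  then show bound: "linear_bound UNIV 1 (fock_shift t)" using Z(1) unfolding total_eps by simp
  have "fock_shift t ` UNIV \<subseteq> fock {t..}"
    by (rule linear_bound_image_subset[OF bound total_eps[symmetric]])
       (auto simp: spec(2) intro!: eps_in_fock L2_shift)
  then show "fock_shift t x \<in> fock {t..}" by blast
qed

text \<open>Countable additivity is given for matrix elements only, so finite additivity is derived
  there and lifted by testing the difference of both sides against itself.\<close>

lemma finite_stop_time_increment:
  assumes S: "finite_stop_time S" and ab: "0 \<le> a" "a \<le> b"
  shows "S {ennreal a<..ennreal b} x = S {0..ennreal b} x - S {0..ennreal a} x"
proof -
  have add: "(\<lambda>n. cinner z (S (A n) x)) sums cinner z (S (\<Union>n. A n) x)"
    if "range A \<subseteq> sets borel" "disjoint_family A" for A and z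
    using S that unfolding finite_stop_time_def by blast
  \<comment> \<open>The empty set, repeated, is a disjoint family, and a constant series converges
    only if its term is zero.\<close>
  have "(\<lambda>n::nat. cinner z (S {} x)) sums cinner z (S {} x)" for z
    using add[of "\<lambda>_. {}"] by (simp add: disjoint_family_on_def)
  then have empty: "cinner z (S {} x) = 0" for z
    using sums_summable summable_const_iff by blast
  let ?A = "{0..ennreal a}" and ?B = "{ennreal a<..ennreal b}"
  have un: "?A \<union> ?B = {0..ennreal b}"
    using ab by (intro ivl_disj_un) (simp_all add: ennreal_leI)
  have "(\<lambda>n. cinner z (S (binaryset ?A ?B n) x)) sums cinner z (S {0..ennreal b} x)" for z
  proof -
    have "disjoint_family (binaryset ?A ?B)"
      by (auto simp: disjoint_family_on_def binaryset_def)
    then show ?thesis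
      using add[of "binaryset ?A ?B" z] by (simp add: range_binaryset_eq UN_binaryset_eq un)
  qed
  moreover have "(\<lambda>n. cinner z (S (binaryset ?A ?B n) x)) sums (cinner z (S ?A x) + cinner z (S ?B x))" for z
    by (rule binaryset_sums[where f="\<lambda>A. cinner z (S A x)"]) (rule empty)
  ultimately have "cinner z (S {0..ennreal b} x) = cinner z (S ?A x) + cinner z (S ?B x)" for z
    using sums_unique2 by blast
  then have "cinner z (S {0..ennreal b} x - S ?A x - S ?B x) = 0" for z
    by (simp add: cinner_diff_right)
  then have "S {0..ennreal b} x - S ?A x - S ?B x = 0"
    using cinner_self_eq_0 by blast
  then show ?thesis by simp
qed

end

section \<open>Ampliated Fock space\<close>

context ampliated_fock_space
begin

lemma closed_csubspace_amp_fock [simp]: "closed_csubspace (amp_fock A)"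
  by (simp add: amp_fock_def)

lemma amp_fock_image: "amp_fock A = closure (cspan ((\<lambda>(u, x). tens u x) ` (UNIV \<times> fock A)))"
  unfolding amp_fock_def tensor_space_image ..

lemma amp_fock_half_line [simp]: "amp_fock {0..} = UNIV"
  using hilbert_tensor_tens unfolding amp_fock_def hilbert_tensor_def by simp

lemma tens_in_amp_fock: "x \<in> fock A \<Longrightarrow> tens u x \<in> amp_fock A"
  unfolding amp_fock_image by (rule closure_span_superset) auto

lemma total_tens: "UNIV = closure (cspan ((\<lambda>(u, x). tens u x) ` (UNIV \<times> UNIV)))"
  by (rule hilbert_tensor_UNIV[OF hilbert_tensor_tens])

lemma cinner_tens: "cinner (tens u x) (tens v y) = cinner u v * cinner x y"
  by (rule hilbert_tensor_cinner[OF hilbert_tensor_tens]) simp_all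

text \<open>The same triple tensors provide totality for both bracketings,
  \<open>amp_split_past\<close> and \<open>amp_split_future\<close>.\<close>

lemma total_tens_fock_split:
  assumes "t \<ge> 0"
  shows "closure (cspan ((\<lambda>(u, x, y). tens u (fock_split t x y)) `
    (UNIV \<times> fock {0..<t} \<times> fock {t..}))) = UNIV"
proof -
  let ?B = "(\<lambda>(x, y). fock_split t x y) ` (fock {0..<t} \<times> fock {t..})"
  have "hilbert_tensor (closure (cspan UNIV)) (closure (cspan ?B)) tens"
    using hilbert_tensor_tens hilbert_tensor_UNIV[OF hilbert_tensor_fock_split[OF assms]] by simp
  from tensor_total[OF this]
  have "closure (cspan ((\<lambda>(x, y). tens x y) ` (UNIV \<times> ?B))) = UNIV" .
  moreover have "(\<lambda>(x, y). tens x y) ` (UNIV \<times> ?B) =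
      (\<lambda>(u, x, y). tens u (fock_split t x y)) ` (UNIV \<times> fock {0..<t} \<times> fock {t..})"
    by force
  ultimately show ?thesis by simp
qed

lemma hilbert_tensor_amp_split_past:
  assumes t: "t \<ge> 0"
  shows "hilbert_tensor (amp_fock {0..<t}) (fock {t..}) (amp_split_past t)"
proof -
  note cinner_split = hilbert_tensor_cinner[OF hilbert_tensor_fock_split[OF t]]
  obtain T where T: "hilbert_tensor (amp_fock {0..<t}) (fock {t..}) T"
    "\<And>i y. i \<in> UNIV \<times> fock {0..<t} \<Longrightarrow> y \<in> fock {t..} \<Longrightarrow>
      T ((\<lambda>(u, x). tens u x) i) ((\<lambda>y. y) y) = (\<lambda>(u, x) y. tens u (fock_split t x y)) i y"
  proof (rule hilbert_tensor_exists[of "UNIV \<times> fock {0..<t}" "fock {t..}"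
        "\<lambda>(u, x) y. tens u (fock_split t x y)" "\<lambda>(u, x). tens u x" "\<lambda>y. y"])
    have "(\<lambda>(i, y). (\<lambda>(u, x) y. tens u (fock_split t x y)) i y) ` ((UNIV \<times> fock {0..<t}) \<times> fock {t..}) =
      (\<lambda>(u, x, y). tens u (fock_split t x y)) ` (UNIV \<times> fock {0..<t} \<times> fock {t..})"
      by force
    then show "closure (cspan ((\<lambda>(i, y). (\<lambda>(u, x) y. tens u (fock_split t x y)) i y) `
        ((UNIV \<times> fock {0..<t}) \<times> fock {t..}))) = UNIV"
      using total_tens_fock_split[OF t] by simp
  qed (auto simp: amp_fock_image cinner_tens cinner_split)
  have "hilbert_tensor (amp_fock {0..<t}) (fock {t..}) T \<and>
     (\<forall>u. \<forall>x\<in>fock {0..<t}. \<forall>y\<in>fock {t..}. T (tens u x) y = tens u (fock_split t x y))"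
    using T(1) T(2)[of "(_, _)"] by simp
  from someI[where P="\<lambda>T. hilbert_tensor (amp_fock {0..<t}) (fock {t..}) T \<and>
     (\<forall>u. \<forall>x\<in>fock {0..<t}. \<forall>y\<in>fock {t..}. T (tens u x) y = tens u (fock_split t x y))", OF this]
  show "hilbert_tensor (amp_fock {0..<t}) (fock {t..}) (amp_split_past t)"
    unfolding amp_split_past_def by blast
qed

lemma amp_split_future:
  assumes t: "t \<ge> 0"
  shows hilbert_tensor_amp_split_future:
      "hilbert_tensor (fock {0..<t}) (amp_fock {t..}) (amp_split_future t)"
    and amp_split_future_tens: "x \<in> fock {0..<t} \<Longrightarrow> y \<in> fock {t..} \<Longrightarrow>
      amp_split_future t x (tens u y) = tens u (fock_split t x y)"
proof -
  note cinner_split = hilbert_tensor_cinner[OF hilbert_tensor_fock_split[OF t]]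
  obtain T where T: "hilbert_tensor (fock {0..<t}) (amp_fock {t..}) T"
    "\<And>x j. x \<in> fock {0..<t} \<Longrightarrow> j \<in> UNIV \<times> fock {t..} \<Longrightarrow>
      T ((\<lambda>x. x) x) ((\<lambda>(u, y). tens u y) j) = (\<lambda>x (u, y). tens u (fock_split t x y)) x j"
  proof (rule hilbert_tensor_exists[of "fock {0..<t}" "UNIV \<times> fock {t..}"
        "\<lambda>x (u, y). tens u (fock_split t x y)" "\<lambda>x. x" "\<lambda>(u, y). tens u y"])
    have "(\<lambda>(x, j). (\<lambda>x (u, y). tens u (fock_split t x y)) x j) ` (fock {0..<t} \<times> (UNIV \<times> fock {t..})) =
      (\<lambda>(u, x, y). tens u (fock_split t x y)) ` (UNIV \<times> fock {0..<t} \<times> fock {t..})"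
      by force
    then show "closure (cspan ((\<lambda>(x, j). (\<lambda>x (u, y). tens u (fock_split t x y)) x j) `
        (fock {0..<t} \<times> (UNIV \<times> fock {t..})))) = UNIV"
      using total_tens_fock_split[OF t] by simp
  qed (auto simp: amp_fock_image cinner_tens cinner_split)
  have "hilbert_tensor (fock {0..<t}) (amp_fock {t..}) T \<and>
     (\<forall>u. \<forall>x\<in>fock {0..<t}. \<forall>y\<in>fock {t..}. T x (tens u y) = tens u (fock_split t x y))"
    using T(1) T(2)[of _ "(_, _)"] by simp
  from someI[where P="\<lambda>T. hilbert_tensor (fock {0..<t}) (amp_fock {t..}) T \<and>
     (\<forall>u. \<forall>x\<in>fock {0..<t}. \<forall>y\<in>fock {t..}. T x (tens u y) = tens u (fock_split t x y))", OF this]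
  show "hilbert_tensor (fock {0..<t}) (amp_fock {t..}) (amp_split_future t)"
    "x \<in> fock {0..<t} \<Longrightarrow> y \<in> fock {t..} \<Longrightarrow>
      amp_split_future t x (tens u y) = tens u (fock_split t x y)"
    unfolding amp_split_future_def by blast+
qed

lemma ampliation:
  assumes "linear_bound UNIV K Y" "K \<ge> 0"
  shows linear_bound_ampliation: "linear_bound UNIV K (ampliation Y)"
    and ampliation_tens: "ampliation Y (tens u x) = tens u (Y x)"
  using op_tensor_right_bound[OF hilbert_tensor_tens closed_csubspace_UNIV closed_csubspace_UNIV
      assms(1) subset_UNIV assms(2)]
    op_tensor_right[OF hilbert_tensor_tens closed_csubspace_UNIV closed_csubspace_UNIV
      assms(1) subset_UNIV assms(2)]
  unfolding ampliation_def is_op_tensor_def by blast+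

lemma ampliation_orth_projection:
  assumes P: "orth_projection P"
  shows cinner_ampliation_projection: "cinner (ampliation P x) y = cinner x (ampliation P y)"
    and ampliation_projection_idem: "ampliation P (ampliation P x) = ampliation P x"
proof -
  note lin = linear_bound_ampliation[OF orth_projection_linear_bound[OF P] zero_le_one]
  note tens = ampliation_tens[OF orth_projection_linear_bound[OF P] zero_le_one]
  have "cinner (ampliation P x) y = 1 * cinner x (ampliation P y)"
  proof (rule linear_bound_cinner_eqI[OF lin linear_bound_id linear_bound_id lin total_tens total_tens])
    fix x y assume "x \<in> (\<lambda>(u, x). tens u x) ` (UNIV \<times> UNIV)" "y \<in> (\<lambda>(u, x). tens u x) ` (UNIV \<times> UNIV)"
    then show "cinner (ampliation P x) y = 1 * cinner x (ampliation P y)"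
      using P by (auto simp: tens cinner_tens orth_projection_def)
  qed simp_all
  then show "cinner (ampliation P x) y = cinner x (ampliation P y)" by simp
  have PP: "P (P x) = P x" for x
    using P unfolding orth_projection_def by (metis comp_apply)
  show "ampliation P (ampliation P x) = ampliation P x"
    by (rule linear_bound_eqI[OF linear_bound_compose[OF lin subset_UNIV lin zero_le_one] lin total_tens])
       (auto simp: tens PP)
qed

text \<open>The range of \<Gamma> lies in the future of \<open>c\<close>, so
  \<open>W = \<Gamma> X \<Gamma>\<^sup>*\<close> leaves that subspace invariant and the flow acts as
  \<open>I \<otimes> W\<close>. The bound \<open>K\<close> survives because \<Gamma> and its adjoint
  are contractions.\<close>

lemma ccr_flow:
  assumes c: "c \<ge> 0" and X: "linear_bound UNIV K X" and K: "K \<ge> 0"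
  obtains W where "W ` amp_fock {c..} \<subseteq> amp_fock {c..}" "linear_bound UNIV K (ccr_flow c X)"
    "\<And>a w. a \<in> fock {0..<c} \<Longrightarrow> w \<in> amp_fock {c..} \<Longrightarrow>
      ccr_flow c X (amp_split_future c a w) = amp_split_future c a (W w)"
proof -
  define \<Gamma> where "\<Gamma> = ampliation (fock_shift c)"
  define W where "W = \<Gamma> \<circ> X \<circ> adj UNIV \<Gamma>"
  have \<Gamma>: "linear_bound UNIV 1 \<Gamma>"
    unfolding \<Gamma>_def by (intro linear_bound_ampliation linear_bound_fock_shift c) simp
  have "\<Gamma> ` UNIV \<subseteq> amp_fock {c..}"
    by (rule linear_bound_image_subset[OF \<Gamma> total_tens])
       (auto simp: \<Gamma>_def ampliation_tens[OF linear_bound_fock_shift[OF c]] fock_shift_mem[OF c]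
         intro!: tens_in_amp_fock)
  then have sub: "W ` amp_fock {c..} \<subseteq> amp_fock {c..}" by (auto simp: W_def)
  have "linear_bound UNIV (1 * (K * 1)) (\<lambda>z. \<Gamma> (X (adj UNIV \<Gamma> z)))"
    by (rule linear_bound_compose[OF linear_bound_compose[OF linear_bound_adj[OF _ \<Gamma>] _ X K] _ \<Gamma>]) simp_all
  then have "linear_bound UNIV K W" unfolding W_def comp_def by simp
  then have W: "linear_bound (amp_fock {c..}) K W" by (rule linear_bound_mono) simp
  have eq: "ccr_flow c X = op_tensor (fock {0..<c}) (amp_fock {c..}) (amp_split_future c) (\<lambda>x. x) W"
    unfolding ccr_flow_def W_def \<Gamma>_def Let_def ..
  note T = hilbert_tensor_amp_split_future[OF c]
  show thesis
    using that[of W] sub op_tensor_right_bound[OF T _ _ W sub K] op_tensor_right[OF T _ _ W sub K]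
    unfolding eq is_op_tensor_def by simp
qed

lemma adapted_process_linear_bound:
  assumes "adapted_process M p V" "t \<ge> 0"
  obtains K where "K \<ge> 0" "linear_bound UNIV K (V t)"
  using assms unfolding adapted_process_def vn_tensor_def ultraweak_closure_def bop_iff by auto

text \<open>The past part preserves inner products by the adjoint relation in
  \<open>isometric_process\<close>; tensoring it with the identity preserves those of elementary
  tensors, which are total.\<close>

lemma hat_isometry:
  assumes ad: "adapted_process M p V" and iso: "isometric_process p V" and t: "t \<ge> 0"
  obtains L where "linear_bound UNIV L (hat p V t)" "\<And>x y. cinner (hat p V t x) (hat p V t y) = cinner x y"
proof -
  define D where "D = amp_fock {0..<t}"
  define W where "W = past_part p V t"
  have D: "closed_csubspace D" by (simp add: D_def)
  have "\<exists>W. is_past_part p t (V t) W" using ad t unfolding adapted_process_def by blast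
  then have "is_past_part p t (V t) W" unfolding W_def past_part_def by (rule someI_ex)
  then obtain K where K: "K \<ge> 0" "linear_bound D K W" "W ` D \<subseteq> D"
    unfolding is_past_part_def bop_iff D_def by blast
  have W_iso: "cinner (W x) (W y) = cinner x y" if "x \<in> D" "y \<in> D" for x y
    using cinner_adj[OF D K(2,3), of y "W x"] iso t that unfolding isometric_process_def D_def W_def by simp
  note T = hilbert_tensor_amp_split_past[OF t, folded D_def]
  have hat_eq: "hat p V t = op_tensor D (fock {t..}) (amp_split_past t) W (\<lambda>y. y)"
    unfolding hat_def D_def W_def ..
  have "is_op_tensor D (fock {t..}) (amp_split_past t) W (\<lambda>y. y) (hat p V t)"
    unfolding hat_eq by (rule op_tensor_left[OF T D _ K(2,3,1)]) simp
  then obtain L where L: "linear_bound UNIV L (hat p V t)"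
    "\<And>x y. x \<in> D \<Longrightarrow> y \<in> fock {t..} \<Longrightarrow> hat p V t (amp_split_past t x y) = amp_split_past t (W x) y"
    unfolding is_op_tensor_iff[OF T] by blast
  have "cinner (hat p V t x) (hat p V t y) = 1 * cinner x y" for x y
  proof (rule linear_bound_inner_eqI[OF L(1) L(1) hilbert_tensor_UNIV[OF T] hilbert_tensor_UNIV[OF T]])
    fix x y assume "x \<in> (\<lambda>(x, y). amp_split_past t x y) ` (D \<times> fock {t..})"
      "y \<in> (\<lambda>(x, y). amp_split_past t x y) ` (D \<times> fock {t..})"
    then show "cinner (hat p V t x) (hat p V t y) = 1 * cinner x y"
      using K(3) by (auto simp: L(2) hilbert_tensor_cinner[OF T] W_iso image_subset_iff)
  qed simp_all
  then show thesis using that L(1) by simp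
qed

end

section \<open>The cocycle and the stop time, compared over past and future\<close>

locale stopped_cocycle = ampliated_fock_space eps tens
  for eps :: "(real \<Rightarrow> 'k::chilbert_space) \<Rightarrow> 'f::chilbert_space"
    and tens :: "'h::chilbert_space \<Rightarrow> 'f \<Rightarrow> 'g::chilbert_space" +
  fixes M :: "('h \<Rightarrow> 'h) set" and p :: "'k \<Rightarrow> 'k"
    and S :: "ennreal set \<Rightarrow> 'f \<Rightarrow> 'f" and V :: "real \<Rightarrow> 'g \<Rightarrow> 'g"
  assumes stop_time: "finite_stop_time S"
    and cocycle: "adapted_cocycle M p V"
    and isometric: "isometric_process p V"
begin

text \<open>This is \<open>Q\<^sub>r\<close> of the overview, acting on the ampliated space.\<close>

definition past_proj :: "real \<Rightarrow> 'g \<Rightarrow> 'g" where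
  "past_proj r = ampliation (S {0..ennreal r})"

lemma adapted: "adapted_process M p V"
  using cocycle unfolding adapted_cocycle_def by blast

lemma orth_projection_S: "A \<in> sets borel \<Longrightarrow> orth_projection (S A)"
  using stop_time unfolding finite_stop_time_def by blast

lemma linear_bound_S: "A \<in> sets borel \<Longrightarrow> linear_bound UNIV 1 (S A)"
  by (intro orth_projection_linear_bound orth_projection_S)

lemma linear_bound_past_proj: "linear_bound UNIV 1 (past_proj r)"
  unfolding past_proj_def by (intro linear_bound_ampliation linear_bound_S) simp_all

lemma cinner_past_proj: "cinner (past_proj r x) y = cinner x (past_proj r y)"
  unfolding past_proj_def by (intro cinner_ampliation_projection orth_projection_S) simp

lemma past_proj_tens: "past_proj r (tens u x) = tens u (S {0..ennreal r} x)"
  unfolding past_proj_def by (intro ampliation_tens[of 1] linear_bound_S) simp_all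

lemma past_proj_zero: "past_proj 0 x = 0"
proof -
  have S0: "S {0..ennreal 0} = (\<lambda>x. 0)"
    using stop_time unfolding finite_stop_time_def by simp
  have "linear_bound UNIV 0 (ampliation (S {0..ennreal 0}))"
    unfolding S0 by (rule linear_bound_ampliation) (simp_all add: linear_bound_def)
  then show ?thesis
    unfolding past_proj_def linear_bound_def by simp
qed

lemma ampliation_increment:
  assumes "0 \<le> a" "a \<le> b"
  shows "ampliation (S {ennreal a<..ennreal b}) x = past_proj b x - past_proj a x"
proof -
  note lin = linear_bound_S[of "{ennreal a<..ennreal b}"]
  note pp = linear_bound_past_proj
  have diff: "linear_bound UNIV 2 (\<lambda>x. past_proj b x - past_proj a x)"
    unfolding linear_bound_def
  proof (intro conjI ballI allI)
    show "norm (past_proj b x - past_proj a x) \<le> 2 * norm x" for x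
      using norm_triangle_ineq4[of "past_proj b x" "past_proj a x"]
        linear_bound_norm[OF pp, of x b] linear_bound_norm[OF pp, of x a] by simp
  qed (simp_all add: linear_bound_add[OF pp] linear_bound_scale[OF pp] complex_vector.scale_right_diff_distrib)
  show ?thesis
  proof (rule linear_bound_eqI[OF linear_bound_ampliation[OF lin] diff total_tens])
    fix x assume "x \<in> (\<lambda>(u, x). tens u x) ` (UNIV \<times> UNIV)"
    then obtain u y where x: "x = tens u y" by auto
    show "ampliation (S {ennreal a<..ennreal b}) x = past_proj b x - past_proj a x"
      unfolding x past_proj_tens ampliation_tens[OF lin[simplified] zero_le_one]
      by (simp add: finite_stop_time_increment[OF stop_time assms]
          linear_bound_diff[OF linear_bound_tensor_right[OF hilbert_tensor_tens]])
  qed simp_all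
qed

text \<open>The increment \<open>E = Q\<^sub>b - Q\<^sub>a\<close> is itself an ampliated
  projection. For \<open>y = Q\<^sub>a x\<close> this gives \<open>\<parallel>Q\<^sub>b
  y\<parallel>\<^sup>2 = \<parallel>y\<parallel>\<^sup>2 + \<parallel>E
  y\<parallel>\<^sup>2\<close>, so \<open>E y = 0\<close> as \<open>Q\<^sub>b\<close> is a
  contraction. Taking adjoints yields the other order.\<close>

lemma past_proj_mult:
  assumes "0 \<le> a" "a \<le> b"
  shows "past_proj b (past_proj a x) = past_proj a x" "past_proj a (past_proj b x) = past_proj a x"
proof -
  note pp = linear_bound_past_proj
  have idem: "past_proj r (past_proj r x) = past_proj r x" for r x
    unfolding past_proj_def by (intro ampliation_projection_idem orth_projection_S) simp
  let ?E = "ampliation (S {ennreal a<..ennreal b})"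
  have E: "?E x = past_proj b x - past_proj a x" for x by (rule ampliation_increment[OF assms])
  have cinner_E: "cinner (?E x) (?E x) = cinner x (?E x)" for x
    using cinner_ampliation_projection[of "S {ennreal a<..ennreal b}"]
      ampliation_projection_idem[of "S {ennreal a<..ennreal b}"] orth_projection_S by simp
  have ba: "past_proj b (past_proj a x) = past_proj a x" for x
  proof -
    let ?y = "past_proj a x"
    have "Re (cinner ?y (?E ?y)) = (norm (?E ?y))\<^sup>2"
      unfolding norm_sq_cinner cinner_E ..
    also have "cinner ?y (?E ?y) = cinner (past_proj b ?y) (past_proj b ?y) - cinner ?y ?y"
      unfolding E cinner_diff_right by (simp add: idem cinner_past_proj)
    finally have "(norm ?y)\<^sup>2 + (norm (?E ?y))\<^sup>2 = (norm (past_proj b ?y))\<^sup>2"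
      by (simp add: norm_sq_cinner)
    moreover have "(norm (past_proj b ?y))\<^sup>2 \<le> (norm ?y)\<^sup>2"
      using linear_bound_norm[OF pp, of ?y b] by (intro power_mono) simp_all
    ultimately have "(norm (?E ?y))\<^sup>2 \<le> 0" by linarith
    then have "?E ?y = 0" by simp
    then show ?thesis unfolding E by (simp add: idem)
  qed
  then show "past_proj b (past_proj a x) = past_proj a x" .
  show "past_proj a (past_proj b x) = past_proj a x"
  proof (rule cinner_eqI[OF closed_csubspace_UNIV])
    show "cinner (past_proj a (past_proj b x)) z = cinner (past_proj a x) z" for z
      by (simp add: cinner_past_proj ba)
  qed simp_all
qed

text \<open>Adaptedness writes \<open>S [0, c]\<close> as \<open>A \<otimes> I\<close> on Fock
  space. Grouping the initial space with the future keeps \<open>A\<close> alone on the past. The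
  restriction \<open>c > 0\<close> is that of the definition of a stop time.\<close>

lemma past_proj_split:
  assumes c: "c > 0"
  obtains A where "A ` fock {0..<c} \<subseteq> fock {0..<c}"
    "\<And>a w. a \<in> fock {0..<c} \<Longrightarrow> w \<in> amp_fock {c..} \<Longrightarrow>
      past_proj c (amp_split_future c a w) = amp_split_future c (A a) w"
proof -
  have c0: "c \<ge> 0" using c by simp
  have "\<exists>A\<in>bop (fock {0..<c}).
      is_op_tensor (fock {0..<c}) (fock {c..}) (fock_split c) A (\<lambda>y. y) (S {0..ennreal c})"
    using stop_time c unfolding finite_stop_time_def by simp
  then obtain A where "A \<in> bop (fock {0..<c})"
    and op: "is_op_tensor (fock {0..<c}) (fock {c..}) (fock_split c) A (\<lambda>y. y) (S {0..ennreal c})"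
    by (rule bexE)
  then have A: "A ` fock {0..<c} \<subseteq> fock {0..<c}" by (simp add: bop_iff)
  from op have SA: "S {0..ennreal c} (fock_split c a y) = fock_split c (A a) y"
    if "a \<in> fock {0..<c}" "y \<in> fock {c..}" for a y
    using that unfolding is_op_tensor_def by blast
  note lin = linear_bound_tensor_right[OF hilbert_tensor_amp_split_future[OF c0] closed_csubspace_amp_fock]
  have "past_proj c (amp_split_future c a w) = amp_split_future c (A a) w"
    if a: "a \<in> fock {0..<c}" and w: "w \<in> amp_fock {c..}" for a w
  proof (rule linear_bound_eqI[OF linear_bound_compose[OF lin[OF a] subset_UNIV linear_bound_past_proj zero_le_one]
        lin amp_fock_image _ w])
    show Aa: "A a \<in> fock {0..<c}" using A(1) a by blast
    fix w assume "w \<in> (\<lambda>(u, x). tens u x) ` (UNIV \<times> fock {c..})"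
    then obtain u y where "w = tens u y" "y \<in> fock {c..}" by auto
    then show "past_proj c (amp_split_future c a w) = amp_split_future c (A a) w"
      using a Aa by (simp add: amp_split_future_tens[OF c0] past_proj_tens SA)
  qed
  then show thesis using that A(1) by blast
qed

text \<open>The case \<open>s = c\<close> needs no separate treatment: the cocycle identity for \<open>c + 0\<close> expresses
  \<open>V c\<close> through \<open>hat p V c\<close> as well.\<close>

lemma cocycle_factor:
  assumes "0 \<le> c" "c \<le> s"
  shows "V s z = hat p V c (ccr_flow c (V (s - c)) z)"
proof -
  have "V (c + (s - c)) = hat p V c \<circ> ccr_flow c (V (s - c))"
    using cocycle assms unfolding adapted_cocycle_def by (metis diff_ge_0_iff_ge)
  then show ?thesis by simp
qed

text \<open>At \<open>s = c = t\<close> the factorisation expresses \<open>V t\<close> through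
  \<open>V 0\<close>: the flow does not raise the bound and \<open>hat p V t\<close> preserves
  norms.\<close>

lemma uniform_linear_bound:
  obtains K where "K \<ge> 0" "\<And>t. t \<ge> 0 \<Longrightarrow> linear_bound UNIV K (V t)"
proof -
  obtain K where K: "K \<ge> 0" "linear_bound UNIV K (V 0)"
    by (rule adapted_process_linear_bound[OF adapted order_refl])
  have "linear_bound UNIV K (V t)" if t: "t \<ge> 0" for t
  proof -
    obtain L where L: "linear_bound UNIV L (V t)"
      by (rule adapted_process_linear_bound[OF adapted t])
    obtain H where H: "linear_bound UNIV H (hat p V t)"
      "\<And>x y. cinner (hat p V t x) (hat p V t y) = cinner x y"
      by (rule hat_isometry[OF adapted isometric t]) (rule that)
    have "linear_bound UNIV K (ccr_flow t (V 0))"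
      by (rule ccr_flow[OF t K(2,1)])
    moreover have "(norm (V t z))\<^sup>2 = (norm (ccr_flow t (V 0) z))\<^sup>2" for z
      unfolding norm_sq_cinner using cocycle_factor[OF t order_refl, of z] H(2) by simp
    ultimately have "norm (V t z) \<le> K * norm z" for z
      unfolding linear_bound_def by simp
    then show ?thesis using L unfolding linear_bound_def by simp
  qed
  then show thesis using that K(1) by blast
qed

lemma V_zero: "t \<ge> 0 \<Longrightarrow> V t 0 = 0"
  using adapted_process_linear_bound[OF adapted] linear_bound_zero[OF _ closed_csubspace_UNIV] by metis

lemma past_proj_commute:
  assumes c: "0 \<le> c" "c \<le> s" "c \<le> t"
  shows "cinner (V s (past_proj c x)) (V t y) = cinner (V s x) (V t (past_proj c y))"
proof (cases "c = 0")
  \<comment> \<open>Adaptedness is available only at positive times; at time 0 the projection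
    vanishes.\<close>
  case True
  then show ?thesis
    using V_zero[of s] V_zero[of t] c by (simp add: past_proj_zero)
next
  case False
  then have "c > 0" using c by simp
  obtain K where K: "K \<ge> 0" "\<And>t. t \<ge> 0 \<Longrightarrow> linear_bound UNIV K (V t)" by (rule uniform_linear_bound) (rule that)
  obtain L where H: "linear_bound UNIV L (hat p V c)"
    "\<And>x y. cinner (hat p V c x) (hat p V c y) = cinner x y"
    by (rule hat_isometry[OF adapted isometric c(1)]) (rule that)
  obtain A where A: "A ` fock {0..<c} \<subseteq> fock {0..<c}"
    "\<And>a w. a \<in> fock {0..<c} \<Longrightarrow> w \<in> amp_fock {c..} \<Longrightarrow>
      past_proj c (amp_split_future c a w) = amp_split_future c (A a) w"
    by (rule past_proj_split[OF \<open>c > 0\<close>]) (rule that)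
  \<comment> \<open>On tensors over the past and the future of \<open>c\<close>, the flow changes
    only the future factor and the projection only the past one.\<close>
  have commute: "ccr_flow c (V r) (past_proj c z) = past_proj c (ccr_flow c (V r) z)" if r: "r \<ge> 0" for r z
  proof -
    obtain W where W: "W ` amp_fock {c..} \<subseteq> amp_fock {c..}" "linear_bound UNIV K (ccr_flow c (V r))"
      "\<And>a w. a \<in> fock {0..<c} \<Longrightarrow> w \<in> amp_fock {c..} \<Longrightarrow>
        ccr_flow c (V r) (amp_split_future c a w) = amp_split_future c a (W w)"
      by (rule ccr_flow[OF c(1) K(2)[OF r] K(1)]) (rule that)
    show ?thesis
      by (rule linear_bound_eqI[OF linear_bound_compose[OF linear_bound_past_proj subset_UNIV W(2) K(1)]
            linear_bound_compose[OF W(2) subset_UNIV linear_bound_past_proj zero_le_one]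
            hilbert_tensor_UNIV[OF hilbert_tensor_amp_split_future[OF c(1)]]])
         (use A W in \<open>auto simp: image_subset_iff\<close>)
  qed
  have r: "s - c \<ge> 0" "t - c \<ge> 0" using c by simp_all
  show ?thesis
    unfolding cocycle_factor[OF c(1,2)] cocycle_factor[OF c(1,3)] H(2) commute[OF r(1)] commute[OF r(2)]
    by (rule cinner_past_proj)
qed

text \<open>Both sides factorise over the past and the future of \<open>c\<close>.\<close>

lemma past_proj_exponential:
  assumes c: "0 \<le> c" "c \<le> s" "c \<le> t" and f: "f \<in> L2 {0..}" and x: "x = tens u (eps f)"
  shows "cinner (V s x - V t x) (V s (past_proj c x) - V t (past_proj c x)) * cinner x x =
    cinner x (past_proj c x) * cinner (V s x - V t x) (V s x - V t x)"
proof (cases "c = 0")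
  case True
  have "V s 0 = 0" "V t 0 = 0"
    using V_zero c by simp_all
  then show ?thesis unfolding True past_proj_zero by simp
next
  case False
  then have "c > 0" using c by simp
  obtain K where K: "K \<ge> 0" "\<And>t. t \<ge> 0 \<Longrightarrow> linear_bound UNIV K (V t)" by (rule uniform_linear_bound) (rule that)
  obtain L where H: "linear_bound UNIV L (hat p V c)"
    "\<And>x y. cinner (hat p V c x) (hat p V c y) = cinner x y"
    by (rule hat_isometry[OF adapted isometric c(1)]) (rule that)
  obtain A where A: "A ` fock {0..<c} \<subseteq> fock {0..<c}"
    "\<And>a w. a \<in> fock {0..<c} \<Longrightarrow> w \<in> amp_fock {c..} \<Longrightarrow>
      past_proj c (amp_split_future c a w) = amp_split_future c (A a) w"
    by (rule past_proj_split[OF \<open>c > 0\<close>]) (rule that)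
  have r: "s - c \<ge> 0" "t - c \<ge> 0" using c by simp_all
  obtain Ws where Ws: "Ws ` amp_fock {c..} \<subseteq> amp_fock {c..}"
    "\<And>a w. a \<in> fock {0..<c} \<Longrightarrow> w \<in> amp_fock {c..} \<Longrightarrow>
      ccr_flow c (V (s - c)) (amp_split_future c a w) = amp_split_future c a (Ws w)"
    by (rule ccr_flow[OF c(1) K(2)[OF r(1)] K(1)]) (rule that)
  obtain Wt where Wt: "Wt ` amp_fock {c..} \<subseteq> amp_fock {c..}"
    "\<And>a w. a \<in> fock {0..<c} \<Longrightarrow> w \<in> amp_fock {c..} \<Longrightarrow>
      ccr_flow c (V (t - c)) (amp_split_future c a w) = amp_split_future c a (Wt w)"
    by (rule ccr_flow[OF c(1) K(2)[OF r(2)] K(1)]) (rule that)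
  note T = hilbert_tensor_amp_split_future[OF c(1)]
  define a where "a = eps (cut {0..<c} f)"
  define w where "w = tens u (eps (cut {c..} f))"
  \<comment> \<open>The difference of the two times lives entirely in this future factor; the
    projection will only replace \<open>a\<close> by \<open>A a\<close>.\<close>
  define v where "v = Ws w - Wt w"
  have a: "a \<in> fock {0..<c}" "A a \<in> fock {0..<c}"
    using A(1) L2_cut_past[OF f] by (auto simp: a_def intro: eps_in_fock)
  have w: "w \<in> amp_fock {c..}"
    unfolding w_def by (intro tens_in_amp_fock eps_in_fock L2_cut_future f)
  have Ww: "Ws w \<in> amp_fock {c..}" "Wt w \<in> amp_fock {c..}" using w Ws(1) Wt(1) by auto
  have v: "v \<in> amp_fock {c..}" unfolding v_def using Ww by (simp add: closed_csubspace_diff)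
  have x_eq: "x = amp_split_future c a w"
    unfolding x a_def w_def
    by (simp add: amp_split_future_tens[OF c(1)] eps_in_fock L2_cut_past L2_cut_future f fock_split_eps[OF c(1)])
  have D: "V s (amp_split_future c b w) - V t (amp_split_future c b w) = hat p V c (amp_split_future c b v)"
    if b: "b \<in> fock {0..<c}" for b
  proof -
    have "amp_split_future c b v = amp_split_future c b (Ws w) - amp_split_future c b (Wt w)"
      unfolding v_def
      by (rule linear_bound_diff[OF linear_bound_tensor_right[OF T _ b]]) (simp_all add: Ww)
    then show ?thesis
      unfolding cocycle_factor[OF c(1,2)] cocycle_factor[OF c(1,3)] Ws(2)[OF b w] Wt(2)[OF b w]
      by (simp add: linear_bound_diff[OF H(1)])
  qed
  show ?thesis
    \<comment> \<open>Both sides become the product of \<open>\<langle>a, A a\<rangle>\<close>,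
      \<open>\<langle>a, a\<rangle>\<close>, \<open>\<langle>v, v\<rangle>\<close> and
      \<open>\<langle>w, w\<rangle>\<close>.\<close>
    unfolding x_eq A(2)[OF a(1) w] D[OF a(1)] D[OF a(2)] H(2)
    by (simp add: hilbert_tensor_cinner[OF T] a v w)
qed

end

section \<open>Stopping sums\<close>

text \<open>Two values close to the same \<open>y\<close> are close to each other, so a Cauchy
  condition along an arbitrary filter needs only a single reference point for each \<open>e\<close>.
  It serves for partitions and for the horizon alike.\<close>

lemma net_converges:
  fixes f :: "'i \<Rightarrow> 'a::banach"
  assumes F: "F \<noteq> bot" and approx: "\<And>e. e > 0 \<Longrightarrow> \<exists>y. \<forall>\<^sub>F i in F. norm (f i - y) \<le> e"
  shows "\<exists>l. (f \<longlongrightarrow> l) F"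
proof -
  have "cauchy_filter (filtermap f F)"
    unfolding cauchy_filter_metric_filtermap
  proof (intro allI impI)
    fix e :: real assume "e > 0"
    then have "e / 3 > 0" by simp
    then obtain y where y: "\<forall>\<^sub>F i in F. norm (f i - y) \<le> e / 3" using approx by blast
    have "dist (f i) (f j) < e" if "norm (f i - y) \<le> e / 3" "norm (f j - y) \<le> e / 3" for i j
    proof -
      have "dist (f i) (f j) \<le> norm (f i - y) + norm (f j - y)"
        using dist_triangle2[of "f i" "f j" y] by (simp add: dist_norm)
      then show ?thesis using that \<open>e > 0\<close> by linarith
    qed
    with y show "\<exists>P. eventually P F \<and> (\<forall>i j. P i \<and> P j \<longrightarrow> dist (f i) (f j) < e)"
      by (intro exI[of _ "\<lambda>i. norm (f i - y) \<le> e / 3"]) blast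
  qed
  moreover have "filtermap f F \<noteq> bot" using F by (simp add: filtermap_bot_iff)
  ultimately have "\<exists>l. filtermap f F \<le> nhds l"
    using cauchy_filter_complete_converges[of "filtermap f F" UNIV] complete_UNIV by simp
  then show ?thesis by (simp add: filterlim_def)
qed

text \<open>\<open>Q r\<close> plays the role of \<open>S [0, r]\<close>; labelling the subintervals by a family \<open>U\<close> more general than
  \<open>V\<close> allows the difference of two stopping sums to be treated as one stopping sum.\<close>

fun step_sum :: "(real \<Rightarrow> 'a \<Rightarrow> 'a) \<Rightarrow> (real \<Rightarrow> 'a \<Rightarrow> 'a) \<Rightarrow> real \<Rightarrow> real list \<Rightarrow> 'a \<Rightarrow> 'a::ab_group_add" where
  "step_sum Q U a [] x = 0"
| "step_sum Q U a (b # bs) x = U b (Q b x - Q a x) + step_sum Q U b bs x"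

text \<open>Links the recursion, suited to induction over partition points, to the indexed form used
  by \<open>stop_sum\<close>.\<close>

lemma step_sum_conv_sum:
  "step_sum Q U a bs x =
    (\<Sum>j=1..<length (a # bs). U ((a # bs) ! j) (Q ((a # bs) ! j) x - Q ((a # bs) ! (j - 1)) x))"
proof (induction bs arbitrary: a)
  case (Cons b bs)
  have "(\<Sum>j=1..<length (a # b # bs). U ((a # b # bs) ! j) (Q ((a # b # bs) ! j) x - Q ((a # b # bs) ! (j - 1)) x)) =
    (\<Sum>j=0..<length (b # bs). U ((b # bs) ! j) (Q ((b # bs) ! j) x - Q ((a # b # bs) ! j) x))"
    by (simp add: sum.shift_bounds_Suc_ivl del: sum.op_ivl_Suc)
  also have "\<dots> = U b (Q b x - Q a x) +
    (\<Sum>j=1..<length (b # bs). U ((b # bs) ! j) (Q ((b # bs) ! j) x - Q ((a # b # bs) ! j) x))"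
    by (subst sum.atLeast_Suc_lessThan) simp_all
  also have "(\<Sum>j=1..<length (b # bs). U ((b # bs) ! j) (Q ((b # bs) ! j) x - Q ((a # b # bs) ! j) x)) =
      step_sum Q U b bs x"
    unfolding Cons.IH by (intro sum.cong refl) (auto simp: nth_Cons')
  finally show ?case by simp
qed simp

lemma step_sum_cong:
  "(\<And>b y. b \<in> set bs \<Longrightarrow> U b y = U' b y) \<Longrightarrow> step_sum Q U a bs x = step_sum Q U' a bs x"
  by (induction bs arbitrary: a) simp_all

lemma step_sum_diff:
  "step_sum Q (\<lambda>b y. U b y - U' b y) a bs x = step_sum Q U a bs x - step_sum Q U' a bs x"
  by (induction bs arbitrary: a) simp_all

lemma step_sum_append:
  "step_sum Q U a (bs @ s # cs) x = step_sum Q U a (bs @ [s]) x + step_sum Q U s cs x"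
  by (induction bs arbitrary: a) simp_all

text \<open>A new point \<open>q\<close> splits one increment in two. If both halves carry the label
  of the first old point beyond \<open>q\<close>, additivity joins them again. Some old point must
  lie beyond \<open>q\<close>, since otherwise a further increment would be appended.\<close>

lemma step_sum_insort:
  assumes "\<And>b y z. b \<ge> 0 \<Longrightarrow> U b (y + z) = U b y + U b z"
    and "0 \<le> q" "sorted bs" "\<exists>b\<in>set bs. q \<le> b"
    and "\<And>b. b \<in> set bs \<Longrightarrow> q \<le> b \<Longrightarrow> (\<And>b'. b' \<in> set bs \<Longrightarrow> q \<le> b' \<Longrightarrow> b \<le> b') \<Longrightarrow> U q = U b"
  shows "step_sum Q U a (insort q bs) x = step_sum Q U a bs x"
  using assms(3-5)
proof (induction bs arbitrary: a)
  case (Cons b bs)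
  show ?case
  proof (cases "q \<le> b")
    case True
    have "U q = U b" using Cons.prems(1) True by (intro Cons.prems(3)) auto
    moreover have "U b (Q q x - Q a x) + U b (Q b x - Q q x) = U b (Q b x - Q a x)"
      using assms(1)[of b "Q q x - Q a x" "Q b x - Q q x"] assms(2) True by simp
    ultimately show ?thesis using True by (simp add: add.assoc[symmetric])
  next
    case False
    have "step_sum Q U b (insort q bs) x = step_sum Q U b bs x"
    proof (rule Cons.IH)
      show "sorted bs" "\<exists>b\<in>set bs. q \<le> b" using Cons.prems(1,2) False by auto
      show "U q = U c" if "c \<in> set bs" "q \<le> c" "\<And>b'. b' \<in> set bs \<Longrightarrow> q \<le> b' \<Longrightarrow> c \<le> b'" for c
        using that False by (intro Cons.prems(3)) auto
    qed
    then show ?thesis using False by simp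
  qed
qed simp

text \<open>What the convergence proof uses of Fock space: \<open>Q\<close> stands for
  \<open>past_proj\<close>, \<open>X\<close> for the vectors
  \<open>u \<otimes> \<epsilon>(f)\<close>, \<open>K\<close> for the uniform bound.
  \<open>V_Q_total\<close> is a product identity, so that no division by the norm of
  \<open>x\<close> occurs.\<close>

locale stopping_family =
  fixes V Q :: "real \<Rightarrow> 'a \<Rightarrow> 'a::chilbert_space" and K :: real and X :: "'a set"
  assumes K: "K \<ge> 0"
    and linear_bound_V: "t \<ge> 0 \<Longrightarrow> linear_bound UNIV K (V t)"
    and linear_bound_Q: "linear_bound UNIV 1 (Q r)"
    and Q_zero: "Q 0 x = 0"
    and cinner_Q: "cinner (Q r x) y = cinner x (Q r y)"
    and Q_mult: "0 \<le> r \<Longrightarrow> r \<le> s \<Longrightarrow> Q s (Q r x) = Q r x" "0 \<le> r \<Longrightarrow> r \<le> s \<Longrightarrow> Q r (Q s x) = Q r x"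
    and V_Q: "0 \<le> r \<Longrightarrow> r \<le> s \<Longrightarrow> r \<le> t \<Longrightarrow> cinner (V s (Q r x)) (V t y) = cinner (V s x) (V t (Q r y))"
    and V_Q_total: "x \<in> X \<Longrightarrow> 0 \<le> r \<Longrightarrow> r \<le> s \<Longrightarrow> r \<le> t \<Longrightarrow>
      cinner (V s x - V t x) (V s (Q r x) - V t (Q r x)) * cinner x x =
      cinner x (Q r x) * cinner (V s x - V t x) (V s x - V t x)"
    and total: "closure (cspan X) = UNIV"
    and continuous: "continuous_on {0..} (\<lambda>r. V r x)"
begin

lemmas Q_lin = linear_bound_add[OF linear_bound_Q closed_csubspace_UNIV UNIV_I UNIV_I]
  linear_bound_scale[OF linear_bound_Q closed_csubspace_UNIV UNIV_I]
  linear_bound_diff[OF linear_bound_Q closed_csubspace_UNIV UNIV_I UNIV_I]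
  linear_bound_zero[OF linear_bound_Q closed_csubspace_UNIV]

lemmas V_lin = linear_bound_add[OF linear_bound_V closed_csubspace_UNIV UNIV_I UNIV_I]
  linear_bound_scale[OF linear_bound_V closed_csubspace_UNIV UNIV_I]
  linear_bound_diff[OF linear_bound_V closed_csubspace_UNIV UNIV_I UNIV_I]
  linear_bound_zero[OF linear_bound_V closed_csubspace_UNIV]

lemma norm_Q_le: "norm (Q r x) \<le> norm x"
  using linear_bound_norm[OF linear_bound_Q closed_csubspace_UNIV UNIV_I] by simp

lemma norm_Q_mono: "0 \<le> r \<Longrightarrow> r \<le> s \<Longrightarrow> norm (Q r x) \<le> norm (Q s x)"
  using norm_Q_le[of r "Q s x"] by (simp add: Q_mult)

lemma norm_Q_diff:
  assumes "0 \<le> a" "a \<le> b"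
  shows "(norm (Q b x - Q a x))\<^sup>2 = (norm (Q b x))\<^sup>2 - (norm (Q a x))\<^sup>2"
proof -
  have "cinner (Q b x) (Q a x) = cinner (Q a x) (Q a x)"
    using assms by (simp add: cinner_Q Q_mult)
  then show ?thesis unfolding norm_diff_sq by (simp add: norm_sq_cinner)
qed

text \<open>The property of \<open>V\<close> that makes the summands of a stopping sum orthogonal.\<close>

definition compatible :: "(real \<Rightarrow> 'a \<Rightarrow> 'a) \<Rightarrow> bool" where
  "compatible U \<longleftrightarrow> (\<forall>b\<ge>0. \<forall>x y. U b (x - y) = U b x - U b y) \<and>
    (\<forall>b c r x y. 0 \<le> r \<and> r \<le> b \<and> r \<le> c \<longrightarrow> cinner (U b (Q r x)) (U c y) = cinner (U b x) (U c (Q r y)))"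

lemma compatible_V: "compatible V"
  unfolding compatible_def using V_Q V_lin(3) by auto

text \<open>Relabelling forward in time keeps \<open>r \<le> b\<close> below the new label, so each
  of the four cross terms is covered by \<open>V_Q\<close>.\<close>

lemma compatible_V_diff:
  assumes "\<And>b. b \<le> \<nu> b"
  shows "compatible (\<lambda>b y. V b y - V (\<nu> b) y)"
  unfolding compatible_def
proof (intro conjI allI impI)
  fix b :: real and x y assume "0 \<le> b"
  then show "V b (x - y) - V (\<nu> b) (x - y) = V b x - V (\<nu> b) x - (V b y - V (\<nu> b) y)"
    using assms[of b] by (simp add: V_lin)
next
  fix b c r :: real and x y assume r: "0 \<le> r \<and> r \<le> b \<and> r \<le> c"
  then have "r \<le> \<nu> b" "r \<le> \<nu> c" using assms[of b] assms[of c] by linarith+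
  with r show "cinner (V b (Q r x) - V (\<nu> b) (Q r x)) (V c y - V (\<nu> c) y) =
      cinner (V b x - V (\<nu> b) x) (V c (Q r y) - V (\<nu> c) (Q r y))"
    by (simp add: cinner_diff_left cinner_diff_right V_Q)
qed

text \<open>Moved to the other side of the inner product, \<open>Q r\<close> annihilates every
  increment that starts at or after \<open>r\<close>.\<close>

lemma step_sum_orthogonal:
  assumes U: "compatible U" and r: "0 \<le> r" "r \<le> c" "r \<le> b" and bs: "sorted (b # bs)"
  shows "cinner (U c (Q r y)) (step_sum Q U b bs x) = 0"
  using r bs
proof (induction bs arbitrary: b)
  case (Cons d bs)
  have rd: "r \<le> d" "0 \<le> d" using Cons.prems by auto
  have "cinner (U c (Q r y)) (U d (Q d x - Q b x)) = cinner (U c y) (U d (Q r (Q d x - Q b x)))"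
    using U Cons.prems rd unfolding compatible_def by blast
  also have "Q r (Q d x - Q b x) = 0"
    using Cons.prems rd by (simp add: Q_lin Q_mult)
  also have "U d 0 = 0"
    using U rd(2) unfolding compatible_def by (metis diff_self)
  finally show ?case
    using Cons.IH[of d] Cons.prems rd by (simp add: cinner_add_right)
qed simp

text \<open>Pythagoras for orthogonal summands, followed by telescoping of the squared norms of the
  increments. \<open>C\<close> will be \<open>K\<^sup>2\<close> for a stopping sum and
  \<open>e\<^sup>2 / \<parallel>x\<parallel>\<^sup>2\<close> for a difference of two.\<close>

lemma norm_step_sum_le:
  assumes U: "compatible U" and C: "C \<ge> 0" and a: "0 \<le> a" and bs: "sorted (a # bs)" and T: "\<And>b. b \<in> set (a # bs) \<Longrightarrow> b \<le> T"
    and bound: "\<And>a b. 0 \<le> a \<Longrightarrow> a \<le> b \<Longrightarrow> b \<in> set bs \<Longrightarrow>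
      (norm (U b (Q b x - Q a x)))\<^sup>2 \<le> C * (norm (Q b x - Q a x))\<^sup>2"
  shows "(norm (step_sum Q U a bs x))\<^sup>2 \<le> C * ((norm (Q T x))\<^sup>2 - (norm (Q a x))\<^sup>2)"
  using a bs T bound
proof (induction bs arbitrary: a)
  case Nil
  have "(norm (Q a x))\<^sup>2 \<le> (norm (Q T x))\<^sup>2"
    using Nil by (intro power_mono norm_Q_mono) auto
  then show ?case using C by simp
next
  case (Cons b bs)
  have ab: "0 \<le> a" "a \<le> b" "0 \<le> b" using Cons.prems by auto
  \<comment> \<open>The increment is fixed by \<open>Q b\<close>, which puts the first summand into
    the form that orthogonality requires.\<close>
  have "Q b (Q b x - Q a x) = Q b x - Q a x"
    using ab by (simp add: Q_lin Q_mult)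
  then have orth: "cinner (U b (Q b x - Q a x)) (step_sum Q U b bs x) = 0"
    using step_sum_orthogonal[OF U, of b b b bs "Q b x - Q a x" x] Cons.prems ab by simp
  have IH: "(norm (step_sum Q U b bs x))\<^sup>2 \<le> C * ((norm (Q T x))\<^sup>2 - (norm (Q b x))\<^sup>2)"
    using Cons.prems ab by (intro Cons.IH) auto
  have "(norm (step_sum Q U a (b # bs) x))\<^sup>2 =
      (norm (U b (Q b x - Q a x)))\<^sup>2 + (norm (step_sum Q U b bs x))\<^sup>2"
    using orth by (simp add: norm_add_sq)
  also have "\<dots> \<le> C * (norm (Q b x - Q a x))\<^sup>2 + C * ((norm (Q T x))\<^sup>2 - (norm (Q b x))\<^sup>2)"
    using Cons.prems(4)[of a b] ab IH by (intro add_mono) auto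
  also have "\<dots> = C * ((norm (Q T x))\<^sup>2 - (norm (Q a x))\<^sup>2)"
    by (simp add: norm_Q_diff ab algebra_simps)
  finally show ?case .
qed

lemma norm_step_sum_V_le:
  assumes "0 \<le> a" "sorted (a # bs)" "\<And>b. b \<in> set (a # bs) \<Longrightarrow> b \<le> T"
  shows "(norm (step_sum Q V a bs x))\<^sup>2 \<le> K\<^sup>2 * ((norm (Q T x))\<^sup>2 - (norm (Q a x))\<^sup>2)"
proof (rule norm_step_sum_le[OF compatible_V _ assms])
  fix a b :: real assume ab: "0 \<le> a" "a \<le> b"
  have "norm (V b (Q b x - Q a x)) \<le> K * norm (Q b x - Q a x)"
    using ab by (intro linear_bound_norm[OF linear_bound_V]) auto
  then have "(norm (V b (Q b x - Q a x)))\<^sup>2 \<le> (K * norm (Q b x - Q a x))\<^sup>2"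
    by (rule power_mono) simp
  then show "(norm (V b (Q b x - Q a x)))\<^sup>2 \<le> K\<^sup>2 * (norm (Q b x - Q a x))\<^sup>2"
    by (simp add: power_mult_distrib)
qed simp_all

lemma V_diff_increment:
  assumes x: "x \<in> X" and ab: "0 \<le> a" "a \<le> b" and t: "b \<le> t"
  shows "(norm (V b (Q b x - Q a x) - V t (Q b x - Q a x)))\<^sup>2 * (norm x)\<^sup>2 =
    (norm (Q b x - Q a x))\<^sup>2 * (norm (V b x - V t x))\<^sup>2"
proof -
  define D where "D y = V b y - V t y" for y
  define E where "E y = Q b y - Q a y" for y
  have nonneg: "0 \<le> b" "0 \<le> t" using ab t by linarith+
  have D_diff: "D (y - z) = D y - D z" for y z
    using nonneg by (simp add: D_def V_lin)
  have D_Q: "cinner (D (Q r y)) (D z) = cinner (D y) (D (Q r z))" if "0 \<le> r" "r \<le> b" for r y z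
    using that t by (simp add: D_def cinner_diff_left cinner_diff_right V_Q)
  have E_E: "E (E y) = E y" for y
    using ab nonneg by (simp add: E_def Q_lin Q_mult)
  have D_E: "cinner (D (E y)) (D z) = cinner (D y) (D (E z))" for y z
    unfolding E_def D_diff cinner_diff_left cinner_diff_right
    using D_Q[OF ab] D_Q[OF nonneg(1) order_refl] by simp
  have E_adj: "cinner (E y) z = cinner y (E z)" for y z
    by (simp add: E_def cinner_diff_left cinner_diff_right cinner_Q)
  have D_total: "cinner (D x) (D (Q r x)) * cinner x x = cinner x (Q r x) * cinner (D x) (D x)"
    if "0 \<le> r" "r \<le> b" for r
    using V_Q_total[OF x, of r b t] that t by (simp add: D_def)
  \<comment> \<open>Difference of the product identities at \<open>r = b\<close> and
    \<open>r = a\<close>.\<close>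
  have "cinner (D x) (D (E x)) * cinner x x = cinner x (E x) * cinner (D x) (D x)"
    unfolding E_def D_diff cinner_diff_right left_diff_distrib
      D_total[OF ab] D_total[OF nonneg(1) order_refl] ..
  \<comment> \<open>\<open>E\<close> is idempotent and may be moved across both inner products, so
    one copy of it can be shared between the two arguments.\<close>
  then have "cinner (D (E x)) (D (E x)) * cinner x x = cinner (E x) (E x) * cinner (D x) (D x)"
    unfolding D_E E_adj E_E .
  then show ?thesis
    unfolding cinner_self of_real_mult[symmetric] of_real_eq_iff D_def E_def .
qed

section \<open>Sums over partitions and their refinement\<close>

definition partition_sum :: "real \<Rightarrow> real set \<Rightarrow> 'a \<Rightarrow> 'a" where
  "partition_sum t R x = step_sum Q V 0 (sorted_list_of_set (insert t R)) x"

lemma partition_list: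
  assumes "finite R" "R \<subseteq> {0<..<t}" "t > 0"
  shows "sorted (0 # sorted_list_of_set (insert t R))"
    "set (0 # sorted_list_of_set (insert t R)) \<subseteq> {0..t}"
  using assms by (force simp del: sorted_list_of_set_insert_remove)+

text \<open>The point is the constant \<open>K\<close>, the same for all partitions: the estimate
  telescopes to \<open>\<parallel>Q t x\<parallel>\<^sup>2\<close>, which is at most
  \<open>\<parallel>x\<parallel>\<^sup>2\<close>.\<close>

lemma partition_sum_lin:
  assumes R: "finite R" "R \<subseteq> {0<..<t}" "t > 0"
  shows "partition_sum t R (x + y) = partition_sum t R x + partition_sum t R y"
    and "partition_sum t R (scaleC c x) = scaleC c (partition_sum t R x)"
    and "norm (partition_sum t R x) \<le> K * norm x"
proof -
  have add: "step_sum Q V a bs (x + y) = step_sum Q V a bs x + step_sum Q V a bs y"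
    if "set bs \<subseteq> {0..}" for a bs
    using that
  proof (induction bs arbitrary: a)
    case (Cons b bs)
    have "Q b (x + y) - Q a (x + y) = (Q b x - Q a x) + (Q b y - Q a y)" by (simp add: Q_lin)
    then show ?case using Cons by (simp add: V_lin)
  qed simp
  have scale: "step_sum Q V a bs (scaleC c x) = scaleC c (step_sum Q V a bs x)"
    if "set bs \<subseteq> {0..}" for a bs
    using that
  proof (induction bs arbitrary: a)
    case (Cons b bs)
    have "Q b (scaleC c x) - Q a (scaleC c x) = scaleC c (Q b x - Q a x)"
      by (simp add: Q_lin complex_vector.scale_right_diff_distrib)
    then show ?case using Cons by (simp add: V_lin scaleC_add_right)
  qed simp
  have set: "set (sorted_list_of_set (insert t R)) \<subseteq> {0..}"
    using partition_list(2)[OF R] by auto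
  show "partition_sum t R (x + y) = partition_sum t R x + partition_sum t R y"
    "partition_sum t R (scaleC c x) = scaleC c (partition_sum t R x)"
    unfolding partition_sum_def by (rule add[OF set] scale[OF set])+
  have "(norm (partition_sum t R x))\<^sup>2 \<le> K\<^sup>2 * ((norm (Q t x))\<^sup>2 - (norm (Q 0 x))\<^sup>2)"
    unfolding partition_sum_def using partition_list[OF R] by (intro norm_step_sum_V_le) auto
  also have "\<dots> \<le> K\<^sup>2 * (norm x)\<^sup>2"
    using norm_Q_le[of t x] by (intro mult_left_mono) (simp_all add: Q_zero power_mono)
  also have "\<dots> = (K * norm x)\<^sup>2" by (simp add: power_mult_distrib)
  finally show "norm (partition_sum t R x) \<le> K * norm x"
    by (rule power2_le_imp_le) (use K in simp)
qed

lemma partition_sum_diff: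
  assumes "finite R" "R \<subseteq> {0<..<t}" "t > 0"
  shows "partition_sum t R (x - y) = partition_sum t R x - partition_sum t R y"
  using partition_sum_lin(1)[OF assms, of "x - y" y] by simp

text \<open>The next point of the coarser partition: labelling the finer partition \<open>P\<close> by it gives back the
  stopping sum of \<open>R\<close>.\<close>

definition next_point :: "real set \<Rightarrow> real \<Rightarrow> real" where
  "next_point R r = (if \<exists>c\<in>R. r \<le> c then Min {c \<in> R. r \<le> c} else r)"

lemma next_point:
  assumes "finite R"
  shows "r \<le> next_point R r"
    and "c \<in> R \<Longrightarrow> r \<le> c \<Longrightarrow> next_point R r \<in> R"
    and "c \<in> R \<Longrightarrow> r \<le> c \<Longrightarrow> next_point R r \<le> c"
    and "r \<in> R \<Longrightarrow> next_point R r = r"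
proof -
  have fin: "finite {c \<in> R. r \<le> c}" using assms by simp
  show le: "r \<le> next_point R r"
    using Min_in[OF fin] by (auto simp: next_point_def)
  show "next_point R r \<in> R" if "c \<in> R" "r \<le> c"
    using Min_in[OF fin] that by (auto simp: next_point_def)
  show ge: "next_point R r \<le> c" if "c \<in> R" "r \<le> c" for c
    using Min_le[OF fin] that by (auto simp: next_point_def)
  show "next_point R r = r" if "r \<in> R"
    using le ge[OF that] by simp
qed

text \<open>The extra points are inserted one at a time; the label \<open>next_point R\<close> is
  constant between consecutive points of \<open>R\<close>, so no insertion changes the sum.\<close>

lemma step_sum_refine:
  assumes F: "finite F" "F \<subseteq> {0<..t}" and R: "finite R" "R \<subseteq> {0<..t}" "t \<in> R"
  shows "step_sum Q (\<lambda>b. V (next_point R b)) 0 (sorted_list_of_set (R \<union> F)) x =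
    step_sum Q V 0 (sorted_list_of_set R) x"
  using F
proof (induction F rule: finite_induct)
  case empty
  show ?case using R(1) by (auto intro!: step_sum_cong simp: next_point(4))
next
  case (insert q F)
  let ?P = "R \<union> F"
  show ?case
  proof (cases "q \<in> ?P")
    case True
    then have "R \<union> insert q F = ?P" by blast
    then show ?thesis using insert by simp
  next
    case False
    have fin: "finite ?P" using R insert by simp
    have q: "0 < q" "q \<le> t" using insert.prems by auto
    have "sorted_list_of_set (R \<union> insert q F) = insort q (sorted_list_of_set ?P)"
      using sorted_list_of_set_insert[OF fin False] by simp
    also have "step_sum Q (\<lambda>b. V (next_point R b)) 0 \<dots> x =
        step_sum Q (\<lambda>b. V (next_point R b)) 0 (sorted_list_of_set ?P) x"
    proof (rule step_sum_insort)
      show "V (next_point R b) (y + z) = V (next_point R b) y + V (next_point R b) z" if "b \<ge> 0" for b y z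
        using that next_point(1)[OF R(1), of b] by (intro V_lin) linarith
      show "\<exists>b\<in>set (sorted_list_of_set ?P). q \<le> b" using R(3) q fin by auto
      fix b assume b: "b \<in> set (sorted_list_of_set ?P)" "q \<le> b"
        and least: "\<And>b'. b' \<in> set (sorted_list_of_set ?P) \<Longrightarrow> q \<le> b' \<Longrightarrow> b \<le> b'"
      \<comment> \<open>By minimality of \<open>b\<close>, no point of \<open>R\<close> lies in
        \<open>[q, b)\<close>.\<close>
      have "{c \<in> R. q \<le> c} = {c \<in> R. b \<le> c}" using b(2) least fin by auto
      then have "(\<exists>c\<in>R. q \<le> c) = (\<exists>c\<in>R. b \<le> c)" by blast
      moreover have "\<exists>c\<in>R. q \<le> c" using R(3) q by blast
      ultimately show "V (next_point R q) = V (next_point R b)"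
        unfolding next_point_def \<open>{c \<in> R. q \<le> c} = {c \<in> R. b \<le> c}\<close> by simp
    qed (use q in simp_all)
    finally show ?thesis using insert by simp
  qed
qed

text \<open>The difference is one stopping sum, over the finer partition, for the family
  \<open>V b - V (\<nu> b)\<close>. Its increments are small relative to those of \<open>Q\<close>,
  and orthogonality prevents the errors from accumulating.\<close>

lemma partition_sum_refine_le:
  assumes x: "x \<in> X" and t: "t > 0" and e: "e \<ge> 0"
    and R: "finite R" "R \<subseteq> {0<..<t}" and P: "finite P" "P \<subseteq> {0<..<t}" "R \<subseteq> P"
    and close: "\<And>r. 0 < r \<Longrightarrow> r \<le> t \<Longrightarrow> norm (V r x - V (next_point (insert t R) r) x) \<le> e"
  shows "norm (partition_sum t P x - partition_sum t R x) \<le> e"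
proof (cases "x = 0")
  case True
  have "partition_sum t P 0 = 0" "partition_sum t R 0 = 0"
    using partition_sum_lin(3)[OF P(1,2) t, of 0] partition_sum_lin(3)[OF R t, of 0] by simp_all
  then show ?thesis using True e by simp
next
  case False
  define \<nu> where "\<nu> = next_point (insert t R)"
  \<comment> \<open>This holds for every \<open>b\<close>, as \<open>next_point\<close> returns its
    argument when no partition point lies beyond it.\<close>
  have \<nu>: "b \<le> \<nu> b" for b unfolding \<nu>_def using R(1) by (intro next_point(1)) simp
  have "insert t R \<union> insert t P = insert t P" using P(3) by blast
  then have "partition_sum t R x = step_sum Q (\<lambda>b. V (\<nu> b)) 0 (sorted_list_of_set (insert t P)) x"
    using step_sum_refine[of "insert t P" t "insert t R" x] P R t
    unfolding partition_sum_def \<nu>_def by force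
  then have "partition_sum t P x - partition_sum t R x =
      step_sum Q (\<lambda>b y. V b y - V (\<nu> b) y) 0 (sorted_list_of_set (insert t P)) x"
    unfolding partition_sum_def by (simp add: step_sum_diff)
  \<comment> \<open>The product identity, divided by \<open>\<parallel>x\<parallel>\<^sup>2\<close>,
    gives the constant; this is why \<open>x = 0\<close> was set apart.\<close>
  moreover have "(norm (step_sum Q (\<lambda>b y. V b y - V (\<nu> b) y) 0 (sorted_list_of_set (insert t P)) x))\<^sup>2 \<le>
      (e\<^sup>2 / (norm x)\<^sup>2) * ((norm (Q t x))\<^sup>2 - (norm (Q 0 x))\<^sup>2)"
  proof (rule norm_step_sum_le[OF compatible_V_diff[OF \<nu>]])
    show "sorted (0 # sorted_list_of_set (insert t P))"
      "\<And>b. b \<in> set (0 # sorted_list_of_set (insert t P)) \<Longrightarrow> b \<le> t"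
      using partition_list[OF P(1,2) t] by auto
    fix a b assume ab: "0 \<le> a" "a \<le> b" and b: "b \<in> set (sorted_list_of_set (insert t P))"
    then have "b \<in> insert t P" using P(1) by (simp del: sorted_list_of_set_insert_remove)
    then have bt: "0 < b" "b \<le> t" using P(2) t by auto
    have "(norm (V b (Q b x - Q a x) - V (\<nu> b) (Q b x - Q a x)))\<^sup>2 * (norm x)\<^sup>2 =
        (norm (Q b x - Q a x))\<^sup>2 * (norm (V b x - V (\<nu> b) x))\<^sup>2"
      by (rule V_diff_increment[OF x ab \<nu>])
    also have "\<dots> \<le> (norm (Q b x - Q a x))\<^sup>2 * e\<^sup>2"
      using close[OF bt] unfolding \<nu>_def by (intro mult_left_mono power_mono) simp_all
    finally show "(norm (V b (Q b x - Q a x) - V (\<nu> b) (Q b x - Q a x)))\<^sup>2 \<le>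
        e\<^sup>2 / (norm x)\<^sup>2 * (norm (Q b x - Q a x))\<^sup>2"
      using False by (simp add: field_simps)
  qed simp_all
  moreover have "(e\<^sup>2 / (norm x)\<^sup>2) * ((norm (Q t x))\<^sup>2 - (norm (Q 0 x))\<^sup>2) \<le> (e\<^sup>2 / (norm x)\<^sup>2) * (norm x)\<^sup>2"
    using norm_Q_le[of t x] by (intro mult_left_mono) (simp_all add: Q_zero power_mono)
  ultimately have "(norm (partition_sum t P x - partition_sum t R x))\<^sup>2 \<le> e\<^sup>2"
    using False by simp
  then show ?thesis using e by (rule power2_le_imp_le)
qed

section \<open>Convergence at finite horizon\<close>

lemma fine_partition_exists:
  assumes t: "t > 0" and e: "e > 0"
  obtains R where "finite R" "R \<subseteq> {0<..<t}"
    "\<And>r. 0 < r \<Longrightarrow> r \<le> t \<Longrightarrow> norm (V r x - V (next_point (insert t R) r) x) \<le> e"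
proof -
  have "uniformly_continuous_on {0..t} (\<lambda>r. V r x)"
    by (intro compact_uniformly_continuous continuous_on_subset[OF continuous]) auto
  then obtain d where d: "d > 0"
    "\<And>r s. r \<in> {0..t} \<Longrightarrow> s \<in> {0..t} \<Longrightarrow> dist s r < d \<Longrightarrow> dist (V s x) (V r x) < e"
    unfolding uniformly_continuous_on_def using e by metis
  \<comment> \<open>Half of the modulus \<open>d\<close>, so that a grid of mesh \<open>h\<close>
    meets the strict inequality in uniform continuity.\<close>
  define h where "h = d / 2"
  have h: "h > 0" "h < d" using d(1) by (simp_all add: h_def)
  define R where "R = {c \<in> (\<lambda>k. real k * h) ` {..nat \<lceil>t / h\<rceil>}. 0 < c \<and> c < t}"
  have fin: "finite R" and sub: "R \<subseteq> {0<..<t}" unfolding R_def by auto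
  have "norm (V r x - V (next_point (insert t R) r) x) \<le> e" if r: "0 < r" "r \<le> t" for r
  proof -
    \<comment> \<open>\<open>c = k h\<close> is the first grid point at or beyond
      \<open>r\<close>.\<close>
    define k where "k = nat \<lceil>r / h\<rceil>"
    define c where "c = real k * h"
    have rk: "r / h \<le> real k" "real k < r / h + 1"
      using r h unfolding k_def by (auto simp: of_nat_nat ceiling_correct) linarith+
    have c: "r \<le> c" "c < r + d"
      using rk h unfolding c_def by (auto simp: field_simps)
    have k: "k \<le> nat \<lceil>t / h\<rceil>"
      unfolding k_def using r h by (intro nat_mono ceiling_mono divide_right_mono) simp_all
    have "\<exists>c\<in>insert t R. r \<le> c \<and> c < r + d"
    proof (cases "c < t")
      case True
      then have "c \<in> R" unfolding R_def using c(1) r k c_def by auto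
      then show ?thesis using c by blast
    \<comment> \<open>If this grid point is not below \<open>t\<close>, then \<open>t\<close> itself
      lies between \<open>r\<close> and \<open>r + d\<close>.\<close>
    qed (use r c in auto)
    then obtain c' where c': "c' \<in> insert t R" "r \<le> c'" "c' < r + d" by blast
    have "next_point (insert t R) r \<in> insert t R" "next_point (insert t R) r \<le> c'" "r \<le> next_point (insert t R) r"
      using next_point(1)[of "insert t R" r] next_point(2,3)[of "insert t R" c' r] fin c'
      by simp_all
    then have "next_point (insert t R) r \<in> {0..t}" "dist (next_point (insert t R) r) r < d"
      using sub t c' by (auto simp: dist_real_def)
    then show ?thesis
      using d(2)[of r "next_point (insert t R) r"] r by (simp add: dist_norm norm_minus_commute)
  qed
  then show thesis using that fin sub by blast
qed

lemma eventually_partition: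
  "finite R \<Longrightarrow> R \<subseteq> A \<Longrightarrow> \<forall>\<^sub>F P in finite_subsets_at_top A. finite P \<and> P \<subseteq> A \<and> R \<subseteq> P"
  unfolding eventually_finite_subsets_at_top by blast

text \<open>On \<open>X\<close> the sum of a fine partition approximates the sums of all its
  refinements. Linearity and the uniform bound extend convergence to the closed span.\<close>

lemma partition_sum_converges:
  assumes t: "t > 0"
  shows "\<exists>l. ((\<lambda>R. partition_sum t R x) \<longlongrightarrow> l) (finite_subsets_at_top {0<..<t})"
proof -
  let ?F = "finite_subsets_at_top {0<..<t}"
  have part: "\<forall>\<^sub>F R in ?F. finite R \<and> R \<subseteq> {0<..<t}"
    using eventually_partition[of "{}" "{0<..<t}"] by simp
  have "x \<in> closure (cspan X)" unfolding total by simp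
  then show ?thesis
  proof (induction rule: closure_span_induct)
    case (base x)
    show ?case
    proof (rule net_converges)
      fix e :: real assume e: "e > 0"
      \<comment> \<open>The sum over this one partition is the reference point required by
        \<open>net_converges\<close>.\<close>
      obtain R where R: "finite R" "R \<subseteq> {0<..<t}"
        "\<And>r. 0 < r \<Longrightarrow> r \<le> t \<Longrightarrow> norm (V r x - V (next_point (insert t R) r) x) \<le> e"
        by (rule fine_partition_exists[OF t e]) (rule that)
      have "\<forall>\<^sub>F P in ?F. norm (partition_sum t P x - partition_sum t R x) \<le> e"
        using eventually_partition[OF R(1,2)]
        by eventually_elim (use partition_sum_refine_le[OF base t _ R(1,2) _ _ _ R(3)] e in auto)
      then show "\<exists>y. \<forall>\<^sub>F P in ?F. norm (partition_sum t P x - y) \<le> e" by blast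
    qed simp
  next
    case zero
    have "\<forall>\<^sub>F R in ?F. partition_sum t R 0 = 0"
      using part by eventually_elim (use partition_sum_lin(3)[OF _ _ t, of _ 0] in auto)
    then show ?case by (intro exI tendsto_eventually)
  next
    case (add x y)
    then obtain l m where "((\<lambda>R. partition_sum t R x) \<longlongrightarrow> l) ?F" "((\<lambda>R. partition_sum t R y) \<longlongrightarrow> m) ?F"
      by blast
    then have "((\<lambda>R. partition_sum t R x + partition_sum t R y) \<longlongrightarrow> l + m) ?F" by (rule tendsto_add)
    moreover have "\<forall>\<^sub>F R in ?F. partition_sum t R x + partition_sum t R y = partition_sum t R (x + y)"
      using part by eventually_elim (use partition_sum_lin(1)[OF _ _ t] in auto)
    ultimately show ?case by (intro exI) (rule Lim_transform_eventually)
  next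
    case (scale c x)
    then obtain l where "((\<lambda>R. partition_sum t R x) \<longlongrightarrow> l) ?F" by blast
    then have "((\<lambda>R. scaleC c (partition_sum t R x)) \<longlongrightarrow> scaleC c l) ?F" by (rule tendsto_scaleC)
    moreover have "\<forall>\<^sub>F R in ?F. scaleC c (partition_sum t R x) = partition_sum t R (scaleC c x)"
      using part by eventually_elim (use partition_sum_lin(2)[OF _ _ t] in auto)
    ultimately show ?case by (intro exI) (rule Lim_transform_eventually)
  next
    case (limit f x)
    show ?case
    proof (rule net_converges)
      fix e :: real assume e: "e > 0"
      have "(\<lambda>n. K * norm (f n - x)) \<longlonglongrightarrow> 0"
        using limit(2) by (intro tendsto_mult_right_zero) (simp add: LIM_zero_iff tendsto_norm_zero_iff)
      then have "\<forall>\<^sub>F n in sequentially. K * norm (f n - x) < e / 2"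
        using e by (intro order_tendstoD(2)[where y=0]) simp_all
      then obtain n where n: "K * norm (f n - x) < e / 2"
        using eventually_happens'[OF sequentially_bot] by blast
      obtain l where l: "((\<lambda>R. partition_sum t R (f n)) \<longlongrightarrow> l) ?F" using limit(4) by blast
      have "\<forall>\<^sub>F R in ?F. norm (partition_sum t R (f n) - l) < e / 2"
        using tendstoD[OF l, of "e / 2"] e by (simp add: dist_norm)
      with part have "\<forall>\<^sub>F R in ?F. norm (partition_sum t R x - l) \<le> e"
      proof eventually_elim
        case (elim R)
        \<comment> \<open>The last term is at most \<open>K * norm (f n - x)\<close> for every
          partition, so \<open>n\<close> can be fixed before \<open>R\<close>.\<close>
        have eq: "partition_sum t R x - l = (partition_sum t R (f n) - l) - partition_sum t R (f n - x)"
          using elim partition_sum_diff[OF _ _ t, of R "f n" x] by simp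
        have "norm (partition_sum t R (f n - x)) \<le> K * norm (f n - x)"
          using elim partition_sum_lin(3)[OF _ _ t] by blast
        then show ?case
          unfolding eq using norm_triangle_ineq4[of "partition_sum t R (f n) - l" "partition_sum t R (f n - x)"] elim n
          by linarith
      qed
      then show "\<exists>y. \<forall>\<^sub>F R in ?F. norm (partition_sum t R x - y) \<le> e" by blast
    qed simp
  qed
qed

section \<open>The stopped operator and the limit of infinite horizon\<close>

definition stop_at :: "real \<Rightarrow> 'a \<Rightarrow> 'a" where
  "stop_at t x = Lim (finite_subsets_at_top {0<..<t}) (\<lambda>R. partition_sum t R x)"

lemma partition_sum_tendsto:
  assumes "t > 0"
  shows "((\<lambda>R. partition_sum t R x) \<longlongrightarrow> stop_at t x) (finite_subsets_at_top {0<..<t})"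
  using partition_sum_converges[OF assms, of x] tendsto_Lim unfolding stop_at_def
  by (metis finite_subsets_at_top_neq_bot)

lemma stop_at_lin:
  assumes t: "t > 0"
  shows "stop_at t (x + y) = stop_at t x + stop_at t y"
    and "stop_at t (scaleC c x) = scaleC c (stop_at t x)"
    and "norm (stop_at t x) \<le> K * norm x"
proof -
  let ?F = "finite_subsets_at_top {0<..<t}"
  have part: "\<forall>\<^sub>F R in ?F. finite R \<and> R \<subseteq> {0<..<t}"
    using eventually_partition[of "{}" "{0<..<t}"] by simp
  note lim = partition_sum_tendsto[OF t]
  have "\<forall>\<^sub>F R in ?F. partition_sum t R x + partition_sum t R y = partition_sum t R (x + y)"
    using part by eventually_elim (use partition_sum_lin(1)[OF _ _ t] in auto)
  from Lim_transform_eventually[OF tendsto_add[OF lim lim] this]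
  show "stop_at t (x + y) = stop_at t x + stop_at t y"
    using lim tendsto_unique[OF finite_subsets_at_top_neq_bot] by blast
  have "\<forall>\<^sub>F R in ?F. scaleC c (partition_sum t R x) = partition_sum t R (scaleC c x)"
    using part by eventually_elim (use partition_sum_lin(2)[OF _ _ t] in auto)
  from Lim_transform_eventually[OF tendsto_scaleC[OF lim] this]
  show "stop_at t (scaleC c x) = scaleC c (stop_at t x)"
    using lim tendsto_unique[OF finite_subsets_at_top_neq_bot] by blast
  have "\<forall>\<^sub>F R in ?F. norm (partition_sum t R x) \<le> K * norm x"
    using part by eventually_elim (use partition_sum_lin(3)[OF _ _ t] in auto)
  then show "norm (stop_at t x) \<le> K * norm x"
    by (rule tendsto_upperbound[OF tendsto_norm[OF lim]]) simp
qed

text \<open>If \<open>s\<close> is a partition point, the ordered list splits there. The part up to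
  \<open>s\<close> is the list of the restricted partition and cancels, leaving a stopping sum that
  starts at \<open>s\<close>.\<close>

lemma partition_sum_restrict:
  assumes s: "0 < s" "s < t" and R: "finite R" "R \<subseteq> {0<..<t}" "s \<in> R"
  shows "(norm (partition_sum t R x - partition_sum s (R \<inter> {0<..<s}) x))\<^sup>2 \<le>
    K\<^sup>2 * ((norm (Q t x))\<^sup>2 - (norm (Q s x))\<^sup>2)"
proof -
  define bs where "bs = sorted_list_of_set (R \<inter> {0<..<s})"
  define C where "C = insert t (R \<inter> {s<..<t})"
  define cs where "cs = sorted_list_of_set C"
  have C: "finite C" using R(1) by (simp add: C_def)
  have bs: "sorted bs" "distinct bs" "set bs = R \<inter> {0<..<s}"
    and cs: "sorted cs" "distinct cs" "set cs = C"
    unfolding bs_def cs_def using R(1) C by simp_all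
  note cs = cs[unfolded C_def]
  have "sorted (bs @ s # cs)" "distinct (bs @ s # cs)"
    using bs cs s by (auto simp: sorted_append)
  moreover have "set (bs @ s # cs) = insert t R" using bs(3) cs(3) R s by auto
  ultimately have t_list: "sorted_list_of_set (insert t R) = bs @ s # cs"
    using sorted_list_of_set.idem_if_sorted_distinct by metis
  have "sorted (bs @ [s])" "distinct (bs @ [s])" "set (bs @ [s]) = insert s (R \<inter> {0<..<s})"
    using bs by (auto simp: sorted_append)
  then have s_list: "sorted_list_of_set (insert s (R \<inter> {0<..<s})) = bs @ [s]"
    using sorted_list_of_set.idem_if_sorted_distinct by metis
  have "partition_sum t R x - partition_sum s (R \<inter> {0<..<s}) x = step_sum Q V s cs x"
    unfolding partition_sum_def t_list s_list step_sum_append[of _ _ _ bs s cs] by simp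
  moreover have "(norm (step_sum Q V s cs x))\<^sup>2 \<le> K\<^sup>2 * ((norm (Q t x))\<^sup>2 - (norm (Q s x))\<^sup>2)"
    using cs s by (intro norm_step_sum_V_le) auto
  ultimately show ?thesis by simp
qed

text \<open>The two limits run over different directed sets. Intersection with
  \<open>{0<..<s}\<close> carries refinement at horizon \<open>t\<close> to refinement at horizon
  \<open>s\<close>, so both become limits over the same filter, along which \<open>s\<close> is
  eventually a partition point.\<close>

lemma norm_stop_at_diff_le:
  assumes s: "0 < s" "s < t"
  shows "(norm (stop_at t x - stop_at s x))\<^sup>2 \<le> K\<^sup>2 * ((norm (Q t x))\<^sup>2 - (norm (Q s x))\<^sup>2)"
proof (rule tendsto_upperbound)
  have "filterlim (\<lambda>R. R \<inter> {0<..<s}) (finite_subsets_at_top {0<..<s}) (finite_subsets_at_top {0<..<t})"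
    unfolding filterlim_iff eventually_finite_subsets_at_top
  proof (intro allI impI, elim exE conjE)
    fix P :: "real set \<Rightarrow> bool" and R
    assume R: "finite R" "R \<subseteq> {0<..<s}" "\<forall>Y. finite Y \<and> R \<subseteq> Y \<and> Y \<subseteq> {0<..<s} \<longrightarrow> P Y"
    have "P (Y \<inter> {0<..<s})" if "finite Y" "R \<subseteq> Y" for Y
      using R(3)[rule_format, of "Y \<inter> {0<..<s}"] R(2) that by simp
    moreover have "R \<subseteq> {0<..<t}" using R(2) s by fastforce
    ultimately show "\<exists>X. finite X \<and> X \<subseteq> {0<..<t} \<and>
        (\<forall>Y. finite Y \<and> X \<subseteq> Y \<and> Y \<subseteq> {0<..<t} \<longrightarrow> P (Y \<inter> {0<..<s}))"
      using R(1) by blast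
  qed
  from filterlim_compose[OF partition_sum_tendsto[OF s(1)] this]
  show "((\<lambda>R. (norm (partition_sum t R x - partition_sum s (R \<inter> {0<..<s}) x))\<^sup>2) \<longlongrightarrow>
      (norm (stop_at t x - stop_at s x))\<^sup>2) (finite_subsets_at_top {0<..<t})"
    using partition_sum_tendsto[of t] s by (intro tendsto_intros) auto
  show "\<forall>\<^sub>F R in finite_subsets_at_top {0<..<t}.
      (norm (partition_sum t R x - partition_sum s (R \<inter> {0<..<s}) x))\<^sup>2 \<le> K\<^sup>2 * ((norm (Q t x))\<^sup>2 - (norm (Q s x))\<^sup>2)"
    using eventually_partition[of "{s}" "{0<..<t}"] s
    by (auto elim!: eventually_mono intro!: partition_sum_restrict)
qed simp

lemma stop_at_converges: "\<exists>l. ((\<lambda>t. stop_at t x) \<longlongrightarrow> l) at_top"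
proof (rule net_converges)
  fix e :: real assume e: "e > 0"
  define m where "m = (SUP r\<in>{0<..}. (norm (Q r x))\<^sup>2)"
  \<comment> \<open>The summand 1 keeps the denominator positive for \<open>K = 0\<close>, and still
    gives \<open>K\<^sup>2 * \<delta> \<le> e\<^sup>2\<close>.\<close>
  define \<delta> where "\<delta> = e\<^sup>2 / (K\<^sup>2 + 1)"
  have K1: "K\<^sup>2 + 1 > 0" by (simp add: add_nonneg_pos)
  then have \<delta>: "\<delta> > 0" using e by (simp add: \<delta>_def)
  have bdd: "bdd_above ((\<lambda>r. (norm (Q r x))\<^sup>2) ` {0<..})"
    by (intro bdd_aboveI2[where M="(norm x)\<^sup>2"] power_mono norm_Q_le) simp
  have "\<exists>s\<in>{0<..}. m - \<delta> < (norm (Q s x))\<^sup>2"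
    using \<delta> less_cSUP_iff[OF _ bdd, of "m - \<delta>"] unfolding m_def by auto
  then obtain s where s: "s > 0" "m - \<delta> < (norm (Q s x))\<^sup>2" by auto
  have "norm (stop_at t x - stop_at s x) \<le> e" if t: "t > s" for t
  proof -
    have "(norm (Q t x))\<^sup>2 \<le> m" unfolding m_def using t s by (intro cSUP_upper[OF _ bdd]) simp
    then have "(norm (Q t x))\<^sup>2 - (norm (Q s x))\<^sup>2 \<le> \<delta>" using s by linarith
    then have "K\<^sup>2 * ((norm (Q t x))\<^sup>2 - (norm (Q s x))\<^sup>2) \<le> K\<^sup>2 * \<delta>" by (simp add: mult_left_mono)
    also have "\<dots> \<le> (K\<^sup>2 + 1) * \<delta>" using \<delta> by (simp add: algebra_simps)
    also have "\<dots> = e\<^sup>2" using K1 by (simp add: \<delta>_def)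
    finally have "(norm (stop_at t x - stop_at s x))\<^sup>2 \<le> e\<^sup>2"
      using norm_stop_at_diff_le[OF s(1) t, of x] by linarith
    then show ?thesis by (rule power2_le_imp_le) (use e in simp)
  qed
  then have "\<forall>\<^sub>F t in at_top. norm (stop_at t x - stop_at s x) \<le> e"
    unfolding eventually_at_top_dense by blast
  then show "\<exists>y. \<forall>\<^sub>F t in at_top. norm (stop_at t x - y) \<le> e" by blast
qed simp

lemma stop_at_tendsto: "((\<lambda>t. stop_at t x) \<longlongrightarrow> Lim at_top (\<lambda>t. stop_at t x)) at_top"
  using stop_at_converges[of x] tendsto_Lim by (metis trivial_limit_at_top_linorder)

lemma linear_bound_stop: "linear_bound UNIV K (\<lambda>x. Lim at_top (\<lambda>t. stop_at t x))"
proof -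
  note lim = stop_at_tendsto
  have pos: "\<forall>\<^sub>F t in at_top. (0::real) < t" by (rule eventually_gt_at_top)
  show ?thesis
    unfolding linear_bound_def
  proof (intro conjI ballI allI)
    fix x
    show "Lim at_top (\<lambda>t. stop_at t (x + y)) = Lim at_top (\<lambda>t. stop_at t x) + Lim at_top (\<lambda>t. stop_at t y)" for y
    proof -
      have "\<forall>\<^sub>F t in at_top. stop_at t x + stop_at t y = stop_at t (x + y)"
        using pos by eventually_elim (simp add: stop_at_lin)
      from Lim_transform_eventually[OF tendsto_add[OF lim lim] this]
      show ?thesis using lim tendsto_unique[OF trivial_limit_at_top_linorder] by blast
    qed
    show "Lim at_top (\<lambda>t. stop_at t (scaleC c x)) = scaleC c (Lim at_top (\<lambda>t. stop_at t x))" for c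
    proof -
      have "\<forall>\<^sub>F t in at_top. scaleC c (stop_at t x) = stop_at t (scaleC c x)"
        using pos by eventually_elim (simp add: stop_at_lin)
      from Lim_transform_eventually[OF tendsto_scaleC[OF lim] this]
      show ?thesis using lim tendsto_unique[OF trivial_limit_at_top_linorder] by blast
    qed
    have "\<forall>\<^sub>F t in at_top. norm (stop_at t x) \<le> K * norm x"
      using pos by eventually_elim (simp add: stop_at_lin)
    then show "norm (Lim at_top (\<lambda>t. stop_at t x)) \<le> K * norm x"
      by (rule tendsto_upperbound[OF tendsto_norm[OF lim]]) simp
  qed
qed

end

text \<open>Since \<open>Lim\<close> is total, being well defined is expressed by convergence to
  \<open>stopped\<close> at every vector, which is strong convergence, together with boundedness and
  linearity of the limit.\<close>

theorem corollary6p6: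
  fixes eps :: "(real \<Rightarrow> 'k::chilbert_space) \<Rightarrow> 'f::chilbert_space"
    and tens :: "'h::chilbert_space \<Rightarrow> 'f \<Rightarrow> 'g::chilbert_space"
    and M :: "('h \<Rightarrow> 'h) set"
    and p :: "'k \<Rightarrow> 'k"
    and S :: "ennreal set \<Rightarrow> 'f \<Rightarrow> 'f"
    and V :: "real \<Rightarrow> 'g \<Rightarrow> 'g"
  assumes "ampliated_fock_space eps tens"
    and "von_neumann_algebra M"
    and "orth_projection p"
    and "fock_space.finite_stop_time eps S"
    and "ampliated_fock_space.adapted_cocycle eps tens M p V"
    and "ampliated_fock_space.isometric_process eps tens p V"
    and "ampliated_fock_space.strongly_continuous V"
  shows "ampliated_fock_space.stopped tens V S \<in> bop UNIV \<and>
    (\<forall>x. ((\<lambda>t. ampliated_fock_space.stopped_at tens V S t x) \<longlongrightarrow>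
            ampliated_fock_space.stopped tens V S x) at_top)"
proof -
  interpret ampliated_fock_space eps tens by fact
  interpret stopped_cocycle eps tens M p S V
    by unfold_locales (use assms in simp_all)
  obtain K where K: "K \<ge> 0" "\<And>t. t \<ge> 0 \<Longrightarrow> linear_bound UNIV K (V t)"
    by (rule uniform_linear_bound) (rule that)
  \<comment> \<open>Tensors with exponential vectors: the vectors for which
    \<open>past_proj_exponential\<close> was proved.\<close>
  define X where "X = (\<lambda>(u, x). tens u x) ` (UNIV \<times> eps ` L2 {0..})"
  interpret stopping_family V past_proj K X
  proof
    show "closure (cspan X) = UNIV"
      unfolding X_def using tensor_total[of UNIV "eps ` L2 {0..}" tens] hilbert_tensor_tens
      by (simp add: total_eps)
    show "cinner (V s x - V t x) (V s (past_proj r x) - V t (past_proj r x)) * cinner x x =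
      cinner x (past_proj r x) * cinner (V s x - V t x) (V s x - V t x)"
      if x: "x \<in> X" and r: "0 \<le> r" "r \<le> s" "r \<le> t" for x r s t
    proof -
      obtain u f where "f \<in> L2 {0..}" "x = tens u (eps f)" using x unfolding X_def by auto
      then show ?thesis by (rule past_proj_exponential[OF r])
    qed
    show "continuous_on {0..} (\<lambda>r. V r x)" for x
      using assms(7) unfolding strongly_continuous_def by blast
  qed (use K in \<open>simp_all add: linear_bound_past_proj past_proj_zero cinner_past_proj
      past_proj_mult past_proj_commute\<close>)
  have sum_eq: "stop_sum V S t R x = partition_sum t R x"
    if R: "finite R" "R \<subseteq> {0<..<t}" and t: "t > 0" for t R x
  proof -
    let ?bs = "sorted_list_of_set (insert t R)"
    note list = partition_list[OF R t]
    \<comment> \<open>All points of \<open>insert t R\<close> are positive, so the sorted list of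
      \<open>stop_sum\<close> begins with 0, the left endpoint passed separately to
      \<open>step_sum\<close>.\<close>
    have "distinct (0 # ?bs)" "set (0 # ?bs) = insert 0 (insert t R)"
      using R t by (auto simp del: sorted_list_of_set_insert_remove)
    with list(1) have eq: "sorted_list_of_set (insert 0 (insert t R)) = 0 # ?bs"
      using sorted_list_of_set.idem_if_sorted_distinct by metis
    have "ampliation (S {ennreal ((0 # ?bs) ! (j - 1))<..ennreal ((0 # ?bs) ! j)}) x =
        past_proj ((0 # ?bs) ! j) x - past_proj ((0 # ?bs) ! (j - 1)) x"
      if j: "j \<in> {1..<length (0 # ?bs)}" for j
    proof (rule ampliation_increment)
      have "(0 # ?bs) ! (j - 1) \<in> {0..t}"
        by (rule subsetD[OF list(2) nth_mem]) (use j in auto)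
      then show "0 \<le> (0 # ?bs) ! (j - 1)" by simp
      show "(0 # ?bs) ! (j - 1) \<le> (0 # ?bs) ! j" using j by (intro sorted_nth_mono[OF list(1)]) auto
    qed
    then show ?thesis
      unfolding stop_sum_def partition_sum_def step_sum_conv_sum Let_def eq
      by (intro sum.cong refl) simp
  qed
  \<comment> \<open>Agreement at positive horizons is enough for the limit at infinity.\<close>
  have at_eq: "stopped_at V S t x = stop_at t x" if t: "t > 0" for t x
  proof -
    have "\<forall>\<^sub>F R in finite_subsets_at_top {0<..<t}. partition_sum t R x = stop_sum V S t R x"
      using eventually_partition[of "{}" "{0<..<t}"] sum_eq[OF _ _ t] by (auto elim!: eventually_mono)
    from Lim_transform_eventually[OF partition_sum_tendsto[OF t] this]
    show ?thesis unfolding stopped_at_def by (intro tendsto_Lim) simp_all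
  qed
  have "\<forall>\<^sub>F t in at_top. stop_at t x = stopped_at V S t x" for x
    using eventually_gt_at_top[of "0::real"] by eventually_elim (simp add: at_eq)
  from Lim_transform_eventually[OF stop_at_tendsto this]
  have lim: "((\<lambda>t. stopped_at V S t x) \<longlongrightarrow> Lim at_top (\<lambda>t. stop_at t x)) at_top" for x .
  then have stopped: "stopped V S x = Lim at_top (\<lambda>t. stop_at t x)" for x
    unfolding stopped_def by (intro tendsto_Lim) simp_all
  have "stopped V S = (\<lambda>x. Lim at_top (\<lambda>t. stop_at t x))" using stopped by (rule ext)
  then have "stopped V S \<in> bop UNIV"
    using linear_bound_stop K(1) unfolding bop_iff by auto
  then show ?thesis using lim unfolding stopped by blast
qed

end
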